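(* The sequence $\{\widehat m_n\}_{n\ge1}$ has a subsequence converging in the weak star topology to a probability measure $\widehat\mu$ on the Hofbauer tower $\widehat M$ such that $\pi_*\widehat\mu=\mu$.
   Context: **Setting.** $M=[0,1]$ with Lebesgue measure $m$. For a sub-interval $W\subset M$ (of positive length) write $|W|=m(W)$. $T:M\to M$ is a map with a countable partition $\xi_1$ of $M$ into sub-intervals such that $T$ is strictly monotonic and $C^1$ on the interior of each element of $\xi_1$. Put $\xi_n=\bigvee_{k=0}^{n-1}T^{-k}\xi_1$, let $\mathcal S_n$ be the set of endpoints of intervals in $\xi_n$, and $\mathcal S_\infty=\bigcup_{n\ge1}\mathcal S_n$. For an interval $W$, $\{W_\alpha\}_{\alpha\in W/\xi_n}$ is the partition of $W$ into sub-intervals induced by $\xi_n$; the intervals $T^nW_\alpha$ are called the components of $T^nW$. For $x,y\in M\setminus\mathcal S_\infty$, the separation time $\mathbf s(x,y)$ is the smallest integer $n\ge1$ such that $x,y$ lie in distinct elements of $\xi_n$. For an interval $W$ and $\gamma\in(0,1)$, $\mathcal H_{W,\gamma}$ is the space of $f:M\to\mathbb R$ vanishing outside $W$ with $|f|_{W,\gamma}:=\sup\{|f(x)-f(y)|/\gamma^{\mathbf s(x,y)}: x\ne y\in W\setminus\mathcal S_\infty\}<\infty$. **Standing assumptions.** (H1) There is $q\in(0,1]$ with $\liminf_{\delta\to0}\sup_{W:|W|<\delta}\sum_{\alpha\in W/\xi_1}\left(\frac{|W|}{|TW_\alpha|}\right)^{q}\frac{|W_\alpha|}{|W|}<1$ (sup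 over sub-intervals $W\subset M$). (H2) There are $C_{\mathbf J}>0$, $\gamma_{\mathbf J}\in(0,1)$ such that for every $W\in\xi_1$, $\mathbf 1_W\log|T'|\in\mathcal H_{W,\gamma_{\mathbf J}}$ with $|\mathbf 1_W\log|T'||_{W,\gamma_{\mathbf J}}\le C_{\mathbf J}$. (H3) There is an interval $U$, called a magnet, such that for any interval $W\subset M$ there is $n_W\ge1$ such that for all $n\ge n_W$ at least one component of $T^nW$ contains $U$. **Invariant measure.** $\mu$ is the absolutely continuous $T$-invariant probability measure to which $T^n_*m$ converges in total variation as $n\to\infty$ (such a measure is known to exist for every map $T$ satisfying (H1), (H2) and (H3)). **Hofbauer tower.** $\mathcal D_0=\{M\}$, $\mathcal D_n=\{T(W\cap V): W\in\xi_1,\ V\in\mathcal D_{n-1}\}$ (over intersections that are intervals) and $\mathcal D=\bigcup_{n\ge0}\mathcal D_n$, a countable collection of intervals. The tower is $\widehat M=\{(x,D)\in M\times\mathcal D: x\in\overline D\}$ with projection $\pi(x,D)=x$; for $D\in\mathcal D$, $\widehat D=\{(x,D):x\in\overline D\}$ is an identical copy of $\overline D$, and $\widehat M$, as the disjoint union of the $\widehat D$, carries the natural extension of the Euclidean metric. The map $\widehat T:\widehat M\setminus\pi^{-1}(\mathcal S_1)\to\widehat M$ is $\widehat T(x,D)=(T(x),T(D\cap W(x)))$, where $W(x)$ is the element of $\xi_1$ containing $x$. The base is $\widehat M_0=\{(x,M):x\in M\}$. Let $\overline m(A)=\sum_{D\in\mathcal D}m(\pi(A\cap\widehat D))$ for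 Borel $A\subset\widehat M$, $\overline m_n(A)=\overline m(\widehat T^{-n}A\cap\widehat M_0)$ for $n\ge0$ (probability measures with $\pi_*\overline m_n=T^n_*m$), and $\widehat m_n=\frac1n\sum_{k=0}^{n-1}\overline m_k$ for $n\ge1$. *)

theory Defs
  imports "HOL-Probability.Probability"
begin

section \<open>Piecewise monotone interval maps\<close>

abbreviation unit_ivl :: "real set" where
  "unit_ivl \<equiv> {0..1}"

abbreviation leb_unit :: "real measure" where
  "leb_unit \<equiv> restrict_space lborel unit_ivl"

abbreviation len :: "real set \<Rightarrow> real" where
  "len W \<equiv> measure lborel W"

definition subinterval :: "real set \<Rightarrow> bool" where
  "subinterval W \<longleftrightarrow> is_interval W \<and> W \<subseteq> unit_ivl \<and> 0 < len W"

text \<open>The elements of the partition may be single points, since an exact countable partition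
  into nondegenerate intervals need not exist (Gauss map: nothing but the point 0 itself is left
  to cover 0). They are Lebesgue null and never contribute to the tower.
  No regularity of the map at the endpoints of the elements is required.\<close>

definition piecewise_monotone_map :: "(real \<Rightarrow> real) \<Rightarrow> real set set \<Rightarrow> bool" where
  "piecewise_monotone_map T \<xi> \<longleftrightarrow>
     T ` unit_ivl \<subseteq> unit_ivl \<and>
     countable \<xi> \<and> partition_on unit_ivl \<xi> \<and> (\<forall>W\<in>\<xi>. is_interval W) \<and>
     (\<forall>W\<in>\<xi>. (strict_mono_on (interior W) T \<or> strict_antimono_on (interior W) T) \<and>
             T C1_differentiable_on interior W)"

definition refined_partition :: "(real \<Rightarrow> real) \<Rightarrow> real set set \<Rightarrow> nat \<Rightarrow> real set set" where
  "refined_partition T \<xi> n =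
     {A. A \<noteq> {} \<and> (\<exists>w. (\<forall>k<n. w k \<in> \<xi>) \<and> A = {x \<in> unit_ivl. \<forall>k<n. (T ^^ k) x \<in> w k})}"

text \<open>The frontier of an interval is the set of its endpoints.\<close>

definition endpoint_set :: "(real \<Rightarrow> real) \<Rightarrow> real set set \<Rightarrow> nat \<Rightarrow> real set" where
  "endpoint_set T \<xi> n = (\<Union>A\<in>refined_partition T \<xi> n. frontier A)"

definition endpoint_set_inf :: "(real \<Rightarrow> real) \<Rightarrow> real set set \<Rightarrow> real set" where
  "endpoint_set_inf T \<xi> = (\<Union>n\<in>{1..}. endpoint_set T \<xi> n)"

definition induced_partition :: "real set \<Rightarrow> real set set \<Rightarrow> real set set" where
  "induced_partition W \<zeta> = {W \<inter> A | A. A \<in> \<zeta> \<and> W \<inter> A \<noteq> {}}"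

definition image_components :: "(real \<Rightarrow> real) \<Rightarrow> real set set \<Rightarrow> nat \<Rightarrow> real set \<Rightarrow> real set set" where
  "image_components T \<xi> n W =
     (\<lambda>W\<^sub>\<alpha>. (T ^^ n) ` W\<^sub>\<alpha>) ` induced_partition W (refined_partition T \<xi> n)"

text \<open>The value is \<open>\<infinity>\<close> for points that are never separated; then \<open>\<gamma>\<^bsup>\<infinity>\<^esup> = 0\<close> and the
  corresponding quotient below is \<open>\<infinity>\<close>, or 0 if the numerator vanishes.\<close>

definition separation_time :: "(real \<Rightarrow> real) \<Rightarrow> real set set \<Rightarrow> real \<Rightarrow> real \<Rightarrow> enat" where
  "separation_time T \<xi> x y =
     Inf {enat n | n. n \<ge> 1 \<and>
       (\<exists>A\<in>refined_partition T \<xi> n. \<exists>B\<in>refined_partition T \<xi> n. A \<noteq> B \<and> x \<in> A \<and> y \<in> B)}"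

definition power_enat :: "real \<Rightarrow> enat \<Rightarrow> real" where
  "power_enat \<gamma> s = (case s of enat n \<Rightarrow> \<gamma> ^ n | \<infinity> \<Rightarrow> 0)"

definition holder_seminorm ::
    "(real \<Rightarrow> real) \<Rightarrow> real set set \<Rightarrow> real set \<Rightarrow> real \<Rightarrow> (real \<Rightarrow> real) \<Rightarrow> ennreal" where
  "holder_seminorm T \<xi> W \<gamma> f =
     (SUP (x, y) \<in> {(x, y). x \<in> W - endpoint_set_inf T \<xi> \<and> y \<in> W - endpoint_set_inf T \<xi> \<and> x \<noteq> y}.
        ennreal \<bar>f x - f y\<bar> / ennreal (power_enat \<gamma> (separation_time T \<xi> x y)))"

definition holder_space ::
    "(real \<Rightarrow> real) \<Rightarrow> real set set \<Rightarrow> real set \<Rightarrow> real \<Rightarrow> (real \<Rightarrow> real) set" where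
  "holder_space T \<xi> W \<gamma> = {f. (\<forall>x. x \<notin> W \<longrightarrow> f x = 0) \<and> holder_seminorm T \<xi> W \<gamma> f < \<infinity>}"


section \<open>Standing assumptions\<close>

definition H1 :: "(real \<Rightarrow> real) \<Rightarrow> real set set \<Rightarrow> bool" where
  "H1 T \<xi> \<longleftrightarrow>
     (\<exists>q::real. 0 < q \<and> q \<le> 1 \<and>
        Liminf (at_right (0::real))
          (\<lambda>\<delta>. SUP W \<in> {W. subinterval W \<and> len W < \<delta>}.
             \<Sum>\<^sub>\<infinity>W\<^sub>\<alpha>\<in>induced_partition W \<xi>.
               ennreal ((len W / len (T ` W\<^sub>\<alpha>)) powr q * (len W\<^sub>\<alpha> / len W))) < 1)"

text \<open>The convention \<open>ln 0 = 0\<close> is harmless: in the presence of a critical point of \<open>T\<close> inside \<open>W\<close>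
  the oscillation of \<open>ln \<bar>T'\<bar>\<close> over \<open>W\<close> is infinite.\<close>

definition H2 :: "(real \<Rightarrow> real) \<Rightarrow> real set set \<Rightarrow> bool" where
  "H2 T \<xi> \<longleftrightarrow>
     (\<exists>C \<gamma>::real. 0 < C \<and> 0 < \<gamma> \<and> \<gamma> < 1 \<and>
        (\<forall>W\<in>\<xi>. (\<lambda>x. indicator W x * ln \<bar>deriv T x\<bar>) \<in> holder_space T \<xi> W \<gamma> \<and>
               holder_seminorm T \<xi> W \<gamma> (\<lambda>x. indicator W x * ln \<bar>deriv T x\<bar>) \<le> ennreal C))"

definition H3 :: "(real \<Rightarrow> real) \<Rightarrow> real set set \<Rightarrow> bool" where
  "H3 T \<xi> \<longleftrightarrow>
     (\<exists>U. subinterval U \<and>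
        (\<forall>W. subinterval W \<longrightarrow>
           (\<exists>n\<^sub>W\<ge>1. \<forall>n\<ge>n\<^sub>W. \<exists>V\<in>image_components T \<xi> n W. U \<subseteq> V)))"


section \<open>The invariant measure\<close>

definition tv_dist :: "real measure \<Rightarrow> real measure \<Rightarrow> real" where
  "tv_dist \<mu> \<nu> = (SUP A\<in>sets leb_unit. \<bar>measure \<mu> A - measure \<nu> A\<bar>)"

definition limit_acip :: "(real \<Rightarrow> real) \<Rightarrow> real measure \<Rightarrow> bool" where
  "limit_acip T \<mu> \<longleftrightarrow>
     sets \<mu> = sets leb_unit \<and> prob_space \<mu> \<and>
     absolutely_continuous leb_unit \<mu> \<and>
     distr \<mu> leb_unit T = \<mu> \<and>
     (\<lambda>n. tv_dist (distr leb_unit leb_unit (T ^^ n)) \<mu>) \<longlonglongrightarrow> 0"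


section \<open>The Hofbauer tower\<close>

text \<open>The image \<open>T J\<close> of an interval \<open>J\<close> contained in an element of the partition. Whenever \<open>T ` J\<close>
  is an interval, \<open>branch_image T J = T ` J\<close>; in general the intersection only discards values
  of \<open>T\<close> at endpoints of \<open>J\<close> that are isolated in \<open>T ` J\<close>, so that the result is an interval.\<close>

definition branch_image :: "(real \<Rightarrow> real) \<Rightarrow> real set \<Rightarrow> real set" where
  "branch_image T J = T ` J \<inter> closure (T ` interior J)"

primrec tower_level :: "(real \<Rightarrow> real) \<Rightarrow> real set set \<Rightarrow> nat \<Rightarrow> real set set" where
  "tower_level T \<xi> 0 = {unit_ivl}"
| "tower_level T \<xi> (Suc n) =
     {branch_image T (W \<inter> V) | W V. W \<in> \<xi> \<and> V \<in> tower_level T \<xi> n \<and> subinterval (W \<inter> V)}"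

definition tower_intervals :: "(real \<Rightarrow> real) \<Rightarrow> real set set \<Rightarrow> real set set" where
  "tower_intervals T \<xi> = (\<Union>n. tower_level T \<xi> n)"

text \<open>Points of the tower are written \<open>(D, x)\<close>, with the label of the copy first, to fit the
  library's disjoint union of topological spaces; so the projection \<open>\<pi>\<close> is \<^const>\<open>snd\<close>.\<close>

definition tower_topology :: "(real \<Rightarrow> real) \<Rightarrow> real set set \<Rightarrow> (real set \<times> real) topology" where
  "tower_topology T \<xi> = sum_topology (\<lambda>D. top_of_set (closure D)) (tower_intervals T \<xi>)"

definition tower :: "(real \<Rightarrow> real) \<Rightarrow> real set set \<Rightarrow> (real set \<times> real) set" where
  "tower T \<xi> = (SIGMA D:tower_intervals T \<xi>. closure D)"

abbreviation tower_copy :: "real set \<Rightarrow> (real set \<times> real) set" where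
  "tower_copy D \<equiv> {D} \<times> closure D"

abbreviation tower_base :: "(real set \<times> real) set" where
  "tower_base \<equiv> {unit_ivl} \<times> unit_ivl"

abbreviation tower_opens :: "(real \<Rightarrow> real) \<Rightarrow> real set set \<Rightarrow> (real set \<times> real) set set" where
  "tower_opens T \<xi> \<equiv> {U. openin (tower_topology T \<xi>) U}"

definition tower_borel :: "(real \<Rightarrow> real) \<Rightarrow> real set set \<Rightarrow> (real set \<times> real) measure" where
  "tower_borel T \<xi> = sigma (tower T \<xi>) (tower_opens T \<xi>)"

definition partition_element :: "real set set \<Rightarrow> real \<Rightarrow> real set" where
  "partition_element \<xi> x = (THE W. W \<in> \<xi> \<and> x \<in> W)"

text \<open>Only meaningful off \<open>\<pi>\<^sup>-\<^sup>1(S\<^sub>1)\<close>; the domain is taken into account in \<open>tower_preimage\<close>.\<close>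

definition tower_map ::
    "(real \<Rightarrow> real) \<Rightarrow> real set set \<Rightarrow> real set \<times> real \<Rightarrow> real set \<times> real" where
  "tower_map T \<xi> = (\<lambda>(D, x). (branch_image T (D \<inter> partition_element \<xi> x), T x))"

definition tower_preimage ::
    "(real \<Rightarrow> real) \<Rightarrow> real set set \<Rightarrow> nat \<Rightarrow> (real set \<times> real) set \<Rightarrow> (real set \<times> real) set" where
  "tower_preimage T \<xi> n A =
     {p \<in> tower T \<xi>. (\<forall>k<n. snd ((tower_map T \<xi> ^^ k) p) \<notin> endpoint_set T \<xi> 1) \<and>
                    (tower_map T \<xi> ^^ n) p \<in> A}"

definition tower_leb :: "(real \<Rightarrow> real) \<Rightarrow> real set set \<Rightarrow> (real set \<times> real) measure" where
  "tower_leb T \<xi> = measure_of (tower T \<xi>) (tower_opens T \<xi>)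
     (\<lambda>A. \<Sum>\<^sub>\<infinity>D\<in>tower_intervals T \<xi>. emeasure lborel (snd ` (A \<inter> tower_copy D)))"

definition tower_pushed ::
    "(real \<Rightarrow> real) \<Rightarrow> real set set \<Rightarrow> nat \<Rightarrow> (real set \<times> real) measure" where
  "tower_pushed T \<xi> n = measure_of (tower T \<xi>) (tower_opens T \<xi>)
     (\<lambda>A. emeasure (tower_leb T \<xi>) (tower_preimage T \<xi> n A \<inter> tower_base))"

definition tower_average ::
    "(real \<Rightarrow> real) \<Rightarrow> real set set \<Rightarrow> nat \<Rightarrow> (real set \<times> real) measure" where
  "tower_average T \<xi> n = measure_of (tower T \<xi>) (tower_opens T \<xi>)
     (\<lambda>A. (\<Sum>k<n. emeasure (tower_pushed T \<xi> k) A) / of_nat n)"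

text \<open>Convergence against bounded continuous functions. For probability measures with a
  probability measure as limit this is the same as convergence against continuous functions
  vanishing at infinity, the tower being locally compact.\<close>

definition tower_weak_star_conv ::
    "(real \<Rightarrow> real) \<Rightarrow> real set set \<Rightarrow> (nat \<Rightarrow> (real set \<times> real) measure) \<Rightarrow>
     (real set \<times> real) measure \<Rightarrow> bool" where
  "tower_weak_star_conv T \<xi> \<nu>s \<nu> \<longleftrightarrow>
     (\<forall>f. continuous_map (tower_topology T \<xi>) euclideanreal f \<and> bounded (f ` tower T \<xi>) \<longrightarrow>
        (\<lambda>j. integral\<^sup>L (\<nu>s j) f) \<longlonglongrightarrow> integral\<^sup>L \<nu> f)"

end

theory Submission
  imports Defs
begin

text \<open>
  The projections of the averaged measures are the Cesaro means of the laws of \<open>T\<^sup>n\<close> under Lebesgue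
  measure, and these converge to \<open>\<mu>\<close> in total variation. So the projection of any weak limit is
  \<open>\<mu>\<close>, and what has to be excluded is that mass escapes to infinity in the tower: the tower has
  countably many cells and need not be compact.

  Call a point regular if its orbit never meets an endpoint of the partition; all but countably
  many points are regular. For regular \<open>x\<close> let \<open>C\<^sub>n(x)\<close> be the open cylinder of order \<open>n\<close> around
  \<open>x\<close>, let \<open>I\<^sub>n(x) = T\<^sup>n C\<^sub>n(x)\<close>, an open interval, and let the depth \<open>r\<^sub>n(x)\<close> be the distance from
  \<open>T\<^sup>n x\<close> to the complement of \<open>I\<^sub>n(x)\<close>. The orbit in the tower of the point \<open>x\<close> of the base is at time \<open>n\<close> in a cell
  that lies between \<open>I\<^sub>n(x)\<close> and its closure, so at most four cells are possible once \<open>I\<^sub>n(x)\<close> is known.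
  If \<open>r\<^sub>i(x)\<close> exceeds the length of \<open>C\<^sub>k(T\<^sup>i x)\<close>, then \<open>C\<^sub>k(T\<^sup>i x) \<subseteq> I\<^sub>i(x)\<close> and hence
  \<open>I\<^bsub>i+k\<^esub>(x) = T\<^sup>k C\<^sub>k(T\<^sup>i x)\<close>: the past before time \<open>i\<close> is forgotten. By (H3) cylinders shrink to points
  (two halves of a common limit interval would both be mapped over the magnet by an injective
  iterate), so for given \<open>\<rho>\<close> and suitable \<open>k\<close>, finitely many cylinders of order \<open>k\<close> and length less
  than \<open>\<rho>\<close> carry almost all of \<open>\<mu>\<close>. Tightness thus reduces to the claim that, on average over time,
  \<open>r\<^sub>i\<close> is rarely small (\<open>shallow_orbits_rare\<close>, used in \<open>finitely_many_images\<close>).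

  The claim is proved by a drift argument for \<open>log (1 / r\<^sub>n)\<close>. Applied to intervals inside a branch,
  (H1) says that \<open>T\<close> expands by a factor \<open>\<Lambda> > 1\<close>; applied to general intervals and combined with
  the bounded distortion that follows from (H2), it bounds the moment of order \<open>a\<close> of
  \<open>\<bar>I\<^sub>n\<bar> / r\<^bsub>n+1\<^esub>\<close> uniformly in \<open>n\<close>, for some \<open>a > 0\<close>. The distortion constant need not be close to 1,
  so the contraction in (H1) cannot simply be iterated. But if \<open>T\<^sup>n x\<close> is farther than \<open>r\<^sub>n\<close> from
  the endpoints of its branch, then \<open>log (1 / r\<^sub>n)\<close> decreases by at least \<open>log \<Lambda>\<close>. The law of
  \<open>T\<^sup>n x\<close> is close to \<open>\<mu>\<close>, and the regular points within \<open>\<rho>\<close> of an endpoint of their branch have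
  small measure under \<open>\<mu>\<close> if \<open>\<rho>\<close> is small. So among the times with \<open>r\<^sub>n < \<rho>\<close> those at which the
  logarithm does not decrease are rare, and the moment bound limits what they can add (\<open>excess_drift\<close>, \<open>excess_integral_bound\<close>). As the logarithm, truncated below, is
  nonnegative, most of the time it must be near its lower truncation.

  With tightness at hand the tower is embedded as a closed subset of the line, one cell
  per block of length 2, and Helly's selection theorem provides the weak limit.
\<close>


section \<open>Intervals of the real line\<close>

lemma finite_frontier_interval:
  fixes W :: "real set"
  assumes "is_interval W"
  shows "finite (frontier W)"
proof -
  have "\<exists>a b. W = {} \<or> W = UNIV \<or> W = {..<b} \<or> W = {..b} \<or> W = {a<..} \<or> W = {a..} \<or>
      W = {a<..<b} \<or> W = {a<..b} \<or> W = {a..<b} \<or> W = {a..b}"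
    by (rule interval_cases) (use assms[unfolded is_interval_1] in blast)
  then obtain a b where "W = {} \<or> W = UNIV \<or> W = {..<b} \<or> W = {..b} \<or> W = {a<..} \<or> W = {a..} \<or>
      W = {a<..<b} \<or> W = {a<..b} \<or> W = {a..<b} \<or> W = {a..b}"
    by (elim exE)
  moreover have "frontier W \<subseteq> {a, b}" if "open G" "closed H" "G \<subseteq> W" "W \<subseteq> H" "H - G \<subseteq> {a, b}" for G H
    using interior_maximal[OF that(3,1)] closure_minimal[OF that(4,2)] that(5)
    by (auto simp: frontier_def)
  note * = this
  ultimately have "frontier W \<subseteq> {a, b}"
  proof (elim disjE)
    assume "W = {}" then show ?thesis by (intro *[of "{}" "{}"]) auto
  next
    assume "W = UNIV" then show ?thesis by (intro *[of "UNIV" "UNIV"]) auto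
  next
    assume "W = {..<b}" then show ?thesis by (intro *[of "{..<b}" "{..b}"]) auto
  next
    assume "W = {..b}" then show ?thesis by (intro *[of "{..<b}" "{..b}"]) auto
  next
    assume "W = {a<..}" then show ?thesis by (intro *[of "{a<..}" "{a..}"]) auto
  next
    assume "W = {a..}" then show ?thesis by (intro *[of "{a<..}" "{a..}"]) auto
  next
    assume "W = {a<..<b}" then show ?thesis by (intro *[of "{a<..<b}" "{a..b}"]) auto
  next
    assume "W = {a<..b}" then show ?thesis by (intro *[of "{a<..<b}" "{a..b}"]) auto
  next
    assume "W = {a..<b}" then show ?thesis by (intro *[of "{a<..<b}" "{a..b}"]) auto
  next
    assume "W = {a..b}" then show ?thesis by (intro *[of "{a<..<b}" "{a..b}"]) auto
  qed
  then show ?thesis by (rule finite_subset) simp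
qed

lemma open_interval_cases:
  fixes J :: "real set"
  assumes "open J" "is_interval J" "J \<subseteq> {a..b}" "J \<noteq> {}"
  obtains c d where "c < d" "J = {c<..<d}" "a \<le> c" "d \<le> b"
proof -
  have bb: "bdd_below J" "bdd_above J" using assms(3) by (auto intro: bdd_below_mono bdd_above_mono)
  have 1: "J = {Inf J<..<Sup J}"
  proof (intro set_eqI iffI)
    fix x assume x: "x \<in> J"
    obtain e where e: "e > 0" "ball x e \<subseteq> J" using assms(1) x openE by blast
    have "x - e/2 \<in> J" "x + e/2 \<in> J" using e by (auto simp: dist_real_def subset_iff)
    then have "Inf J \<le> x - e/2" "x + e/2 \<le> Sup J" using bb by (auto intro: cInf_lower cSup_upper)
    then show "x \<in> {Inf J<..<Sup J}" using e(1) by auto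
  next
    fix x assume "x \<in> {Inf J<..<Sup J}"
    then obtain u v where "u \<in> J" "u < x" "v \<in> J" "x < v"
      using assms(4) bb by (auto simp: cInf_less_iff less_cSup_iff)
    then show "x \<in> J" using assms(2) unfolding is_interval_1 by (meson less_imp_le)
  qed
  moreover have "Inf J < Sup J" using 1 assms(4) by fastforce
  moreover have "a \<le> Inf J" "Sup J \<le> b"
    using assms(3,4) by (auto intro!: cInf_greatest cSup_least)
  ultimately show ?thesis using that by blast
qed

lemma interior_between_open_interval:
  fixes I D :: "real set"
  assumes "open I" "is_interval I" "I \<subseteq> D" "D \<subseteq> closure I"
  shows "interior D = I"
proof
  show "I \<subseteq> interior D" using assms by (simp add: interior_maximal)
  have "interior D \<subseteq> interior (closure I)" using assms(4) by (rule interior_mono)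
  also have "\<dots> = interior I"
    using convex_interior_closure[of I] assms(2) by (simp add: is_interval_convex_1)
  finally show "interior D \<subseteq> I" using assms(1) by (simp add: interior_open)
qed

lemma open_image_interval_inj:
  fixes f :: "real \<Rightarrow> real"
  assumes "open J" "is_interval J" "continuous_on J f" "inj_on f J"
  shows "open (f ` J)" "is_interval (f ` J)"
proof -
  show "open (f ` J)" using invariance_of_domain[OF assms(3,1,4)] .
  show "is_interval (f ` J)"
    using assms connected_continuous_image is_interval_connected_1 by blast
qed

lemma is_interval_vimage_inj:
  fixes f :: "real \<Rightarrow> real"
  assumes "is_interval J" "continuous_on J f" "inj_on f J" "is_interval K"
  shows "is_interval {x \<in> J. f x \<in> K}"
  unfolding is_interval_1
proof (intro ballI allI impI, elim conjE)
  fix a b x assume ab: "a \<in> {x \<in> J. f x \<in> K}" "b \<in> {x \<in> J. f x \<in> K}" "a \<le> x" "x \<le> b"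
  have sub: "{a..b} \<subseteq> J" using ab assms(1) unfolding is_interval_1 by (auto intro: less_imp_le)
  show "x \<in> {x \<in> J. f x \<in> K}"
  proof (cases "a = x \<or> x = b")
    case False
    then have "a < x" "x < b" using ab by auto
    then have "f a < f x \<and> f x < f b \<or> f b < f x \<and> f x < f a"
      using continuous_inj_imp_mono[of a x b f] assms(2,3) sub
      by (meson continuous_on_subset inj_on_subset)
    then have "f x \<in> K" using ab assms(4) unfolding is_interval_1 
      by (metis (mono_tags, lifting) less_imp_le mem_Collect_eq)
    then show ?thesis using sub ab by auto
  qed (use ab in auto)
qed

section \<open>Regular points\<close>

locale interval_map =
  fixes T :: "real \<Rightarrow> real" and \<xi> :: "real set set"
  assumes pm: "piecewise_monotone_map T \<xi>"
begin

abbreviation elt :: "real \<Rightarrow> real set" where "elt \<equiv> partition_element \<xi>"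

lemma T_unit: "x \<in> unit_ivl \<Longrightarrow> T x \<in> unit_ivl"
  using pm unfolding piecewise_monotone_map_def by blast

lemma funpow_unit: "x \<in> unit_ivl \<Longrightarrow> (T ^^ n) x \<in> unit_ivl"
  by (induction n) (use T_unit in auto)

lemma countable_xi: "countable \<xi>"
  and partition_xi: "partition_on unit_ivl \<xi>"
  and xi_interval: "W \<in> \<xi> \<Longrightarrow> is_interval W"
  and xi_mono: "W \<in> \<xi> \<Longrightarrow> strict_mono_on (interior W) T \<or> strict_antimono_on (interior W) T"
  and xi_C1: "W \<in> \<xi> \<Longrightarrow> T C1_differentiable_on interior W"
  using pm by (auto simp: piecewise_monotone_map_def)

lemma xi_subset: "W \<in> \<xi> \<Longrightarrow> W \<subseteq> unit_ivl"
  using partition_xi by (auto simp: partition_on_def)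

lemma elt_eq: "W \<in> \<xi> \<Longrightarrow> x \<in> W \<Longrightarrow> elt x = W"
  unfolding partition_element_def
  by (rule the_equality) (use partition_xi in \<open>auto simp: partition_on_def disjoint_def\<close>)

lemma elt_in: assumes "x \<in> unit_ivl" shows "elt x \<in> \<xi>" "x \<in> elt x"
proof -
  obtain W where "W \<in> \<xi>" "x \<in> W" using assms partition_onD1[OF partition_xi] by blast
  then show "elt x \<in> \<xi>" "x \<in> elt x" using elt_eq by auto
qed

lemma T_cont: "W \<in> \<xi> \<Longrightarrow> continuous_on (interior W) T"
  using xi_C1 C1_differentiable_imp_continuous_on by blast

lemma T_inj: assumes "W \<in> \<xi>" shows "inj_on T (interior W)"
  using xi_mono[OF assms] strict_mono_on_imp_inj_on
  by (auto simp: inj_on_def monotone_on_def) (metis linorder_neqE less_irrefl)+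

text \<open>The endpoints of the elements of the partition.\<close>

definition breaks :: "real set" where "breaks = (\<Union>W\<in>\<xi>. frontier W)"

text \<open>Points whose orbit never meets an endpoint. All but countably many
  points are regular, and each iterate is injective and continuous near a regular point.\<close>

definition regular :: "real set" where
  "regular = {x \<in> unit_ivl. \<forall>k. (T ^^ k) x \<notin> breaks}"

lemma countable_breaks: "countable breaks"
  unfolding breaks_def using countable_xi xi_interval finite_frontier_interval
  by (intro countable_UN) (auto intro: countable_finite)

lemma not_breaks_interior: "x \<in> unit_ivl \<Longrightarrow> x \<notin> breaks \<Longrightarrow> x \<in> interior (elt x)"
  using elt_in[of x] closure_subset[of "elt x"] by (auto simp: breaks_def frontier_def)

lemma countable_vimage_T:
  assumes "countable A"
  shows "countable {x \<in> unit_ivl. T x \<in> A}"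
proof -
  have "{x \<in> unit_ivl. T x \<in> A} \<subseteq> breaks \<union> (\<Union>W\<in>\<xi>. {x \<in> interior W. T x \<in> A})"
    using not_breaks_interior elt_in by fastforce
  moreover have "countable {x \<in> interior W. T x \<in> A}" if "W \<in> \<xi>" for W
  proof -
    have "inj_on T {x \<in> interior W. T x \<in> A}" using T_inj[OF that] by (auto simp: inj_on_def)
    moreover have "countable (T ` {x \<in> interior W. T x \<in> A})"
      using assms by (rule countable_subset[rotated]) auto
    ultimately show ?thesis using countable_image_inj_on by blast
  qed
  ultimately show ?thesis
    using countable_breaks countable_xi by (meson countable_UN countable_Un countable_subset)
qed

lemma countable_vimage_funpow: "countable {x \<in> unit_ivl. (T ^^ n) x \<in> breaks}"
proof (induction n)
  case 0
  show ?case using countable_breaks by (rule countable_subset[rotated]) auto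
next
  case (Suc n)
  have "{x \<in> unit_ivl. (T ^^ Suc n) x \<in> breaks} \<subseteq>
      {x \<in> unit_ivl. T x \<in> {x \<in> unit_ivl. (T ^^ n) x \<in> breaks}}"
    using T_unit by (auto simp: funpow_swap1)
  then show ?case using countable_vimage_T[OF Suc] countable_subset by blast
qed

lemma countable_irregular: "countable (unit_ivl - regular)"
proof -
  have "unit_ivl - regular = (\<Union>n. {x \<in> unit_ivl. (T ^^ n) x \<in> breaks})"
    by (auto simp: regular_def)
  then show ?thesis using countable_vimage_funpow by auto
qed

lemma regular_unit: "x \<in> regular \<Longrightarrow> x \<in> unit_ivl"
  by (simp add: regular_def)

lemma regular_funpow: "x \<in> regular \<Longrightarrow> (T ^^ n) x \<in> regular"
  using funpow_unit by (auto simp: regular_def) (metis comp_apply funpow_add)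

lemma regular_interior: "x \<in> regular \<Longrightarrow> x \<in> interior (elt x)"
  using not_breaks_interior[of x] unfolding regular_def by (auto dest: spec[of _ 0])

lemma interior_unit_ivl: "W \<in> \<xi> \<Longrightarrow> interior W \<subseteq> {0<..<1}"
  using interior_mono[OF xi_subset, of W] by simp

lemma regular_01: "x \<in> regular \<Longrightarrow> x \<in> {0<..<1}"
  using regular_interior interior_unit_ivl elt_in regular_unit by blast

lemma regular_sets [measurable]: "regular \<in> sets borel"
proof -
  have "regular = unit_ivl - (unit_ivl - regular)" using regular_unit by auto
  moreover have "unit_ivl - regular \<in> sets borel"
    by (intro borel_closed countable_irregular sets.countable) auto
  ultimately show ?thesis by (metis sets.Diff atLeastAtMost_borel)
qed

section \<open>Cylinders and their images\<close>

text \<open>The open cylinder of order \<open>n\<close> around \<open>x\<close>. Interiors of the branches are used, because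
  the values of the map at the endpoints of a branch are arbitrary; the cylinder of order 0 is
  the open unit interval.\<close>

definition cyl :: "nat \<Rightarrow> real \<Rightarrow> real set" where
  "cyl n x = {y \<in> {0<..<1}. \<forall>k<n. (T ^^ k) y \<in> interior (elt ((T ^^ k) x))}"

text \<open>The image interval, that is, the interior of the cell that the orbit of \<open>x\<close> in the tower
  occupies at time \<open>n\<close>.\<close>

definition img :: "nat \<Rightarrow> real \<Rightarrow> real set" where
  "img n x = (T ^^ n) ` cyl n x"

lemma cyl_0: "cyl 0 x = {0<..<1}" by (auto simp: cyl_def)

lemma cyl_Suc: "cyl (Suc n) x = {y \<in> cyl n x. (T ^^ n) y \<in> interior (elt ((T ^^ n) x))}"
  by (auto simp: cyl_def less_Suc_eq)

lemma img_0: "img 0 x = {0<..<1}" by (simp add: img_def cyl_0)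

lemma img_Suc: "img (Suc n) x = T ` (img n x \<inter> interior (elt ((T ^^ n) x)))"
  by (auto simp: img_def cyl_Suc)

lemma elt_funpow: assumes "x \<in> regular" shows "elt ((T ^^ n) x) \<in> \<xi>"
  using assms elt_in regular_funpow regular_unit by blast

lemma cyl_props:
  assumes x: "x \<in> regular"
  shows "x \<in> cyl n x \<and> open (cyl n x) \<and> is_interval (cyl n x) \<and>
    continuous_on (cyl n x) (T ^^ n) \<and> inj_on (T ^^ n) (cyl n x)"
proof (induction n)
  case 0
  show ?case using regular_01[OF x] by (simp add: cyl_0 is_interval_1 id_def[symmetric])
next
  case (Suc n)
  let ?E = "interior (elt ((T ^^ n) x))"
  have eq: "cyl (Suc n) x = {y \<in> cyl n x. (T ^^ n) y \<in> ?E}" by (rule cyl_Suc)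
  have E: "elt ((T ^^ n) x) \<in> \<xi>" using elt_funpow x by blast
  have iE: "is_interval ?E"
    using xi_interval[OF E] by (simp add: is_interval_convex_1)
  have mem: "x \<in> cyl (Suc n) x"
    unfolding eq using Suc regular_interior regular_funpow[OF x] by blast
  have op: "open (cyl (Suc n) x)"
    unfolding eq using Suc continuous_open_preimage[of "cyl n x" "T ^^ n" ?E]
    by (auto simp: Int_def vimage_def)
  have iv: "is_interval (cyl (Suc n) x)"
    unfolding eq using Suc iE by (intro is_interval_vimage_inj) auto
  have sub: "cyl (Suc n) x \<subseteq> cyl n x" "(T ^^ n) ` cyl (Suc n) x \<subseteq> ?E" unfolding eq by auto
  have "continuous_on (cyl (Suc n) x) (T \<circ> (T ^^ n))"
    using Suc sub T_cont[OF E] by (intro continuous_on_compose) (auto intro: continuous_on_subset)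
  moreover have "inj_on (T \<circ> (T ^^ n)) (cyl (Suc n) x)"
    using Suc sub T_inj[OF E] by (intro comp_inj_on) (auto intro: inj_on_subset)
  ultimately show ?case using mem op iv by (simp add: o_def)
qed

lemma cyl_self: "x \<in> regular \<Longrightarrow> x \<in> cyl n x"
  and cyl_open: "x \<in> regular \<Longrightarrow> open (cyl n x)"
  and cyl_interval: "x \<in> regular \<Longrightarrow> is_interval (cyl n x)"
  and cyl_cont: "x \<in> regular \<Longrightarrow> continuous_on (cyl n x) (T ^^ n)"
  and cyl_inj: "x \<in> regular \<Longrightarrow> inj_on (T ^^ n) (cyl n x)"
  using cyl_props by auto

lemma img_open: "x \<in> regular \<Longrightarrow> open (img n x)"
  and img_interval: "x \<in> regular \<Longrightarrow> is_interval (img n x)"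
  unfolding img_def using open_image_interval_inj[OF cyl_open cyl_interval cyl_cont cyl_inj] by auto

lemma img_self: "x \<in> regular \<Longrightarrow> (T ^^ n) x \<in> img n x"
  by (simp add: img_def cyl_self)

lemma cyl_subset: "cyl n x \<subseteq> {0<..<1}" by (auto simp: cyl_def)

lemma img_subset: assumes "x \<in> regular" shows "img n x \<subseteq> {0<..<1}"
proof -
  have "img n x \<subseteq> unit_ivl" unfolding img_def
  proof (rule image_subsetI)
    fix y assume "y \<in> cyl n x"
    then have "y \<in> unit_ivl" using cyl_subset[of n x] by fastforce
    then show "(T ^^ n) y \<in> unit_ivl" by (rule funpow_unit)
  qed
  then have "img n x \<subseteq> interior unit_ivl" using img_open[OF assms] by (rule interior_maximal)
  then show ?thesis by simp
qed

lemma cyl_antimono: "m \<le> n \<Longrightarrow> cyl n x \<subseteq> cyl m x" by (auto simp: cyl_def)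

lemma elt_cyl: "x \<in> regular \<Longrightarrow> y \<in> cyl n x \<Longrightarrow> k < n \<Longrightarrow> elt ((T ^^ k) y) = elt ((T ^^ k) x)"
  using elt_eq[OF elt_funpow[of x k], of "(T ^^ k) y"] interior_subset[of "elt ((T ^^ k) x)"]
  unfolding cyl_def by blast

lemma cyl_eq: "x \<in> regular \<Longrightarrow> y \<in> cyl n x \<Longrightarrow> k \<le> n \<Longrightarrow> cyl k y = cyl k x"
  using elt_cyl[of x y n] by (auto simp: cyl_def)

lemma img_eq: "x \<in> regular \<Longrightarrow> y \<in> cyl n x \<Longrightarrow> img n y = img n x"
  unfolding img_def using cyl_eq by simp

text \<open>A cylinder splits at time \<open>n\<close> into a cylinder of the past and one of the future.\<close>

lemma cyl_add:
  assumes "x \<in> regular"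
  shows "cyl (n + k) x = {y \<in> cyl n x. (T ^^ n) y \<in> cyl k ((T ^^ n) x)}" (is "?L = ?R")
proof
  have "(T ^^ n) y \<in> cyl k ((T ^^ n) x)" if y: "y \<in> ?L" for y
    unfolding cyl_def
  proof (intro CollectI conjI allI impI)
    have "y \<in> cyl n x" using y cyl_antimono[of n "n+k" x] by auto
    then show "(T ^^ n) y \<in> {0<..<1}" using img_subset[OF assms, of n] by (auto simp: img_def)
    fix j assume "j < k"
    then have "(T ^^ (j + n)) y \<in> interior (elt ((T ^^ (j + n)) x))"
      using y by (auto simp: cyl_def)
    then show "(T ^^ j) ((T ^^ n) y) \<in> interior (elt ((T ^^ j) ((T ^^ n) x)))"
      by (simp add: funpow_add)
  qed
  then show "?L \<subseteq> ?R" using cyl_antimono[of n "n+k" x] by auto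
  show "?R \<subseteq> ?L"
  proof
    fix y assume y: "y \<in> ?R"
    show "y \<in> ?L" unfolding cyl_def
    proof (intro CollectI conjI allI impI)
      show "y \<in> {0<..<1}" using y by (auto simp: cyl_def)
      fix j assume j: "j < n + k"
      show "(T ^^ j) y \<in> interior (elt ((T ^^ j) x))"
      proof (cases "j < n")
        case True then show ?thesis using y by (auto simp: cyl_def)
      next
        case False
        then have "j - n < k" "(T ^^ j) y = (T ^^ (j - n)) ((T ^^ n) y)" "(T ^^ j) x = (T ^^ (j - n)) ((T ^^ n) x)"
          using j funpow_add[of "j - n" n T] by auto
        then show ?thesis using y by (auto simp: cyl_def)
      qed
    qed
  qed
qed

lemma img_add: assumes "x \<in> regular"
  shows "img (n + k) x = (T ^^ k) ` (img n x \<inter> cyl k ((T ^^ n) x))"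
proof -
  have "img (n + k) x = (T ^^ (k + n)) ` {y \<in> cyl n x. (T ^^ n) y \<in> cyl k ((T ^^ n) x)}"
    unfolding img_def cyl_add[OF assms] by (simp only: add.commute)
  also have "\<dots> = (T ^^ k) ` (img n x \<inter> cyl k ((T ^^ n) x))"
    by (auto simp: img_def funpow_add)
  finally show ?thesis .
qed

lemma cyl_bounds:
  assumes "x \<in> regular"
  obtains c d where "c < d" "cyl n x = {c<..<d}" "0 \<le> c" "d \<le> 1"
proof (rule open_interval_cases[of "cyl n x" 0 1])
  show "cyl n x \<subseteq> {0..1}" using cyl_subset[of n x] by force
qed (use assms cyl_open cyl_interval cyl_self that in blast)+

lemma img_bounds:
  assumes "x \<in> regular"
  obtains c d where "c < d" "img n x = {c<..<d}" "0 \<le> c" "d \<le> 1"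
proof (rule open_interval_cases[of "img n x" 0 1])
  show "img n x \<subseteq> {0..1}" using img_subset[OF assms, of n] by force
qed (use assms img_open img_interval img_self that in blast)+

text \<open>A function that agrees on each cylinder with a continuous one is continuous on the regular
  points, since the cylinders are open. All measurability on the regular points comes from this.\<close>

lemma continuous_on_regularI:
  fixes f :: "real \<Rightarrow> 'b::topological_space"
  assumes "\<And>x. x \<in> regular \<Longrightarrow> continuous_on (cyl (n x) x) (g x)"
    and "\<And>x y. x \<in> regular \<Longrightarrow> y \<in> cyl (n x) x \<Longrightarrow> y \<in> regular \<Longrightarrow> f y = g x y"
  shows "continuous_on regular f"
  unfolding continuous_on_def
proof
  fix x assume x: "x \<in> regular"
  have "(g x \<longlongrightarrow> g x x) (at x)"
    using assms(1)[OF x] cyl_self[OF x] cyl_open[OF x]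
    by (metis at_within_open continuous_on_def)
  then have "(g x \<longlongrightarrow> f x) (at x within regular)"
    using assms(2)[OF x cyl_self[OF x] x] tendsto_within_subset[of "g x" _ x UNIV regular] by simp
  moreover have "\<forall>\<^sub>F y in at x within regular. g x y = f y"
    unfolding eventually_at_topological
    by (rule exI[of _ "cyl (n x) x"]) (use assms(2)[OF x] x cyl_self cyl_open in auto)
  ultimately show "(f \<longlongrightarrow> f x) (at x within regular)"
    by (simp cong: tendsto_cong)
qed

lemma funpow_continuous_regular: "continuous_on regular (T ^^ n)"
  by (rule continuous_on_regularI[where n="\<lambda>_. n" and g="\<lambda>_. T ^^ n"]) (auto intro: cyl_cont)

end

section \<open>Null sets and exceptional sets\<close>

lemma measure_Un_finite:
  fixes A F :: "real set"
  assumes "finite F" "A \<in> sets borel"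
  shows "measure lborel (A \<union> F) = measure lborel A"
proof -
  have "F \<in> null_sets lborel"
    using assms(1) by (intro finite_imp_null_set_lborel)
  then show ?thesis using assms(2) by (simp add: measure_Un_null_set)
qed

lemma fmeasurable_intervals:
  fixes c d :: real
  shows "{c<..<d} \<in> fmeasurable lborel" "{c..d} \<in> fmeasurable lborel"
  by (cases "c \<le> d"; auto intro!: fmeasurableI)+

lemma len_Int_interval:
  fixes Z :: "real set"
  assumes "is_interval Z"
  shows "len ({c<..<d} \<inter> Z) = len ({c<..<d} \<inter> interior Z)"
proof -
  have "{c<..<d} \<inter> Z = ({c<..<d} \<inter> interior Z) \<union> ({c<..<d} \<inter> Z \<inter> frontier Z)"
    using interior_subset closure_subset by (auto simp: frontier_def)
  then show ?thesis
    using measure_Un_finite[of "{c<..<d} \<inter> Z \<inter> frontier Z" "{c<..<d} \<inter> interior Z"]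
      finite_frontier_interval[OF assms] by simp
qed

text \<open>Bounds known off a countable set extend by continuity; (H2) gives its bounds
  only off such a set.\<close>

lemma le_cocountable:
  fixes g :: "real \<Rightarrow> real"
  assumes "open U" "continuous_on U g" "countable N" "\<And>x. x \<in> U - N \<Longrightarrow> g x \<le> c" "x \<in> U"
  shows "g x \<le> c"
proof (rule ccontr)
  assume "\<not> g x \<le> c"
  moreover have op: "open {y \<in> U. g y \<in> {c<..}}"
    using continuous_open_preimage[OF assms(2,1), of "{c<..}"] by (simp add: Int_def vimage_def)
  ultimately obtain e where e: "e > 0" "ball x e \<subseteq> {y \<in> U. g y \<in> {c<..}}"
    using assms(5) by (auto elim!: openE)
  have "{x - e<..<x + e} \<subseteq> N"
  proof
    fix y assume "y \<in> {x - e<..<x + e}"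
    then have "y \<in> U" "g y > c" using e by (auto simp: subset_iff dist_real_def)
    then show "y \<in> N" using assms(4)[of y] by force
  qed
  then show False
    using assms(3) e(1) uncountable_open_interval[of "x - e" "x + e"] countable_subset by auto
qed

context interval_map
begin

lemma T_image_Int:
  assumes "Z \<in> \<xi>" "{c<..<d} \<inter> interior Z \<noteq> {}"
  obtains u v s t where "u < v" "c \<le> u" "v \<le> d" "{c<..<d} \<inter> interior Z = {u<..<v}"
    "s < t" "0 \<le> s" "t \<le> 1" "T ` ({c<..<d} \<inter> interior Z) = {s<..<t}"
proof -
  let ?J = "{c<..<d} \<inter> interior Z"
  have J: "open ?J" "is_interval ?J"
    using xi_interval[OF assms(1)] by (auto simp: is_interval_convex_1 convex_Int)
  obtain u v where uv: "u < v" "?J = {u<..<v}" "c \<le> u" "v \<le> d"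
    using open_interval_cases[OF J _ assms(2), of c d] by (metis Int_lower1 greaterThanLessThan_subseteq_atLeastAtMost_iff order.trans order_refl)
  have T: "open (T ` ?J)" "is_interval (T ` ?J)"
    using open_image_interval_inj[OF J] T_cont[OF assms(1)] T_inj[OF assms(1)]
    by (meson Int_lower2 continuous_on_subset inj_on_subset)+
  have "T ` ?J \<subseteq> {0..1}"
    using T_unit interior_unit_ivl[OF assms(1)] by fastforce
  then obtain s t where st: "s < t" "T ` ?J = {s<..<t}" "0 \<le> s" "t \<le> 1"
    using open_interval_cases[OF T, of 0 1] assms(2) by blast
  show ?thesis using that uv st by blast
qed

lemma T_image_Int_sets: "Z \<in> \<xi> \<Longrightarrow> T ` ({c<..<d} \<inter> interior Z) \<in> sets borel"
  by (cases "{c<..<d} \<inter> interior Z = {}") (auto elim: T_image_Int[of Z c d])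

lemma len_T_image:
  assumes "Z \<in> \<xi>"
  shows "len (T ` ({c<..<d} \<inter> Z)) = len (T ` ({c<..<d} \<inter> interior Z))"
proof -
  have "{c<..<d} \<inter> Z = ({c<..<d} \<inter> interior Z) \<union> ({c<..<d} \<inter> Z \<inter> frontier Z)"
    using interior_subset closure_subset by (auto simp: frontier_def)
  then have "T ` ({c<..<d} \<inter> Z) = T ` ({c<..<d} \<inter> interior Z) \<union> T ` ({c<..<d} \<inter> Z \<inter> frontier Z)"
    by (metis image_Un)
  then show ?thesis
    using measure_Un_finite[of "T ` ({c<..<d} \<inter> Z \<inter> frontier Z)" "T ` ({c<..<d} \<inter> interior Z)"]
      finite_frontier_interval[OF xi_interval[OF assms]] T_image_Int_sets[OF assms] by simp
qed

section \<open>Expansion and fragmentation\<close>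

text \<open>The sum in (H1) for \<open>W = (c, d)\<close>, multiplied by \<open>\<bar>W\<bar>\<close> and restricted to a set \<open>F\<close> of
  elements of the partition. Branches that miss \<open>(c, d)\<close> contribute 0, because the second
  factor vanishes.\<close>

definition fragmentation :: "real \<Rightarrow> real \<Rightarrow> real \<Rightarrow> real set set \<Rightarrow> real" where
  "fragmentation p c d F = (\<Sum>Z\<in>F. ((d - c) / len (T ` ({c<..<d} \<inter> interior Z))) powr p
     * len ({c<..<d} \<inter> interior Z))"

text \<open>Unlike in (H1), the interval \<open>(c, d)\<close> may be long here, and the constant may exceed 1.\<close>

definition fragmentation_bound :: "real \<Rightarrow> real \<Rightarrow> bool" where
  "fragmentation_bound a B \<longleftrightarrow> (\<forall>c d F. 0 \<le> c \<longrightarrow> c < d \<longrightarrow> d \<le> 1 \<longrightarrow> finite F \<longrightarrow> F \<subseteq> \<xi> \<longrightarrow>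
     fragmentation a c d F \<le> B * (d - c))"

text \<open>Expansion by the factor \<open>\<Lambda>\<close> in each branch, without reference to the derivative.\<close>

definition expanding :: "real \<Rightarrow> bool" where
  "expanding \<Lambda> \<longleftrightarrow> (\<forall>Z\<in>\<xi>. \<forall>x\<in>interior Z. \<forall>y\<in>interior Z. \<Lambda> * \<bar>x - y\<bar> \<le> \<bar>T x - T y\<bar>)"

lemma H1_finite_sums:
  assumes "H1 T \<xi>"
  obtains q \<delta> \<theta> :: real where "0 < q" "q \<le> 1" "0 < \<delta>" "0 < \<theta>" "\<theta> < 1"
    "\<And>c d F. 0 \<le> c \<Longrightarrow> c < d \<Longrightarrow> d \<le> 1 \<Longrightarrow> d - c < \<delta> \<Longrightarrow> finite F \<Longrightarrow> F \<subseteq> \<xi> \<Longrightarrow>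
      fragmentation q c d F \<le> \<theta> * (d - c)"
proof -
  obtain q :: real where q: "0 < q" "q \<le> 1" and lim: "Liminf (at_right (0::real))
          (\<lambda>\<delta>. SUP W \<in> {W. subinterval W \<and> len W < \<delta>}.
             \<Sum>\<^sub>\<infinity>W\<^sub>\<alpha>\<in>induced_partition W \<xi>.
               ennreal ((len W / len (T ` W\<^sub>\<alpha>)) powr q * (len W\<^sub>\<alpha> / len W))) < 1" (is "Liminf _ ?G < 1")
    using assms unfolding H1_def by blast
  have "\<not> eventually (\<lambda>\<delta>. 1 \<le> ?G \<delta>) (at_right 0)"
    using lim Liminf_bounded[of 1 ?G "at_right 0"] by (auto simp: not_le)
  then have "\<not> (\<exists>b>0. \<forall>y>0. y < b \<longrightarrow> 1 \<le> ?G y)"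
    unfolding eventually_at_right_field .
  then have "\<exists>\<delta>>0. ?G \<delta> < 1"
    using zero_less_one not_le by blast
  then obtain \<delta> :: real where \<delta>: "0 < \<delta>" "?G \<delta> < 1" by blast
  have *: "\<exists>g\<ge>0. y = ennreal g \<and> g < 1" if "y < 1" for y :: ennreal
    using that by (cases y) (auto simp: ennreal_less_one_iff)
  obtain g where g: "0 \<le> g" "?G \<delta> = ennreal g" "g < 1" using *[OF \<delta>(2)] by blast
  define \<theta> where "\<theta> = max (1/2) g"
  have G: "?G \<delta> \<le> ennreal \<theta>" "\<theta> < 1" "0 < \<theta>"
    using g by (auto simp: \<theta>_def intro!: ennreal_leI)
  show ?thesis
  proof (rule that[OF q \<delta>(1) G(3,2)])
    fix c d :: real and F
    assume cd: "0 \<le> c" "c < d" "d \<le> 1" "d - c < \<delta>" and F: "finite F" "F \<subseteq> \<xi>"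
    define W where "W = {c<..<d}"
    have lW: "len W = d - c" using cd by (simp add: W_def)
    have W: "subinterval W" "len W < \<delta>"
      using cd lW by (auto simp: subinterval_def W_def is_interval_convex_1)
    let ?h = "\<lambda>V. (len W / len (T ` V)) powr q * (len V / len W)"
    let ?F = "{Z \<in> F. W \<inter> Z \<noteq> {}}"
    have inj: "inj_on (\<lambda>Z. W \<inter> Z) ?F"
    proof (rule inj_onI)
      fix Z Z' assume Z: "Z \<in> ?F" "Z' \<in> ?F" "W \<inter> Z = W \<inter> Z'"
      then obtain x where "x \<in> Z" "x \<in> Z'" by blast
      then show "Z = Z'" using elt_eq[of Z x] elt_eq[of Z' x] Z F(2) by blast
    qed
    have "ennreal (\<Sum>Z\<in>?F. ?h (W \<inter> Z)) = (\<Sum>Z\<in>?F. ennreal (?h (W \<inter> Z)))"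
      by (intro sum_ennreal[symmetric]) auto
    also have "\<dots> = (\<Sum>V\<in>(\<lambda>Z. W \<inter> Z) ` ?F. ennreal (?h V))"
      by (subst sum.reindex[OF inj]) simp
    also have "\<dots> \<le> (\<Sum>\<^sub>\<infinity>V\<in>induced_partition W \<xi>. ennreal (?h V))"
      unfolding nonneg_infsum_complete[of "induced_partition W \<xi>" "\<lambda>V. ennreal (?h V)", OF zero_le]
      using F by (intro SUP_upper) (auto simp: induced_partition_def)
    also have "\<dots> \<le> ?G \<delta>" using W by (intro SUP_upper) simp
    also have "\<dots> \<le> ennreal \<theta>" by (rule G)
    finally have "(\<Sum>Z\<in>?F. ?h (W \<inter> Z)) \<le> \<theta>" using G(3) by simp
    moreover have "(\<Sum>Z\<in>?F. ?h (W \<inter> Z)) = (\<Sum>Z\<in>F. ?h (W \<inter> Z))"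
      using F by (intro sum.mono_neutral_left) auto
    moreover have "(\<Sum>Z\<in>F. ?h (W \<inter> Z)) = (\<Sum>Z\<in>F. ((d - c) / len (T ` ({c<..<d} \<inter> interior Z))) powr q
         * (len ({c<..<d} \<inter> interior Z) / (d - c)))"
    proof (rule sum.cong)
      fix Z assume "Z \<in> F"
      then have Z: "Z \<in> \<xi>" using F by blast
      show "?h (W \<inter> Z) = ((d - c) / len (T ` ({c<..<d} \<inter> interior Z))) powr q
         * (len ({c<..<d} \<inter> interior Z) / (d - c))"
        unfolding lW unfolding W_def len_T_image[OF Z] len_Int_interval[OF xi_interval[OF Z]] ..
    qed simp
    ultimately have "(\<Sum>Z\<in>F. ((d - c) / len (T ` ({c<..<d} \<inter> interior Z))) powr q
         * (len ({c<..<d} \<inter> interior Z) / (d - c))) \<le> \<theta>" by simp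
    then show "fragmentation q c d F \<le> \<theta> * (d - c)"
      using cd(2) by (simp add: fragmentation_def sum_divide_distrib[symmetric] pos_divide_le_eq)
  qed
qed

lemma xi_mono_sign:
  assumes "Z \<in> \<xi>"
  obtains s :: real where "s = 1 \<or> s = -1"
    "\<And>x y. x \<in> interior Z \<Longrightarrow> y \<in> interior Z \<Longrightarrow> x < y \<Longrightarrow> s * T x < s * T y"
  using xi_mono[OF assms]
proof
  assume "strict_mono_on (interior Z) T"
  then show ?thesis by (intro that[of 1]) (auto simp: monotone_on_def)
next
  assume "strict_antimono_on (interior Z) T"
  then show ?thesis by (intro that[of "-1"]) (auto simp: monotone_on_def)
qed

text \<open>For \<open>W\<close> inside a branch the sum in (H1) is the single term \<open>(\<bar>W\<bar> / \<bar>T W\<bar>)\<^sup>q\<close>. This bounds the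
  expansion of short intervals from below, and longer ones are divided into short pieces.\<close>

lemma H1_uniform_expansion:
  assumes "H1 T \<xi>"
  obtains \<Lambda> :: real where "1 < \<Lambda>"
    "expanding \<Lambda>"
proof -
  obtain q \<delta> \<theta> :: real where q: "0 < q" "q \<le> 1" "0 < \<delta>" "0 < \<theta>" "\<theta> < 1" and
    H: "\<And>c d F. 0 \<le> c \<Longrightarrow> c < d \<Longrightarrow> d \<le> 1 \<Longrightarrow> d - c < \<delta> \<Longrightarrow> finite F \<Longrightarrow> F \<subseteq> \<xi> \<Longrightarrow>
      fragmentation q c d F \<le> \<theta> * (d - c)"
    using H1_finite_sums[OF assms] by blast
  define \<Lambda> where "\<Lambda> = 1 / (\<theta> powr (1 / q))"
  have \<Lambda>: "1 < \<Lambda>"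
    using q powr_less_mono2[of "1/q" \<theta> 1] by (simp add: \<Lambda>_def)
  have small: "\<Lambda> * (d - c) \<le> s * T d - s * T c"
    if Z: "Z \<in> \<xi>" and s: "s = 1 \<or> s = -1" "\<And>x y. x \<in> interior Z \<Longrightarrow> y \<in> interior Z \<Longrightarrow> x < y \<Longrightarrow> s * T x < s * T y"
      and cd: "c \<in> interior Z" "d \<in> interior Z" "c < d" "d - c < \<delta>" for Z c d and s :: real
  proof -
    have sub: "{c..d} \<subseteq> interior Z"
      using cd xi_interval[OF Z] mem_is_interval_1_I[of "interior Z" c d]
      by (auto simp: is_interval_convex_1)
    have J: "{c<..<d} \<inter> interior Z = {c<..<d}" using sub by auto
    have sTcd: "s * T c < s * T d" using s(2) cd by blast
    have im: "T ` {c<..<d} \<subseteq> {min (T c) (T d)..max (T c) (T d)}"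
    proof (intro image_subsetI)
      fix x assume x: "x \<in> {c<..<d}"
      then have "x \<in> interior Z" using sub by auto
      then have "s * T c < s * T x" "s * T x < s * T d" using s(2) x cd by auto
      then show "T x \<in> {min (T c) (T d)..max (T c) (T d)}" using s(1) by auto
    qed
    obtain u v where uv: "u < v" "T ` {c<..<d} = {u<..<v}"
      using T_image_Int[OF Z, of c d] J cd(3) by (metis greaterThanLessThan_empty_iff linorder_not_le)
    have "len (T ` {c<..<d}) \<le> len {min (T c) (T d)..max (T c) (T d)}"
      using im uv by (intro measure_mono_fmeasurable fmeasurable_intervals) auto
    also have "\<dots> = s * T d - s * T c" using s(1) sTcd by auto
    finally have lT: "len (T ` {c<..<d}) \<le> s * T d - s * T c" .
    have pos: "0 < len (T ` {c<..<d})" using uv by simp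
    have cd01: "0 \<le> c" "d \<le> 1" using interior_unit_ivl[OF Z] cd by auto
    have "((d - c) / len (T ` {c<..<d})) powr q \<le> \<theta>"
      using H[of c d "{Z}"] cd Z J cd01 by (simp add: fragmentation_def)
    then have "(((d - c) / len (T ` {c<..<d})) powr q) powr (1/q) \<le> \<theta> powr (1/q)"
      using q by (intro powr_mono2) auto
    then have "(d - c) / len (T ` {c<..<d}) \<le> \<theta> powr (1/q)"
      using q cd pos by (simp add: powr_powr)
    then have "d - c \<le> \<theta> powr (1/q) * len (T ` {c<..<d})" using pos by (simp add: field_simps)
    then have "\<Lambda> * (d - c) \<le> len (T ` {c<..<d})"
      using q by (simp add: \<Lambda>_def field_simps)
    then show ?thesis using lT by simp
  qed
  have *: "\<Lambda> * \<bar>x - y\<bar> \<le> \<bar>T x - T y\<bar>"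
    if Z: "Z \<in> \<xi>" and xy: "x \<in> interior Z" "y \<in> interior Z" "x < y" for Z x y
  proof -
    obtain s :: real where s: "s = 1 \<or> s = -1"
        "\<And>x y. x \<in> interior Z \<Longrightarrow> y \<in> interior Z \<Longrightarrow> x < y \<Longrightarrow> s * T x < s * T y"
      using xi_mono_sign[OF Z] by blast
    obtain N :: nat where N: "(y - x) / \<delta> < real N" using reals_Archimedean2 by blast
    moreover have "0 < (y - x) / \<delta>" using q xy by simp
    ultimately have N0: "0 < N" by (cases N) auto
    define p where "p = (\<lambda>i. x + real i * ((y - x) / real N))"
    have pz: "p i \<in> interior Z" if "i \<le> N" for i
    proof -
      have "real i * ((y - x) / real N) \<le> real N * ((y - x) / real N)"
        using that xy by (intro mult_right_mono) auto
      then have "x \<le> p i" "p i \<le> y" using xy N0 by (auto simp: p_def)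
      then show ?thesis using xy xi_interval[OF Z] mem_is_interval_1_I[of "interior Z" x y]
        by (auto simp: is_interval_convex_1)
    qed
    have "\<Lambda> * (p i - x) \<le> s * T (p i) - s * T x" if "i \<le> N" for i
      using that
    proof (induction i)
      case (Suc i)
      have d: "p (Suc i) - p i = (y - x) / real N" by (simp add: p_def distrib_right add_divide_distrib)
      have d0: "0 < (y - x) / real N" "(y - x) / real N < \<delta>" using xy N N0 q by (auto simp: field_simps)
      have "\<Lambda> * (p (Suc i) - p i) \<le> s * T (p (Suc i)) - s * T (p i)"
        by (rule small[OF Z s]) (use pz Suc d d0 in auto)
      then show ?case using Suc by (simp add: algebra_simps)
    qed (simp add: p_def)
    from this[of N] have "\<Lambda> * (y - x) \<le> s * T y - s * T x" using N0 by (simp add: p_def)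
    then show ?thesis using s(1) xy(3) by auto
  qed
  show ?thesis
  proof (rule that[OF \<Lambda>], unfold expanding_def, intro ballI)
    fix Z x y assume "Z \<in> \<xi>" "x \<in> interior Z" "y \<in> interior Z"
    then show "\<Lambda> * \<bar>x - y\<bar> \<le> \<bar>T x - T y\<bar>"
      using *[of Z x y] *[of Z y x] by (cases x y rule: linorder_cases) (auto simp: abs_minus_commute)
  qed
qed

lemma sum_len_Int_le:
  assumes "finite F" "F \<subseteq> \<xi>" "c < (d::real)"
  shows "(\<Sum>Z\<in>F. len ({c<..<d} \<inter> interior Z)) \<le> d - c"
proof -
  have disj: "disjoint_family_on (\<lambda>Z. {c<..<d} \<inter> interior Z) F"
    unfolding disjoint_family_on_def
  proof (intro ballI impI equals0I)
    fix Z Z' x assume Z: "Z \<in> F" "Z' \<in> F" "Z \<noteq> Z'" "x \<in> {c<..<d} \<inter> interior Z \<inter> ({c<..<d} \<inter> interior Z')"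
    then have "x \<in> Z" "x \<in> Z'" using interior_subset by blast+
    then show False using Z elt_eq[of Z x] elt_eq[of Z' x] assms(2) by blast
  qed
  have fm: "{c<..<d} \<inter> interior Z \<in> fmeasurable lborel" for Z :: "real set"
    by (rule fmeasurableI2[of "{c<..<d}"]) (auto simp: fmeasurable_intervals)
  have "len (\<Union>Z\<in>F. {c<..<d} \<inter> interior Z) = (\<Sum>Z\<in>F. len ({c<..<d} \<inter> interior Z))"
    using disj assms(1) fm by (intro measure_finite_Union) (auto simp: fmeasurable_def less_top[symmetric])
  moreover have "len (\<Union>Z\<in>F. {c<..<d} \<inter> interior Z) \<le> len {c<..<d}"
    using fm assms(1)
    by (intro measure_mono_fmeasurable fmeasurable_intervals fmeasurableD fmeasurable.finite_UN) auto
  ultimately show ?thesis using assms(3) by simp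
qed

text \<open>Short intervals are covered by (H1), for which the exponent is lowered to at most 1/2. A long
  interval is cut into \<open>N\<close> short ones; shrinking \<open>W\<close> only shortens the images of its pieces.\<close>

lemma H1_chopping_estimate:
  assumes "H1 T \<xi>"
  obtains a B :: real where "0 < a" "a \<le> 1 / 2" "0 < B" "fragmentation_bound a B"
proof -
  obtain q \<delta> \<theta> :: real where q: "0 < q" "q \<le> 1" "0 < \<delta>" "0 < \<theta>" "\<theta> < 1" and
    H: "\<And>c d F. 0 \<le> c \<Longrightarrow> c < d \<Longrightarrow> d \<le> 1 \<Longrightarrow> d - c < \<delta> \<Longrightarrow> finite F \<Longrightarrow> F \<subseteq> \<xi> \<Longrightarrow>
      fragmentation q c d F \<le> \<theta> * (d - c)"
    using H1_finite_sums[OF assms] by blast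
  define a where "a = min q (1/2)"
  have a: "0 < a" "a \<le> 1/2" "a \<le> q" using q by (auto simp: a_def)
  \<comment> \<open>The exponent of (H1) may be lowered at the cost of the constant.\<close>
  have pw: "u powr a \<le> 1 + u powr q" if "0 \<le> u" for u :: real
  proof (cases "u \<le> 1")
    case True
    then have "u powr a \<le> 1" using that a by (simp add: powr_le1)
    then show ?thesis by (simp add: add_increasing2)
  next
    case False
    then have "u powr a \<le> u powr q" using a by (intro powr_mono) auto
    then show ?thesis by simp
  qed
  have short: "fragmentation a c d F \<le> 2 * (d - c)"
    if cd: "0 \<le> c" "c < d" "d \<le> 1" "d - c < \<delta>" "finite F" "F \<subseteq> \<xi>" for c d F
  proof -
    let ?r = "\<lambda>Z. (d - c) / len (T ` ({c<..<d} \<inter> interior Z))"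
    let ?l = "\<lambda>Z. len ({c<..<d} \<inter> interior Z)"
    have "fragmentation a c d F \<le> (\<Sum>Z\<in>F. (1 + ?r Z powr q) * ?l Z)"
      unfolding fragmentation_def using pw cd by (intro sum_mono mult_right_mono) auto
    also have "\<dots> = (\<Sum>Z\<in>F. ?l Z) + fragmentation q c d F"
      by (simp add: fragmentation_def sum.distrib distrib_right)
    also have "\<dots> \<le> (d - c) + \<theta> * (d - c)"
      using sum_len_Int_le[of F c d] H[of c d F] cd by (intro add_mono) auto
    also have "\<dots> \<le> (d - c) + 1 * (d - c)"
      using q cd by (intro add_left_mono mult_right_mono) auto
    finally show ?thesis by simp
  qed
  obtain N :: nat where N: "1 / \<delta> < real N" using reals_Archimedean2 by blast
  moreover have "0 < 1 / \<delta>" using q by simp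
  ultimately have N0: "0 < N" by (cases N) auto
  define B where "B = 2 * real N powr a"
  show ?thesis
  proof (rule that[OF a(1,2), of B])
    show "0 < B" using N0 by (simp add: B_def)
    show "fragmentation_bound a B" unfolding fragmentation_bound_def
    proof (intro allI impI)
      fix c d :: real and F assume cd: "0 \<le> c" "c < d" "d \<le> 1" and F: "finite F" "F \<subseteq> \<xi>"
      define h where "h = (d - c) / real N"
      have hN: "c + real N * h = d" using N0 by (simp add: h_def)
      have "h \<le> 1 / real N" using cd N0 by (simp add: h_def divide_right_mono)
      also have "1 / real N < \<delta>" using N N0 q by (simp add: field_simps)
      finally have h: "0 < h" "h < \<delta>" using cd N0 by (auto simp: h_def)
      define I where "I = (\<lambda>i::nat. {c + real i * h<..<c + real (Suc i) * h})"
      have Isub: "I i \<subseteq> {c<..<d}" "0 \<le> c + real i * h" "c + real (Suc i) * h \<le> 1" if "i < N" for i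
      proof -
        have "real (Suc i) * h \<le> real N * h" using that h by (intro mult_right_mono) auto
        moreover have "0 \<le> real i * h" using h by simp
        ultimately show "I i \<subseteq> {c<..<d}" "0 \<le> c + real i * h" "c + real (Suc i) * h \<le> 1" using hN cd by (auto simp: I_def)
      qed
      have cover: "{c<..<d} \<subseteq> (\<Union>i<N. I i) \<union> (\<lambda>i. c + real i * h) ` {..<N}"
      proof
        fix x assume x: "x \<in> {c<..<d}"
        define i where "i = nat \<lfloor>(x - c) / h\<rfloor>"
        have "0 \<le> (x - c) / h" using x h by simp
        then have "real i \<le> (x - c) / h" "(x - c) / h < real (Suc i)"
          unfolding i_def by linarith+
        then have 2: "c + real i * h \<le> x" "x < c + real (Suc i) * h"
          using h by (simp_all add: field_simps)
        have "real i * h < real N * h" using 2 x hN by auto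
        then have "i < N" using h by simp
        then show "x \<in> (\<Union>i<N. I i) \<union> (\<lambda>i. c + real i * h) ` {..<N}"
          using 2 by (cases "x = c + real i * h") (auto simp: I_def)
      qed
      let ?r = "\<lambda>Z. (d - c) / len (T ` ({c<..<d} \<inter> interior Z))"
      have lenle: "len ({c<..<d} \<inter> interior Z) \<le> (\<Sum>i<N. len (I i \<inter> interior Z))" for Z
      proof -
        let ?U = "(\<Union>i<N. I i \<inter> interior Z)"
        let ?E = "(\<lambda>i. c + real i * h) ` {..<N}"
        have fmI: "I i \<inter> interior Z \<in> fmeasurable lborel" for i
          by (rule fmeasurableI2[of "I i"]) (auto simp: I_def fmeasurable_intervals)
        have fmE: "?E \<in> fmeasurable lborel"
          using finite_imp_null_set_lborel[of ?E] by (intro fmeasurableI) (auto simp: null_setsD1 finite_imp_closed)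
        have "len ({c<..<d} \<inter> interior Z) \<le> len (?U \<union> ?E)"
          using cover fmI fmE by (intro measure_mono_fmeasurable fmeasurable.Un fmeasurable.finite_UN) auto
        also have "\<dots> = len ?U" by (rule measure_Un_finite) (auto simp: I_def)
        also have "\<dots> \<le> (\<Sum>i<N. len (I i \<inter> interior Z))"
          using fmeasurableD[OF fmI] by (intro measure_UNION_le) auto
        finally show ?thesis .
      qed
      have chop: "?r Z powr a * len (I i \<inter> interior Z)
          \<le> real N powr a * ((h / len (T ` (I i \<inter> interior Z))) powr a * len (I i \<inter> interior Z))"
        if Z: "Z \<in> F" and i: "i < N" for Z i
      proof (cases "I i \<inter> interior Z = {}")
        case False
        have Zx: "Z \<in> \<xi>" using Z F by auto
        obtain s t where st: "s < t" "T ` (I i \<inter> interior Z) = {s<..<t}"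
          using T_image_Int[OF Zx, of "c + real i * h" "c + real (Suc i) * h"] False unfolding I_def by metis
        have ne: "{c<..<d} \<inter> interior Z \<noteq> {}" using False Isub(1)[OF i] by blast
        obtain s' t' where st': "s' < t'" "T ` ({c<..<d} \<inter> interior Z) = {s'<..<t'}"
          using T_image_Int[OF Zx ne] by metis
        have "T ` (I i \<inter> interior Z) \<subseteq> T ` ({c<..<d} \<inter> interior Z)" using Isub(1)[OF i] by blast
        then have "{s<..<t} \<subseteq> {s'<..<t'}" using st st' by simp
        then have le: "t - s \<le> t' - s'" using st(1) by (auto simp: greaterThanLessThan_subseteq_greaterThanLessThan)
        have "?r Z = (d - c) / (t' - s')" using st' by simp
        also have "\<dots> \<le> (d - c) / (t - s)" using le st cd by (intro divide_left_mono) auto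
        also have "\<dots> = real N * (h / len (T ` (I i \<inter> interior Z)))" using st N0 by (simp add: h_def)
        finally have "?r Z powr a \<le> (real N * (h / len (T ` (I i \<inter> interior Z)))) powr a"
          using a cd by (intro powr_mono2) auto
        also have "\<dots> = real N powr a * (h / len (T ` (I i \<inter> interior Z))) powr a"
          using h by (intro powr_mult)
        finally show ?thesis by (simp add: mult_right_mono flip: mult.assoc)
      qed simp
      have "fragmentation a c d F \<le> (\<Sum>Z\<in>F. ?r Z powr a * (\<Sum>i<N. len (I i \<inter> interior Z)))"
        unfolding fragmentation_def by (intro sum_mono mult_left_mono lenle) auto
      also have "\<dots> = (\<Sum>Z\<in>F. \<Sum>i<N. ?r Z powr a * len (I i \<inter> interior Z))"
        by (simp add: sum_distrib_left)
      also have "\<dots> \<le> (\<Sum>Z\<in>F. \<Sum>i<N. real N powr a * ((h / len (T ` (I i \<inter> interior Z))) powr a * len (I i \<inter> interior Z)))"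
        by (intro sum_mono chop) auto
      also have "\<dots> = real N powr a * (\<Sum>i<N. \<Sum>Z\<in>F. (h / len (T ` (I i \<inter> interior Z))) powr a * len (I i \<inter> interior Z))"
        by (subst sum.swap) (simp add: sum_distrib_left)
      also have "\<dots> \<le> real N powr a * (\<Sum>i<N. 2 * h)"
      proof (intro mult_left_mono sum_mono)
        fix i assume i: "i \<in> {..<N}"
        have "(c + real (Suc i) * h) - (c + real i * h) = h" by (simp add: algebra_simps)
        then show "(\<Sum>Z\<in>F. (h / len (T ` (I i \<inter> interior Z))) powr a * len (I i \<inter> interior Z)) \<le> 2 * h"
          using short[of "c + real i * h" "c + real (Suc i) * h" F] Isub[of i] h F i
          unfolding I_def fragmentation_def by simp
      qed simp
      also have "\<dots> = B * (d - c)" using N0 by (simp add: B_def h_def)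
      finally show "fragmentation a c d F \<le> B * (d - c)" .
    qed
  qed
qed

section \<open>Bounded distortion\<close>

lemma refined_partition_eq:
  assumes "A \<in> refined_partition T \<xi> n" "x \<in> A"
  shows "A = {z \<in> unit_ivl. \<forall>k<n. (T ^^ k) z \<in> elt ((T ^^ k) x)}"
proof -
  obtain w where w: "\<forall>k<n. w k \<in> \<xi>" "A = {z \<in> unit_ivl. \<forall>k<n. (T ^^ k) z \<in> w k}"
    using assms(1) by (auto simp: refined_partition_def)
  have "elt ((T ^^ k) x) = w k" if "k < n" for k
    using w assms(2) that by (intro elt_eq) auto
  then show ?thesis using w(2) by simp
qed

lemma regular_not_endpoint:
  assumes "x \<in> regular"
  shows "x \<notin> endpoint_set_inf T \<xi>"
proof
  assume "x \<in> endpoint_set_inf T \<xi>"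
  then obtain n A where A: "A \<in> refined_partition T \<xi> n" "x \<in> frontier A"
    by (auto simp: endpoint_set_inf_def endpoint_set_def)
  have "cyl n x \<inter> closure A \<noteq> {}" using A cyl_self[OF assms] by (auto simp: frontier_def)
  then obtain z where z: "z \<in> cyl n x" "z \<in> A"
    using open_Int_closure_eq_empty[OF cyl_open[OF assms]] by blast
  have "cyl n x \<subseteq> A"
  proof
    fix y assume y: "y \<in> cyl n x"
    have "y \<in> unit_ivl" using y cyl_subset[of n x] by fastforce
    moreover have "(T ^^ k) y \<in> elt ((T ^^ k) z)" if "k < n" for k
      using y that elt_cyl[OF assms z(1) that] interior_subset by (auto simp: cyl_def)
    ultimately show "y \<in> A" using refined_partition_eq[OF A(1) z(2)] by blast
  qed
  then have "x \<in> interior A"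
    using cyl_open[OF assms] cyl_self[OF assms] by (meson interior_maximal subsetD)
  then show False using A(2) by (simp add: frontier_def)
qed

text \<open>Agreement of the itineraries up to time \<open>n\<close> bounds the separation time from below; the case of
  infinite separation time is included.\<close>

lemma separation_time_ge:
  assumes "\<And>k. k < n \<Longrightarrow> elt ((T ^^ k) x) = elt ((T ^^ k) y)"
  shows "enat n \<le> separation_time T \<xi> x y"
  unfolding separation_time_def
proof (rule Inf_greatest, clarify)
  fix m A B assume m: "A \<in> refined_partition T \<xi> m" "B \<in> refined_partition T \<xi> m" "A \<noteq> B" "x \<in> A" "y \<in> B"
  have "A = B" if "m \<le> n"
    using refined_partition_eq[OF m(1,4)] refined_partition_eq[OF m(2,5)] assms that by auto
  then show "enat n \<le> enat m" using m(3) by force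
qed

lemma H2_log_derivative:
  assumes "H2 T \<xi>"
  obtains C \<gamma> :: real where "0 < C" "0 < \<gamma>" "\<gamma> < 1"
    "\<And>x y n. x \<in> regular \<Longrightarrow> y \<in> regular \<Longrightarrow> 1 \<le> n \<Longrightarrow>
      (\<And>k. k < n \<Longrightarrow> elt ((T ^^ k) x) = elt ((T ^^ k) y)) \<Longrightarrow>
      \<bar>ln \<bar>deriv T x\<bar> - ln \<bar>deriv T y\<bar>\<bar> \<le> C * \<gamma> ^ n"
proof -
  obtain C \<gamma> :: real where C: "0 < C" "0 < \<gamma>" "\<gamma> < 1" and
    H: "\<And>W. W \<in> \<xi> \<Longrightarrow> holder_seminorm T \<xi> W \<gamma> (\<lambda>x. indicator W x * ln \<bar>deriv T x\<bar>) \<le> ennreal C"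
    using assms unfolding H2_def by metis
  show ?thesis
  proof (rule that[OF C])
    fix x y n assume xy: "x \<in> regular" "y \<in> regular" and n: "1 \<le> n"
      and eq: "\<And>k. k < n \<Longrightarrow> elt ((T ^^ k) x) = elt ((T ^^ k) y)"
    define W where "W = elt x"
    have W: "W \<in> \<xi>" "x \<in> W" "y \<in> W"
      using elt_in[OF regular_unit[OF xy(1)]] elt_in[OF regular_unit[OF xy(2)]] eq[of 0] n
      by (auto simp: W_def)
    let ?p = "power_enat \<gamma> (separation_time T \<xi> x y)"
    let ?a = "\<bar>ln \<bar>deriv T x\<bar> - ln \<bar>deriv T y\<bar>\<bar>"
    have p: "0 \<le> ?p" "?p \<le> \<gamma> ^ n"
      using separation_time_ge[of n x y] eq C
      by (auto simp: power_enat_def split: enat.split intro!: power_decreasing)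
    show "?a \<le> C * \<gamma> ^ n"
    proof (cases "x = y")
      case False
      have "ennreal ?a / ennreal ?p \<le> holder_seminorm T \<xi> W \<gamma> (\<lambda>x. indicator W x * ln \<bar>deriv T x\<bar>)"
        unfolding holder_seminorm_def
        by (rule SUP_upper2[of "(x, y)"]) (use W xy False regular_not_endpoint in auto)
      also have "\<dots> \<le> ennreal C" by (rule H[OF W(1)])
      finally have le: "ennreal ?a / ennreal ?p \<le> ennreal C" .
      show ?thesis
      proof (cases "?p = 0")
        case True
        have "?a = 0"
        proof (rule ccontr)
          assume "?a \<noteq> 0"
          then have "ennreal ?a / ennreal ?p = \<top>" using True by (simp add: ennreal_divide_eq_top_iff)
          then show False using le by (simp add: top_unique)
        qed
        then show ?thesis using C by simp
      next
        case False
        then have "?p > 0" using p by simp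
        then have "?a / ?p \<le> C" using le C by (simp add: divide_ennreal)
        then have "?a \<le> C * ?p" using \<open>?p > 0\<close> by (simp add: field_simps)
        also have "\<dots> \<le> C * \<gamma> ^ n" using p C by simp
        finally show ?thesis .
      qed
    qed (use C in simp)
  qed
qed

lemma DERIV_T: "W \<in> \<xi> \<Longrightarrow> y \<in> interior W \<Longrightarrow> (T has_real_derivative deriv T y) (at y)"
  and continuous_deriv_T: "W \<in> \<xi> \<Longrightarrow> continuous_on (interior W) (deriv T)"
proof -
  assume W: "W \<in> \<xi>"
  obtain D where D: "\<And>x. x \<in> interior W \<Longrightarrow> (T has_real_derivative D x) (at x)" "continuous_on (interior W) D"
    using xi_C1[OF W] by (auto simp: C1_differentiable_on_def has_real_derivative_iff_has_vector_derivative)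
  have eq: "D x = deriv T x" if "x \<in> interior W" for x
    using D(1)[OF that] by (simp add: DERIV_imp_deriv)
  show "(T has_real_derivative deriv T y) (at y)" if "y \<in> interior W"
    using D(1)[OF that] eq[OF that] by simp
  show "continuous_on (interior W) (deriv T)"
    using D(2) eq continuous_on_eq by blast
qed

lemma DERIV_funpow:
  assumes "x \<in> regular" "y \<in> cyl n x"
  shows "((T ^^ n) has_real_derivative (\<Prod>j<n. deriv T ((T ^^ j) y))) (at y)"
  using assms(2)
proof (induction n)
  case 0
  show ?case using DERIV_ident[of "at y"] by (simp add: id_def)
next
  case (Suc n)
  have y: "y \<in> cyl n x" "(T ^^ n) y \<in> interior (elt ((T ^^ n) x))" using Suc.prems by (auto simp: cyl_Suc)
  have "((T \<circ> (T ^^ n)) has_real_derivative deriv T ((T ^^ n) y) * (\<Prod>j<n. deriv T ((T ^^ j) y))) (at y)"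
    by (intro DERIV_chain DERIV_T[OF elt_funpow[OF assms(1), of n]] y Suc)
  then show ?case by (simp add: mult.commute o_def)
qed

lemma abs_deriv_ge:
  assumes exp: "expanding \<Lambda>"
    and W: "W \<in> \<xi>" "y \<in> interior W"
  shows "\<Lambda> \<le> \<bar>deriv T y\<bar>"
proof -
  have "((\<lambda>z. (T z - T y) / (z - y)) \<longlongrightarrow> deriv T y) (at y)"
    using DERIV_T[OF W] by (simp add: has_field_derivative_iff)
  then have lim: "((\<lambda>z. \<bar>(T z - T y) / (z - y)\<bar>) \<longlongrightarrow> \<bar>deriv T y\<bar>) (at y)"
    by (rule tendsto_rabs)
  have "\<forall>\<^sub>F z in at y. \<Lambda> \<le> \<bar>(T z - T y) / (z - y)\<bar>"
    unfolding eventually_at_topological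
    by (intro exI[of _ "interior W"]) (use W exp in \<open>auto simp: expanding_def abs_divide le_divide_eq\<close>)
  then show ?thesis using tendsto_lowerbound[OF lim] by simp
qed

text \<open>A form of bounded distortion that needs no derivative: up to the factor \<open>K\<close>, the iterate
  expands all parts of a cylinder by the same ratio.\<close>

definition distortion_bound :: "real \<Rightarrow> bool" where
  "distortion_bound K \<longleftrightarrow> (\<forall>x\<in>regular. \<forall>n. \<forall>y\<in>cyl n x. \<forall>z\<in>cyl n x.
     \<bar>y - z\<bar> * len (img n x) \<le> K * len (cyl n x) * \<bar>(T ^^ n) y - (T ^^ n) z\<bar>)"

lemma distortion_boundD:
  "distortion_bound K \<Longrightarrow> x \<in> regular \<Longrightarrow> y \<in> cyl n x \<Longrightarrow> z \<in> cyl n x \<Longrightarrow>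
    \<bar>y - z\<bar> * len (img n x) \<le> K * len (cyl n x) * \<bar>(T ^^ n) y - (T ^^ n) z\<bar>"
  by (simp add: distortion_bound_def)

text \<open>The logarithm of the derivative of \<open>T\<^sup>n\<close> is a sum of \<open>n\<close> terms whose oscillations over a cylinder
  are dominated by a geometric series, so it oscillates by at most \<open>C / (1 - \<gamma>)\<close>.\<close>

lemma bounded_distortion:
  assumes "H2 T \<xi>" and "1 < \<Lambda>"
    and exp: "expanding \<Lambda>"
  obtains K :: real where "1 \<le> K" "distortion_bound K"
proof -
  obtain C \<gamma> :: real where C: "0 < C" "0 < \<gamma>" "\<gamma> < 1" and
    H: "\<And>x y n. x \<in> regular \<Longrightarrow> y \<in> regular \<Longrightarrow> 1 \<le> n \<Longrightarrow>
      (\<And>k. k < n \<Longrightarrow> elt ((T ^^ k) x) = elt ((T ^^ k) y)) \<Longrightarrow>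
      \<bar>ln \<bar>deriv T x\<bar> - ln \<bar>deriv T y\<bar>\<bar> \<le> C * \<gamma> ^ n"
    using H2_log_derivative[OF assms(1)] by blast
  define L where "L = C / (1 - \<gamma>)"
  have L0: "0 \<le> L" using C by (simp add: L_def)
  show ?thesis
  proof (rule that[of "exp L"])
    show "1 \<le> exp L" using L0 by simp
    show "distortion_bound (exp L)" unfolding distortion_bound_def
    proof (intro ballI allI)
      fix x n assume x: "x \<in> regular"
      let ?f = "T ^^ n"
      define F where "F = (\<lambda>y. \<Sum>j<n. ln \<bar>deriv T ((T ^^ j) y)\<bar>)"
      have ge: "\<Lambda> \<le> \<bar>deriv T ((T ^^ j) y)\<bar>" if "y \<in> cyl n x" "j < n" for j y
        using that by (intro abs_deriv_ge[OF exp]) (auto simp: cyl_def elt_funpow[OF x])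
      \<comment> \<open>\<open>F\<close> is the logarithm of the absolute derivative of the iterate.\<close>
      have cont: "continuous_on (cyl n x) F"
        unfolding F_def
      proof (intro continuous_intros)
        fix j assume j: "j \<in> {..<n}"
        show "continuous_on (cyl n x) (\<lambda>y. deriv T ((T ^^ j) y))"
        proof (rule continuous_on_compose2[OF continuous_deriv_T[OF elt_funpow[OF x, of j]]])
          show "continuous_on (cyl n x) (T ^^ j)"
            using cyl_cont[OF x, of j] cyl_antimono[of j n x] j by (auto intro: continuous_on_subset)
          show "(T ^^ j) ` cyl n x \<subseteq> interior (elt ((T ^^ j) x))" using j by (auto simp: cyl_def)
        qed
        show "\<forall>y\<in>cyl n x. \<bar>deriv T ((T ^^ j) y)\<bar> \<noteq> 0" using ge[of _ j] j assms(2) by force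
      qed
      have reg: "F y - F z \<le> L" if y: "y \<in> cyl n x" "y \<in> regular" and z: "z \<in> cyl n x" "z \<in> regular" for y z
      proof -
        have "F y - F z = (\<Sum>j<n. ln \<bar>deriv T ((T ^^ j) y)\<bar> - ln \<bar>deriv T ((T ^^ j) z)\<bar>)"
          by (simp add: F_def sum_subtractf)
        also have "\<dots> \<le> (\<Sum>j<n. C * \<gamma> ^ (n - Suc j))"
        proof (rule sum_mono)
          fix j assume j: "j \<in> {..<n}"
          have "elt ((T ^^ k) ((T ^^ j) y)) = elt ((T ^^ k) ((T ^^ j) z))" if "k < n - j" for k
            using elt_cyl[OF x y(1), of "k + j"] elt_cyl[OF x z(1), of "k + j"] that by (simp add: funpow_add)
          then have "\<bar>ln \<bar>deriv T ((T ^^ j) y)\<bar> - ln \<bar>deriv T ((T ^^ j) z)\<bar>\<bar> \<le> C * \<gamma> ^ (n - j)"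
            using j y z regular_funpow by (intro H) auto
          also have "\<dots> \<le> C * \<gamma> ^ (n - Suc j)" using C by (intro mult_left_mono power_decreasing) auto
          finally show "ln \<bar>deriv T ((T ^^ j) y)\<bar> - ln \<bar>deriv T ((T ^^ j) z)\<bar> \<le> C * \<gamma> ^ (n - Suc j)" by simp
        qed
        also have "\<dots> = C * (\<Sum>j<n. \<gamma> ^ j)"
          by (simp add: sum_distrib_left[symmetric] sum.nat_diff_reindex[of "\<lambda>i. \<gamma> ^ i" n])
        also have "\<dots> \<le> L"
          using C by (simp add: L_def sum_gp_strict divide_right_mono)
        finally show ?thesis .
      qed
      have N: "countable (unit_ivl - regular)" by (rule countable_irregular)
      have cN: "cyl n x - (unit_ivl - regular) \<subseteq> cyl n x \<inter> regular"
        using cyl_subset[of n x] by fastforce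
      \<comment> \<open>Extension from regular points to the whole cylinder, one variable at a time.\<close>
      have osc1: "F y - F z \<le> L" if z: "z \<in> cyl n x" "z \<in> regular" and y: "y \<in> cyl n x" for y z
      proof (rule le_cocountable[OF cyl_open[OF x] _ N _ y])
        show "continuous_on (cyl n x) (\<lambda>y. F y - F z)" by (intro continuous_intros cont)
        show "F v - F z \<le> L" if "v \<in> cyl n x - (unit_ivl - regular)" for v
          using reg[OF _ _ z] that cN by blast
      qed
      have osc: "F y - F z \<le> L" if "z \<in> cyl n x" "y \<in> cyl n x" for y z
      proof (rule le_cocountable[OF cyl_open[OF x] _ N _ that(1)])
        show "continuous_on (cyl n x) (\<lambda>z. F y - F z)" by (intro continuous_intros cont)
        show "F y - F v \<le> L" if "v \<in> cyl n x - (unit_ivl - regular)" for v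
          using osc1[OF _ _ \<open>y \<in> cyl n x\<close>] that cN by blast
      qed
      define D where "D = (\<lambda>y. \<Prod>j<n. deriv T ((T ^^ j) y))"
      have absD: "\<bar>D y\<bar> = exp (F y)" if "y \<in> cyl n x" for y
      proof -
        have "\<bar>deriv T ((T ^^ j) y)\<bar> > 0" if "j < n" for j using ge[OF \<open>y \<in> cyl n x\<close> that] assms(2) by simp
        then show ?thesis unfolding D_def F_def by (simp add: abs_prod exp_sum)
      qed
      have der: "(?f has_real_derivative D y) (at y)" if "y \<in> cyl n x" for y
        unfolding D_def by (rule DERIV_funpow[OF x that])
      obtain c d where cd: "c < d" "cyl n x = {c<..<d}" using cyl_bounds[OF x] by metis
      obtain s t where st: "s < t" "img n x = {s<..<t}" using img_bounds[OF x] by metis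
      have mvt: "\<exists>w\<in>cyl n x. ?f z - ?f y = (z - y) * D w" if "y \<in> cyl n x" "z \<in> cyl n x" "y < z" for y z
      proof -
        have "\<exists>w>y. w < z \<and> ?f z - ?f y = (z - y) * D w"
          using that cd by (intro MVT2 der) auto
        then show ?thesis using that cd by auto
      qed
      have len: "len (img n x) \<le> exp L * \<bar>D w\<bar> * len (cyl n x)" if w: "w \<in> cyl n x" for w
      proof -
        let ?M = "exp L * \<bar>D w\<bar> * (d - c)"
        have b: "?f z - ?f y \<le> ?M" if yz: "y \<in> cyl n x" "z \<in> cyl n x" for y z
        proof (cases "y = z")
          case False
          then consider "y < z" | "z < y" by linarith
          then obtain v where v: "v \<in> cyl n x" "?f z - ?f y = (z - y) * D v"
          proof cases
            case 2
            then obtain v where "v \<in> cyl n x" "?f y - ?f z = (y - z) * D v" using mvt[OF yz(2,1)] by blast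
            then show ?thesis using that[of v] by (simp add: algebra_simps)
          qed (use mvt[OF yz] that in blast)
          have "?f z - ?f y \<le> \<bar>z - y\<bar> * \<bar>D v\<bar>" unfolding v by (metis abs_ge_self abs_mult)
          also have "\<bar>D v\<bar> \<le> exp L * \<bar>D w\<bar>"
            using osc[OF w v(1)] by (simp add: absD v w exp_add[symmetric])
          finally have "?f z - ?f y \<le> \<bar>z - y\<bar> * (exp L * \<bar>D w\<bar>)" by (simp add: mult_left_mono)
          also have "\<dots> \<le> (d - c) * (exp L * \<bar>D w\<bar>)" using yz cd by (intro mult_right_mono) auto
          finally show ?thesis by (simp add: mult_ac)
        qed (use cd in simp)
        have "t - s \<le> ?M"
        proof (rule field_le_epsilon)
          fix e :: real assume e: "0 < e"
          define h where "h = min (e/2) ((t - s)/3)"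
          have h: "0 < h" "h \<le> e / 2" "h \<le> (t - s)/3" using e st(1) by (auto simp: h_def min_def)
          have "s + h \<in> img n x" "t - h \<in> img n x" using h st by auto
          then obtain y z where "y \<in> cyl n x" "z \<in> cyl n x" "s + h = ?f y" "t - h = ?f z"
            by (auto simp: img_def)
          then have "(t - h) - (s + h) \<le> ?M" using b by metis
          then show "t - s \<le> ?M + e" using h by linarith
        qed
        then show ?thesis using st cd by simp
      qed
      have *: "\<bar>y - z\<bar> * len (img n x) \<le> exp L * len (cyl n x) * \<bar>?f y - ?f z\<bar>"
        if yz: "y \<in> cyl n x" "z \<in> cyl n x" "y < z" for y z
      proof -
        obtain w where w: "w \<in> cyl n x" "?f z - ?f y = (z - y) * D w" using mvt[OF yz] by blast
        have "\<bar>y - z\<bar> * len (img n x) \<le> \<bar>y - z\<bar> * (exp L * \<bar>D w\<bar> * len (cyl n x))"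
          by (intro mult_left_mono len w) auto
        also have "\<dots> = exp L * len (cyl n x) * \<bar>?f z - ?f y\<bar>"
          unfolding w(2) abs_mult by (simp add: abs_minus_commute)
        finally show ?thesis by (simp add: abs_minus_commute)
      qed
      fix y z assume "y \<in> cyl n x" "z \<in> cyl n x"
      then show "\<bar>y - z\<bar> * len (img n x) \<le> exp L * len (cyl n x) * \<bar>?f y - ?f z\<bar>"
        using *[of y z] *[of z y] by (cases y z rule: linorder_cases) (auto simp: abs_minus_commute)
    qed
  qed
qed

section \<open>Cylinders shrink to points\<close>

lemma H3_cylinders_shrink:
  assumes "H3 T \<xi>" and x: "x \<in> regular" and "0 < \<epsilon>"
  shows "\<exists>n. len (cyl n x) < \<epsilon>"
proof (rule ccontr)
  assume "\<not> ?thesis"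
  then have large: "\<epsilon> \<le> len (cyl n x)" for n by (simp add: not_less)
  define c where "c = (\<lambda>n. Inf (cyl n x))"
  define d where "d = (\<lambda>n. Sup (cyl n x))"
  have cd: "cyl n x = {c n<..<d n}" "c n < d n" "0 \<le> c n" "d n \<le> 1" for n
  proof -
    obtain c' d' where "c' < d'" "cyl n x = {c'<..<d'}" "0 \<le> c'" "d' \<le> 1" by (rule cyl_bounds[OF x])
    then show "cyl n x = {c n<..<d n}" "c n < d n" "0 \<le> c n" "d n \<le> 1" by (auto simp: c_def d_def)
  qed
  have sub: "c m \<le> c n \<and> d n \<le> d m" if "m \<le> n" for m n
    using cyl_antimono[OF that, of x] cd(2)[of n] unfolding cd(1)
    by (simp add: greaterThanLessThan_subseteq_greaterThanLessThan)
  have bdd: "bdd_above (range c)" "bdd_below (range d)"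
    using cd by (auto intro!: bdd_aboveI[of _ 1] bdd_belowI[of _ 0]) (meson less_imp_le order_trans)+
  define p where "p = (SUP n. c n)"
  define q where "q = (INF n. d n)"
  have p: "c n \<le> p" "q \<le> d n" for n
    unfolding p_def q_def using bdd by (auto intro: cSUP_upper cINF_lower)
  have "c m + \<epsilon> \<le> d n" for m n
  proof -
    have "c m \<le> c (max m n)" "d (max m n) \<le> d n" using sub by auto
    moreover have "\<epsilon> \<le> d (max m n) - c (max m n)" using large[of "max m n"] cd[of "max m n"] by simp
    ultimately show ?thesis by linarith
  qed
  then have "c m \<le> q - \<epsilon>" for m
    unfolding q_def by (smt (verit, ccfv_threshold) cINF_greatest UNIV_not_empty)
  then have "p \<le> q - \<epsilon>" unfolding p_def by (intro cSUP_least) auto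
  then have pq: "p < q" using assms(3) by simp
  \<comment> \<open>An interval that is never cut; its two halves are compared below.\<close>
  have inside: "{p<..<q} \<subseteq> cyl n x" for n using p[of n] unfolding cd(1) by auto
  define h where "h = (p + q) / 2"
  have h: "p < h" "h < q" using pq by (auto simp: h_def)
  have pq01: "0 \<le> p" "q \<le> 1" using p[of 0] cd(3,4)[of 0] by auto
  have W: "subinterval {p<..<h}" "subinterval {h<..<q}"
    using h pq01 by (auto simp: subinterval_def is_interval_convex_1)
  obtain U where U: "subinterval U"
    "\<And>W. subinterval W \<Longrightarrow> \<exists>n\<^sub>W\<ge>1. \<forall>n\<ge>n\<^sub>W. \<exists>V\<in>image_components T \<xi> n W. U \<subseteq> V"
    using assms(1) unfolding H3_def by blast
  obtain n1 where n1: "\<forall>n\<ge>n1. \<exists>V\<in>image_components T \<xi> n {p<..<h}. U \<subseteq> V" using U(2)[OF W(1)] by blast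
  obtain n2 where n2: "\<forall>n\<ge>n2. \<exists>V\<in>image_components T \<xi> n {h<..<q}. U \<subseteq> V" using U(2)[OF W(2)] by blast
  define n where "n = max n1 n2"
  have comp: "V \<subseteq> (T ^^ n) ` W" if "V \<in> image_components T \<xi> n W" for V W
    using that by (auto simp: image_components_def induced_partition_def)
  have "n1 \<le> n" "n2 \<le> n" by (simp_all add: n_def)
  then obtain V1 V2 where "V1 \<in> image_components T \<xi> n {p<..<h}" "U \<subseteq> V1"
      "V2 \<in> image_components T \<xi> n {h<..<q}" "U \<subseteq> V2"
    using n1 n2 by blast
  then have "U \<subseteq> (T ^^ n) ` {p<..<h}" "U \<subseteq> (T ^^ n) ` {h<..<q}"
    using comp by blast+
  moreover obtain u where "u \<in> U"
  proof -
    have "U \<noteq> {}" using U(1) by (auto simp: subinterval_def)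
    then show ?thesis using that by blast
  qed
  ultimately have "u \<in> (T ^^ n) ` {p<..<h}" "u \<in> (T ^^ n) ` {h<..<q}" by blast+
  then obtain v w where vw: "v \<in> {p<..<h}" "w \<in> {h<..<q}" "(T ^^ n) v = (T ^^ n) w"
    unfolding image_iff by metis
  then have "v \<in> cyl n x" "w \<in> cyl n x" using inside[of n] h by auto
  then have "v = w" using cyl_inj[OF x, of n] vw(3) by (meson inj_onD)
  then show False using vw by auto
qed

end

section \<open>Depth of orbit points\<close>

lemma ball_infdist_compl: "ball y (infdist y (- J)) \<subseteq> J"
  using infdist_le[of _ "- J" y] by (force simp: not_less)

lemma infdist_compl_ge:
  assumes "- J \<noteq> {}" "ball y t \<subseteq> J"
  shows "t \<le> infdist y (- J)"
  unfolding infdist_notempty[OF assms(1)]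
  by (rule cINF_greatest) (use assms in \<open>auto simp: subset_iff not_less[symmetric]\<close>)

text \<open>An injective map that expands distances by \<open>c\<close> expands the distance to the boundary by \<open>c\<close>.\<close>

lemma infdist_compl_expand:
  fixes f :: "real \<Rightarrow> real"
  assumes J: "is_interval J" "continuous_on J f" "inj_on f J" "- (f ` J) \<noteq> {}"
    and exp: "\<And>u v. u \<in> J \<Longrightarrow> v \<in> J \<Longrightarrow> c * \<bar>u - v\<bar> \<le> \<bar>f u - f v\<bar>"
  shows "c * infdist y (- J) \<le> infdist (f y) (- (f ` J))"
proof (intro infdist_compl_ge[OF J(4)] subsetI)
  let ?d = "infdist y (- J)"
  fix z assume "z \<in> ball (f y) (c * ?d)"
  then have z: "\<bar>z - f y\<bar> < c * ?d" by (simp add: dist_real_def abs_minus_commute)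
  have d: "0 \<le> ?d" by (rule infdist_nonneg)
  have "0 < c * ?d" using z by (meson abs_ge_zero order_le_less_trans)
  then have c: "0 < c" "0 < ?d" using d by (auto simp: zero_less_mult_iff)
  define w where "w = \<bar>z - f y\<bar> / c"
  define t where "t = (w + ?d) / 2"
  have lt: "w < ?d" using z c by (simp add: w_def field_simps)
  have "0 \<le> w" using c by (simp add: w_def)
  then have t: "0 < t" "t < ?d" "w < t" using lt c by (simp_all add: t_def)
  have zt: "\<bar>z - f y\<bar> < c * t" using t(3) c by (simp add: w_def field_simps)
  have mem: "{y - t..y + t} \<subseteq> J"
  proof
    fix v assume "v \<in> {y - t..y + t}"
    then have "v \<in> ball y ?d" using t by (auto simp: dist_real_def)
    then show "v \<in> J" using ball_infdist_compl by blast
  qed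
  then have uv: "y - t \<in> J" "y + t \<in> J" "y \<in> J" using t by auto
  have "f (y - t) < f y \<and> f y < f (y + t) \<or> f (y + t) < f y \<and> f y < f (y - t)"
    by (rule continuous_inj_imp_mono) (use t mem J in \<open>auto intro: continuous_on_subset inj_on_subset\<close>)
  moreover have "c * t \<le> \<bar>f (y - t) - f y\<bar>" "c * t \<le> \<bar>f (y + t) - f y\<bar>"
    using exp[OF uv(1,3)] exp[OF uv(2,3)] t by auto
  ultimately have "f (y - t) \<le> z \<and> z \<le> f (y + t) \<or> f (y + t) \<le> z \<and> z \<le> f (y - t)" using zt by linarith
  moreover have "is_interval (f ` J)"
    using J connected_continuous_image is_interval_connected_1 by blast
  ultimately show "z \<in> f ` J" using uv unfolding is_interval_1 by blast
qed

lemma nn_integral_infdist_powr: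
  fixes c d a :: real
  assumes "c < d" "0 < a" "a \<le> 1/2"
  shows "(\<integral>\<^sup>+y\<in>{c<..<d}. ennreal (infdist y (- {c<..<d}) powr (- a)) \<partial>lborel) \<le> ennreal (4 * (d - c) powr (1 - a))"
proof -
  let ?h = "d - c"
  let ?I = "\<integral>\<^sup>+y. ennreal (y powr (- a)) * indicator {0..?h} y \<partial>lborel"
  have I: "?I = ennreal (?h powr (1 - a) / (1 - a))"
    using assms has_integral_powr_from_0[of "- a" ?h]
    by (subst nn_integral_has_integral_lebesgue') (auto simp: add.commute)
  have pos: "0 < ?h powr (1 - a)" using assms by simp
  have bound: "?h powr (1 - a) / (1 - a) \<le> 2 * ?h powr (1 - a)"
  proof -
    have "1 \<le> 2 * (1 - a)" using assms by simp
    then have "?h powr (1 - a) * 1 \<le> ?h powr (1 - a) * (2 * (1 - a))" using pos by (intro mult_left_mono) auto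
    then show ?thesis using assms by (simp add: field_simps)
  qed
  have l: "(\<integral>\<^sup>+y\<in>{c..d}. ennreal ((y - c) powr (- a)) \<partial>lborel) = ?I"
    by (subst nn_integral_real_affine[of _ 1 c]) (auto simp: indicator_def intro!: nn_integral_cong)
  have r: "(\<integral>\<^sup>+y\<in>{c..d}. ennreal ((d - y) powr (- a)) \<partial>lborel) = ?I"
    by (subst nn_integral_real_affine[of _ "-1" d]) (auto simp: indicator_def intro!: nn_integral_cong)
  have ge: "min (y - c) (d - y) \<le> infdist y (- {c<..<d})" for y
    by (rule infdist_compl_ge) (auto simp: dist_real_def)
  have "(\<integral>\<^sup>+y\<in>{c<..<d}. ennreal (infdist y (- {c<..<d}) powr (- a)) \<partial>lborel)
     \<le> (\<integral>\<^sup>+y. ennreal ((y - c) powr (- a)) * indicator {c..d} y + ennreal ((d - y) powr (- a)) * indicator {c..d} y \<partial>lborel)"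
  proof (rule nn_integral_mono)
    fix y
    show "ennreal (infdist y (- {c<..<d}) powr (- a)) * indicator {c<..<d} y
      \<le> ennreal ((y - c) powr (- a)) * indicator {c..d} y + ennreal ((d - y) powr (- a)) * indicator {c..d} y"
    proof (cases "y \<in> {c<..<d}")
      case True
      have "infdist y (- {c<..<d}) powr (- a) \<le> (min (y - c) (d - y)) powr (- a)"
        using ge[of y] True assms by (intro powr_mono2') auto
      also have "\<dots> \<le> (y - c) powr (- a) + (d - y) powr (- a)" by (auto simp: min_def)
      finally show ?thesis using True by (simp flip: ennreal_plus)
    qed simp
  qed
  also have "\<dots> = ?I + ?I"
    unfolding l[symmetric] unfolding l r[symmetric]
    by (subst nn_integral_add) (auto simp: l r)
  also have "\<dots> \<le> ennreal (2 * ?h powr (1 - a)) + ennreal (2 * ?h powr (1 - a))"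
    unfolding I by (intro add_mono ennreal_leI bound)
  also have "\<dots> = ennreal (4 * ?h powr (1 - a))" by (simp flip: ennreal_plus)
  finally show ?thesis .
qed

context interval_map
begin

text \<open>Distance from the orbit point at time \<open>n\<close> to the boundary of its image interval.\<close>

definition depth :: "nat \<Rightarrow> real \<Rightarrow> real" where
  "depth n x = infdist ((T ^^ n) x) (- img n x)"

text \<open>Distance from a point to the boundary of its branch.\<close>

definition margin :: "real \<Rightarrow> real" where
  "margin y = infdist y (- interior (elt y))"

lemma depth_nonneg: "0 \<le> depth n x" by (simp add: depth_def infdist_nonneg)

lemma depth_pos: assumes "x \<in> regular" shows "0 < depth n x"
proof -
  obtain e where "e > 0" "ball ((T ^^ n) x) e \<subseteq> img n x"
    using img_open[OF assms] img_self[OF assms] openE by metis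
  moreover have "- img n x \<noteq> {}" using img_subset[OF assms, of n] by force
  ultimately show ?thesis unfolding depth_def using infdist_compl_ge by (meson less_le_trans)
qed

lemma depth_le_len: assumes "x \<in> regular" shows "depth n x \<le> len (img n x)"
proof -
  obtain s t where st: "s < t" "img n x = {s<..<t}" using img_bounds[OF assms] by metis
  have "depth n x \<le> dist ((T ^^ n) x) s" unfolding depth_def by (rule infdist_le) (simp add: st)
  then show ?thesis using img_self[OF assms, of n] st by (auto simp: dist_real_def)
qed

text \<open>The depth grows by the factor \<open>\<Lambda>\<close>, unless the orbit point is closer to an endpoint of its branch
  than to the boundary of its image interval.\<close>

lemma depth_Suc_expand:
  assumes x: "x \<in> regular" and \<Lambda>: "0 < \<Lambda>"
    and exp: "expanding \<Lambda>"
  shows "\<Lambda> * min (margin ((T ^^ n) x)) (depth n x) \<le> depth (Suc n) x"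
proof -
  let ?y = "(T ^^ n) x" let ?E = "elt ?y" let ?J = "img n x \<inter> interior ?E"
  have E: "?E \<in> \<xi>" by (rule elt_funpow[OF x])
  have "min (margin ?y) (depth n x) \<le> infdist ?y (- ?J)"
  proof (rule infdist_compl_ge)
    show "- ?J \<noteq> {}" using img_subset[OF x, of n] by force
    show "ball ?y (min (margin ?y) (depth n x)) \<subseteq> ?J"
      using ball_infdist_compl[of ?y "img n x"] ball_infdist_compl[of ?y "interior ?E"]
      by (auto simp: margin_def depth_def)
  qed
  then have "\<Lambda> * min (margin ?y) (depth n x) \<le> \<Lambda> * infdist ?y (- ?J)" using \<Lambda> by simp
  also have "\<dots> \<le> infdist (T ?y) (- (T ` ?J))"
  proof (rule infdist_compl_expand)
    show "is_interval ?J"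
      using img_interval[OF x, of n] xi_interval[OF E] by (auto simp: is_interval_convex_1 convex_Int)
    show "continuous_on ?J T" using T_cont[OF E] by (rule continuous_on_subset) auto
    show "inj_on T ?J" using T_inj[OF E] by (rule inj_on_subset) auto
    show "- T ` ?J \<noteq> {}" using img_subset[OF x, of "Suc n"] by (force simp: img_Suc)
  qed (use exp E in \<open>auto simp: expanding_def\<close>)
  also have "\<dots> = depth (Suc n) x" by (simp add: depth_def img_Suc)
  finally show ?thesis .
qed

lemma depth_ge_distortion:
  assumes x: "x \<in> regular" and K: "0 < K" and dist: "distortion_bound K"
  shows "len (img n x) / (K * len (cyl n x)) * infdist x (- cyl n x) \<le> depth n x"
  unfolding depth_def
proof -
  obtain c d where cd: "c < d" "cyl n x = {c<..<d}" by (rule cyl_bounds[OF x])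
  then have pos: "0 < K * len (cyl n x)" using K by simp
  have "len (img n x) / (K * len (cyl n x)) * infdist x (- cyl n x) \<le> infdist ((T ^^ n) x) (- ((T ^^ n) ` cyl n x))"
  proof (rule infdist_compl_expand[OF cyl_interval[OF x] cyl_cont[OF x] cyl_inj[OF x]])
    show "- (T ^^ n) ` cyl n x \<noteq> {}" using img_subset[OF x, of n] by (force simp: img_def)
    fix u v assume "u \<in> cyl n x" "v \<in> cyl n x"
    then show "len (img n x) / (K * len (cyl n x)) * \<bar>u - v\<bar> \<le> \<bar>(T ^^ n) u - (T ^^ n) v\<bar>"
      using distortion_boundD[OF dist x, of u n v] pos by (simp add: field_simps)
  qed
  then show "len (img n x) / (K * len (cyl n x)) * infdist x (- cyl n x) \<le> infdist ((T ^^ n) x) (- img n x)"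
    by (simp add: img_def)
qed

lemma depth_continuous: "continuous_on regular (depth n)"
  by (rule continuous_on_regularI[where n="\<lambda>_. n" and g="\<lambda>x y. infdist ((T ^^ n) y) (- img n x)"])
    (auto intro: cyl_cont continuous_on_infdist simp: depth_def img_eq)

lemma len_img_continuous: "continuous_on regular (\<lambda>x. len (img n x))"
  by (rule continuous_on_regularI[where n="\<lambda>_. n" and g="\<lambda>x y. len (img n x)"]) (auto simp: img_eq)

lemma margin_continuous: "continuous_on regular margin"
  by (rule continuous_on_regularI[where n="\<lambda>_. 1" and g="\<lambda>x y. infdist y (- interior (elt x))"])
    (auto intro!: continuous_on_infdist continuous_on_id simp: margin_def dest: elt_cyl[of _ _ 1 0])

lemma margin_pos: assumes "x \<in> regular" shows "0 < margin x"
proof -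
  obtain e where "e > 0" "ball x e \<subseteq> interior (elt x)"
    using regular_interior[OF assms] openE[OF open_interior] by metis
  moreover have "- interior (elt x) \<noteq> {}"
    using interior_unit_ivl[OF elt_in(1)[OF regular_unit[OF assms]]] by force
  ultimately show ?thesis unfolding margin_def using infdist_compl_ge by (meson less_le_trans)
qed

end

section \<open>Countable sums of nonnegative integrals\<close>

text \<open>Sums over countable index sets are treated as integrals with respect to counting measure.\<close>

lemma infsum_eq_nn_integral_count_space:
  fixes f :: "'a \<Rightarrow> ennreal"
  assumes "countable A"
  shows "infsum f A = (\<integral>\<^sup>+x. f x \<partial>count_space A)"
proof (rule antisym)
  have sup: "infsum f A = (SUP F\<in>{F. finite F \<and> F \<subseteq> A}. sum f F)"
    by (rule nonneg_infsum_complete) simp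
  show "infsum f A \<le> (\<integral>\<^sup>+x. f x \<partial>count_space A)"
    unfolding sup
  proof (rule SUP_least, clarify)
    fix F assume F: "finite F" "F \<subseteq> A"
    have "sum f F = (\<integral>\<^sup>+x. f x \<partial>count_space F)" using F by (simp add: nn_integral_count_space_finite)
    also have "\<dots> = (\<integral>\<^sup>+x. f x * indicator F x \<partial>count_space A)"
      using F by (subst (1 2) nn_integral_count_space_indicator)
        (auto intro!: nn_integral_cong simp: indicator_def)
    also have "\<dots> \<le> (\<integral>\<^sup>+x. f x \<partial>count_space A)" by (intro nn_integral_mono) (simp add: indicator_def)
    finally show "sum f F \<le> (\<integral>\<^sup>+x. f x \<partial>count_space A)" .
  qed
  have le: "sum f F \<le> infsum f A" if "finite F" "F \<subseteq> A" for F
    unfolding sup by (rule SUP_upper) (use that in auto)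
  show "(\<integral>\<^sup>+x. f x \<partial>count_space A) \<le> infsum f A"
  proof (cases "finite A")
    case True
    then show ?thesis using le[of A] by (simp add: nn_integral_count_space_finite)
  next
    case False
    define g where "g = from_nat_into A"
    have bij: "bij_betw g UNIV A" using assms False by (simp add: g_def bij_betw_from_nat_into)
    have "(\<integral>\<^sup>+x. f x \<partial>count_space A) = (\<integral>\<^sup>+i. f (g i) \<partial>count_space UNIV)"
      using nn_integral_bij_count_space[OF bij, of f] by simp
    also have "\<dots> = (\<Sum>i. f (g i))" by (rule nn_integral_count_space_nat)
    also have "\<dots> \<le> infsum f A"
    proof (rule suminf_le_const)
      fix n
      have "(\<Sum>i<n. f (g i)) = sum f (g ` {..<n})"
        using bij by (subst sum.reindex) (auto simp: bij_betw_def intro: inj_on_subset)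
      also have "\<dots> \<le> infsum f A" using bij by (intro le) (auto simp: bij_betw_def)
      finally show "(\<Sum>i<n. f (g i)) \<le> infsum f A" .
    qed simp
    finally show ?thesis .
  qed
qed

lemma nn_integral_count_space_le:
  fixes f :: "'a \<Rightarrow> ennreal"
  assumes "countable A" "\<And>F. finite F \<Longrightarrow> F \<subseteq> A \<Longrightarrow> sum f F \<le> c"
  shows "(\<integral>\<^sup>+x. f x \<partial>count_space A) \<le> c"
  unfolding infsum_eq_nn_integral_count_space[OF assms(1), symmetric]
  by (subst nonneg_infsum_complete) (auto intro!: SUP_least assms(2))

lemma nn_integral_UN_countable:
  assumes f[measurable]: "f \<in> borel_measurable M" and "countable I" "\<And>i. i \<in> I \<Longrightarrow> X i \<in> sets M"
    "disjoint_family_on X I"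
  shows "(\<integral>\<^sup>+x\<in>(\<Union>i\<in>I. X i). f x \<partial>M) = (\<integral>\<^sup>+i. (\<integral>\<^sup>+x\<in>X i. f x \<partial>M) \<partial>count_space I)"
proof -
  have "(\<Union>i\<in>I. X i) \<in> sets M" using assms by (intro sets.countable_UN') auto
  then have "(\<integral>\<^sup>+x\<in>(\<Union>i\<in>I. X i). f x \<partial>M) = emeasure (density M f) (\<Union>i\<in>I. X i)"
    by (simp add: emeasure_density)
  also have "\<dots> = (\<integral>\<^sup>+i. emeasure (density M f) (X i) \<partial>count_space I)"
    using assms by (intro emeasure_UN_countable) auto
  also have "\<dots> = (\<integral>\<^sup>+i. (\<integral>\<^sup>+x\<in>X i. f x \<partial>M) \<partial>count_space I)"
    using assms by (intro nn_integral_cong) (simp add: emeasure_density)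
  finally show ?thesis .
qed

lemma interval_len_le_of_expanding:
  fixes f :: "real \<Rightarrow> real"
  assumes "c < d" "s < t" "f ` {c<..<d} \<subseteq> {s<..<t}"
    and exp: "\<And>y z. y \<in> {c<..<d} \<Longrightarrow> z \<in> {c<..<d} \<Longrightarrow> \<kappa> * \<bar>y - z\<bar> \<le> \<bar>f y - f z\<bar>" and "0 \<le> \<kappa>"
  shows "\<kappa> * (d - c) \<le> t - s"
proof (rule field_le_epsilon)
  fix e :: real assume e: "0 < e"
  define h where "h = min (e / (2 * (\<kappa> + 1))) ((d - c) / 3)"
  have h: "0 < h" "h \<le> e / (2 * (\<kappa> + 1))" "h \<le> (d - c) / 3"
    using e assms(1,5) by (auto simp: h_def min_def)
  then have mem: "c + h \<in> {c<..<d}" "d - h \<in> {c<..<d}" by auto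
  have "\<kappa> * (d - c - 2 * h) = \<kappa> * \<bar>(c + h) - (d - h)\<bar>" using h by (simp add: abs_if)
  also have "\<dots> \<le> \<bar>f (c + h) - f (d - h)\<bar>" by (rule exp[OF mem])
  also have "\<dots> \<le> t - s"
  proof -
    have "f (c + h) \<in> {s<..<t}" "f (d - h) \<in> {s<..<t}" using assms(3) mem by blast+
    then show ?thesis by auto
  qed
  finally have 1: "\<kappa> * (d - c) - \<kappa> * (2 * h) \<le> t - s" by (simp add: algebra_simps)
  have "\<kappa> * (2 * h) \<le> (\<kappa> + 1) * (2 * h)" using h by (intro mult_right_mono) auto
  also have "\<dots> \<le> (\<kappa> + 1) * (2 * (e / (2 * (\<kappa> + 1))))" using h assms(5) by (intro mult_left_mono) auto
  also have "\<dots> = e" using assms(5) by (simp add: field_simps)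
  finally show "\<kappa> * (d - c) \<le> t - s + e" using 1 by linarith
qed

lemma borel_measurable_infdist[measurable]: "(\<lambda>y. infdist y (A :: real set)) \<in> borel_measurable borel"
  by (intro borel_measurable_continuous_onI continuous_on_infdist continuous_on_id)

context interval_map
begin

text \<open>Lebesgue measure on the regular points, a probability measure.\<close>

abbreviation lam :: "real measure" where "lam \<equiv> restrict_space lborel regular"

lemma space_lam: "space lam = regular" by (simp add: space_restrict_space)

lemma sets_lam: "sets lam = sets (restrict_space borel regular)"
  by (simp add: sets_restrict_space)

lemma sets_lam_iff: "A \<in> sets lam \<longleftrightarrow> A \<subseteq> regular \<and> A \<in> sets borel"
  by (auto simp: sets_restrict_space_iff)

lemma emeasure_lam: "A \<in> sets borel \<Longrightarrow> A \<subseteq> regular \<Longrightarrow> emeasure lam A = emeasure lborel A"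
  by (simp add: emeasure_restrict_space)

lemma irregular_null: "unit_ivl - regular \<in> null_sets lborel"
  using countable_irregular by (rule countable_imp_null_set_lborel)

lemma emeasure_Int_regular:
  assumes "A \<in> sets borel" "A \<subseteq> unit_ivl"
  shows "emeasure lborel (A \<inter> regular) = emeasure lborel A"
proof -
  have "A \<inter> regular = A - (unit_ivl - regular)" using assms(2) by auto
  then show ?thesis using emeasure_Diff_null_set[OF irregular_null] assms(1) by simp
qed

lemma emeasure_lam_cyl:
  assumes "x \<in> regular"
  shows "emeasure lam (cyl n x \<inter> regular) = ennreal (len (cyl n x))"
proof -
  obtain c d where "c < d" "cyl n x = {c<..<d}" "0 \<le> c" "d \<le> 1" by (rule cyl_bounds[OF assms])
  then show ?thesis
    by (subst emeasure_lam, auto, subst emeasure_Int_regular, auto)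
qed

lemma prob_space_lam: "prob_space lam"
proof
  have "emeasure lam (space lam) = emeasure lborel (unit_ivl \<inter> regular)"
    using regular_unit by (subst emeasure_lam) (auto simp: space_lam Int_absorb1 subsetI)
  also have "\<dots> = 1" by (subst emeasure_Int_regular) auto
  finally show "emeasure lam (space lam) = 1" .
qed

lemma continuous_on_measurable_lam:
  "continuous_on regular (f :: real \<Rightarrow> 'b :: topological_space) \<Longrightarrow> f \<in> borel_measurable lam"
  using borel_measurable_continuous_on_restrict[of regular f] measurable_cong_sets[OF sets_lam refl]
  by auto

lemmas measurable_lam_depth[measurable] = continuous_on_measurable_lam[OF depth_continuous]
  and measurable_lam_img[measurable] = continuous_on_measurable_lam[OF len_img_continuous]
  and measurable_lam_funpow[measurable] = continuous_on_measurable_lam[OF funpow_continuous_regular]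

lemma measurable_lam_margin_funpow[measurable]: "(\<lambda>x. margin ((T ^^ n) x)) \<in> borel_measurable lam"
  by (intro continuous_on_measurable_lam
      continuous_on_compose2[OF margin_continuous funpow_continuous_regular] image_subsetI regular_funpow)

lemma cyl_disjoint: "x \<in> regular \<Longrightarrow> y \<in> regular \<Longrightarrow> cyl n x \<inter> cyl n y \<inter> regular \<noteq> {} \<Longrightarrow> cyl n x = cyl n y"
  using cyl_eq[of x _ n n] cyl_eq[of y _ n n] by blast

lemma countable_cyls: "countable (cyl n ` regular)"
proof (induction n)
  case (Suc n)
  have "cyl (Suc n) ` regular \<subseteq> (\<lambda>(C, Z). {y \<in> C. (T ^^ n) y \<in> interior Z}) ` ((cyl n ` regular) \<times> \<xi>)"
    using elt_funpow by (auto simp: cyl_Suc image_iff)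
  then show ?case using Suc countable_xi by (meson countable_SIGMA countable_image countable_subset)
next
  case 0
  have "cyl 0 ` regular \<subseteq> {{0<..<1}}" by (auto simp: cyl_0)
  then show ?case by (rule countable_subset) simp
qed

lemma cyl_sets_lam: "x \<in> regular \<Longrightarrow> cyl n x \<inter> regular \<in> sets lam"
  using cyl_open[of x n] by (auto simp: sets_lam_iff)

lemma nn_integral_lam_cyl_mono:
  assumes f: "f \<in> borel_measurable lam" and g: "g \<in> borel_measurable lam"
    and le: "\<And>x. x \<in> regular \<Longrightarrow> (\<integral>\<^sup>+y\<in>cyl n x \<inter> regular. f y \<partial>lam) \<le> (\<integral>\<^sup>+y\<in>cyl n x \<inter> regular. g y \<partial>lam)"
  shows "(\<integral>\<^sup>+x. f x \<partial>lam) \<le> (\<integral>\<^sup>+x. g x \<partial>lam)"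
proof -
  let ?I = "cyl n ` regular"
  have U: "(\<Union>C\<in>?I. C \<inter> regular) = regular" using cyl_self by blast
  have disj: "disjoint_family_on (\<lambda>C. C \<inter> regular) ?I"
    unfolding disjoint_family_on_def using cyl_disjoint by blast
  have split: "(\<integral>\<^sup>+x. h x \<partial>lam) = (\<integral>\<^sup>+C. (\<integral>\<^sup>+y\<in>C \<inter> regular. h y \<partial>lam) \<partial>count_space ?I)"
    if "h \<in> borel_measurable lam" for h
  proof -
    have "(\<integral>\<^sup>+x. h x \<partial>lam) = (\<integral>\<^sup>+x\<in>(\<Union>C\<in>?I. C \<inter> regular). h x \<partial>lam)"
      unfolding U by (intro nn_integral_cong) (auto simp: space_lam)
    also have "\<dots> = (\<integral>\<^sup>+C. (\<integral>\<^sup>+y\<in>C \<inter> regular. h y \<partial>lam) \<partial>count_space ?I)"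
      by (rule nn_integral_UN_countable[OF that countable_cyls _ disj]) (auto intro: cyl_sets_lam)
    finally show ?thesis .
  qed
  show ?thesis unfolding split[OF f] split[OF g] by (rule nn_integral_mono) (use le in auto)
qed

section \<open>A moment bound for the relative depth\<close>

text \<open>The conditional expectation of \<open>(\<bar>I\<^sub>n\<bar> / \<bar>I\<^bsub>n+1\<^esub>\<bar>)\<^sup>a\<close> given the cylinder of order \<open>n\<close>: by bounded
  distortion the subcylinders have relative sizes comparable to those of the pieces of \<open>I\<^sub>n\<close>,
  which turns the expectation into a fragmentation sum.\<close>

lemma nn_integral_length_ratio:
  assumes a: "0 < a" "a \<le> 1 / 2" and B: "0 < B" and K: "1 \<le> K"
    and chop: "fragmentation_bound a B"
    and dist: "distortion_bound K"
  shows "(\<integral>\<^sup>+x. ennreal ((len (img n x) / len (img (Suc n) x)) powr a) \<partial>lam) \<le> ennreal (K * B)"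
proof -
  interpret prob_space lam by (rule prob_space_lam)
  let ?v = "\<lambda>x. ennreal ((len (img n x) / len (img (Suc n) x)) powr a)"
  have "(\<integral>\<^sup>+x. ?v x \<partial>lam) \<le> (\<integral>\<^sup>+x. ennreal (K * B) \<partial>lam)"
  proof (rule nn_integral_lam_cyl_mono[where n=n])
    fix x assume x: "x \<in> regular"
    let ?C = "cyl n x"
    obtain c d where cd: "c < d" "?C = {c<..<d}" "0 \<le> c" "d \<le> 1" by (rule cyl_bounds[OF x])
    obtain s t where st: "s < t" "img n x = {s<..<t}" "0 \<le> s" "t \<le> 1" by (rule img_bounds[OF x])
    let ?X = "\<lambda>Z. {y \<in> ?C \<inter> regular. (T ^^ n) y \<in> interior Z}"
    let ?l = "\<lambda>Z. len ({s<..<t} \<inter> interior Z)"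
    let ?r = "\<lambda>Z. (t - s) / len (T ` ({s<..<t} \<inter> interior Z))"
    have U: "(\<Union>Z\<in>\<xi>. ?X Z) = ?C \<inter> regular"
      using regular_interior regular_funpow elt_funpow by blast
    have Xs: "?X Z \<in> sets lam" if "Z \<in> \<xi>" for Z
    proof -
      have "open {y \<in> ?C. (T ^^ n) y \<in> interior Z}"
        using continuous_open_preimage[OF cyl_cont[OF x] cyl_open[OF x] open_interior, of n Z]
        by (simp add: Int_def vimage_def)
      moreover have "?X Z = {y \<in> ?C. (T ^^ n) y \<in> interior Z} \<inter> regular" by auto
      ultimately show ?thesis by (auto simp: sets_lam_iff)
    qed
    have disj: "disjoint_family_on ?X \<xi>"
      unfolding disjoint_family_on_def using elt_eq interior_subset by blast
    have "(\<integral>\<^sup>+y\<in>?C \<inter> regular. ?v y \<partial>lam) = (\<integral>\<^sup>+y\<in>(\<Union>Z\<in>\<xi>. ?X Z). ?v y \<partial>lam)"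
      by (simp only: U)
    also have "\<dots> = (\<integral>\<^sup>+Z. (\<integral>\<^sup>+y\<in>?X Z. ?v y \<partial>lam) \<partial>count_space \<xi>)"
      by (rule nn_integral_UN_countable[OF _ countable_xi Xs disj]) measurable
    also have "\<dots> \<le> (\<integral>\<^sup>+Z. ennreal (K * (d - c) / (t - s) * (?r Z powr a * ?l Z)) \<partial>count_space \<xi>)"
    proof (rule nn_integral_mono)
      fix Z assume "Z \<in> space (count_space \<xi>)"
      then have Z: "Z \<in> \<xi>" by simp
      show "(\<integral>\<^sup>+y\<in>?X Z. ?v y \<partial>lam) \<le> ennreal (K * (d - c) / (t - s) * (?r Z powr a * ?l Z))"
      proof (cases "?X Z = {}")
        case True
        then have "(\<integral>\<^sup>+y\<in>?X Z. ?v y \<partial>lam) = 0" by simp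
        then show ?thesis by simp
      next
        case False
        then obtain w where w: "w \<in> ?C" "w \<in> regular" "(T ^^ n) w \<in> interior Z" by auto
        have eZ: "elt ((T ^^ n) w) = Z" using w(3) elt_eq[OF Z] interior_subset by blast
        have cylw: "cyl (Suc n) w = {y \<in> ?C. (T ^^ n) y \<in> interior Z}"
          using cyl_eq[OF x w(1), of n] by (simp add: cyl_Suc eZ)
        have imgw: "img n w = {s<..<t}" "img (Suc n) w = T ` ({s<..<t} \<inter> interior Z)"
          using img_eq[OF x w(1)] st by (simp_all add: img_Suc eZ)
        have XZ: "?X Z = cyl (Suc n) w \<inter> regular" unfolding cylw by auto
        have v: "?v y = ennreal (?r Z powr a)" if "y \<in> ?X Z" for y
        proof -
          have y: "y \<in> cyl (Suc n) w" "y \<in> cyl n w"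
            using that cylw cyl_eq[OF x w(1), of n] by auto
          show ?thesis using img_eq[OF w(2) y(1)] img_eq[OF w(2) y(2)] imgw st by simp
        qed
        obtain c' d' where cd': "c' < d'" "cyl (Suc n) w = {c'<..<d'}" by (rule cyl_bounds[OF w(2)])
        have ne: "{s<..<t} \<inter> interior Z \<noteq> {}"
          using w st(2) by (auto simp: img_def)
        obtain u v where uv: "u < v" "{s<..<t} \<inter> interior Z = {u<..<v}"
          using T_image_Int[OF Z ne] by metis
        have "(t - s) / (K * (d - c)) * (d' - c') \<le> v - u"
        proof (rule interval_len_le_of_expanding[OF cd'(1) uv(1)])
          show "(T ^^ n) ` {c'<..<d'} \<subseteq> {u<..<v}"
            unfolding cd'(2)[symmetric] cylw uv(2)[symmetric] st(2)[symmetric] img_def by auto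
          show "0 \<le> (t - s) / (K * (d - c))" using st cd K by auto
          fix y z assume "y \<in> {c'<..<d'}" "z \<in> {c'<..<d'}"
          then have "y \<in> ?C" "z \<in> ?C" unfolding cd'(2)[symmetric] cylw by auto
          then have "\<bar>y - z\<bar> * (t - s) \<le> K * (d - c) * \<bar>(T ^^ n) y - (T ^^ n) z\<bar>"
            using distortion_boundD[OF dist x, of y n z] st cd by simp
          then show "(t - s) / (K * (d - c)) * \<bar>y - z\<bar> \<le> \<bar>(T ^^ n) y - (T ^^ n) z\<bar>"
            using K cd by (simp add: field_simps)
        qed
        then have size: "d' - c' \<le> K * (d - c) / (t - s) * ?l Z"
          using K cd st uv by (simp add: field_simps)
        have "(\<integral>\<^sup>+y\<in>?X Z. ?v y \<partial>lam) = (\<integral>\<^sup>+y\<in>?X Z. ennreal (?r Z powr a) \<partial>lam)"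
          using v by (intro nn_integral_cong) (auto simp: indicator_def)
        also have "\<dots> = ennreal (?r Z powr a) * emeasure lam (?X Z)"
          using Xs[OF Z] by (simp add: nn_integral_cmult_indicator)
        also have "\<dots> = ennreal (?r Z powr a * (d' - c'))"
          unfolding XZ emeasure_lam_cyl[OF w(2)] using cd' by (simp add: ennreal_mult)
        also have "\<dots> \<le> ennreal (?r Z powr a * (K * (d - c) / (t - s) * ?l Z))"
          by (intro ennreal_leI mult_left_mono size) simp
        finally show ?thesis by (simp add: mult_ac)
      qed
    qed
    also have "\<dots> \<le> ennreal (K * B * (d - c))"
    proof (rule nn_integral_count_space_le[OF countable_xi])
      fix F assume F: "finite F" "F \<subseteq> \<xi>"
      have "(\<Sum>Z\<in>F. ennreal (K * (d - c) / (t - s) * (?r Z powr a * ?l Z)))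
        = ennreal (\<Sum>Z\<in>F. K * (d - c) / (t - s) * (?r Z powr a * ?l Z))"
        using K cd st by (intro sum_ennreal) auto
      also have "(\<Sum>Z\<in>F. K * (d - c) / (t - s) * (?r Z powr a * ?l Z))
        = K * (d - c) / (t - s) * (\<Sum>Z\<in>F. ?r Z powr a * ?l Z)"
        by (rule sum_distrib_left[symmetric])
      also have "\<dots> \<le> K * (d - c) / (t - s) * (B * (t - s))"
        using K cd st chop F by (intro mult_left_mono) (auto simp: fragmentation_bound_def fragmentation_def)
      also have "\<dots> = K * B * (d - c)" using st by simp
      finally show "(\<Sum>Z\<in>F. ennreal (K * (d - c) / (t - s) * (?r Z powr a * ?l Z))) \<le> ennreal (K * B * (d - c))"
        by (simp add: ennreal_leI)
    qed
    also have "\<dots> = (\<integral>\<^sup>+y\<in>?C \<inter> regular. ennreal (K * B) \<partial>lam)"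
      using cyl_sets_lam[OF x, of n] emeasure_lam_cyl[OF x, of n] K B cd
      by (simp add: nn_integral_cmult_indicator ennreal_mult)
    finally show "(\<integral>\<^sup>+y\<in>?C \<inter> regular. ?v y \<partial>lam) \<le> (\<integral>\<^sup>+y\<in>?C \<inter> regular. ennreal (K * B) \<partial>lam)" .
  qed (measurable)
  then show ?thesis using emeasure_space_1 by (simp add: space_lam)
qed

text \<open>Within a cylinder, bounded distortion compares the depth with the distance to the boundary of
  the cylinder itself, whose power \<open>-a\<close> is integrable as \<open>a < 1\<close>.\<close>

lemma nn_integral_relative_depth:
  assumes a: "0 < a" "a \<le> 1 / 2" and K: "1 \<le> K"
    and dist: "distortion_bound K"
  shows "(\<integral>\<^sup>+x. ennreal ((len (img n x) / depth (Suc n) x) powr a) \<partial>lam)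
    \<le> ennreal (4 * K powr a) * (\<integral>\<^sup>+x. ennreal ((len (img n x) / len (img (Suc n) x)) powr a) \<partial>lam)"
proof -
  let ?v = "\<lambda>x. ennreal ((len (img n x) / len (img (Suc n) x)) powr a)"
  let ?u = "\<lambda>x. ennreal ((len (img n x) / depth (Suc n) x) powr a)"
  have "(\<integral>\<^sup>+x. ?u x \<partial>lam) \<le> (\<integral>\<^sup>+x. ennreal (4 * K powr a) * ?v x \<partial>lam)"
  proof (rule nn_integral_lam_cyl_mono[where n="Suc n"])
    fix x assume x: "x \<in> regular"
    let ?C = "cyl (Suc n) x"
    obtain c d where cd: "c < d" "?C = {c<..<d}" "0 \<le> c" "d \<le> 1" by (rule cyl_bounds[OF x])
    obtain s t where st: "s < t" "img n x = {s<..<t}" "0 \<le> s" "t \<le> 1" by (rule img_bounds[OF x])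
    obtain s' t' where st': "s' < t'" "img (Suc n) x = {s'<..<t'}" by (rule img_bounds[OF x])
    let ?q = "(t - s) / (t' - s')"
    have same: "img n y = {s<..<t}" "img (Suc n) y = {s'<..<t'}" "cyl (Suc n) y = {c<..<d}" if "y \<in> ?C" for y
      using img_eq[OF x that] cyl_eq[OF x that, of "Suc n"] img_eq[OF x, of y n] cyl_antimono[of n "Suc n" x]
        that st st' cd by auto
    have q: "0 < ?q" using st st' by simp
    have u: "(len (img n y) / depth (Suc n) y) powr a \<le> (K * (d - c) * ?q) powr a * infdist y (- {c<..<d}) powr (- a)"
      if y: "y \<in> ?C" "y \<in> regular" for y
    proof -
      let ?i = "infdist y (- {c<..<d})"
      have i: "0 < ?i"
      proof -
        have "0 < min (y - c) (d - y)" using y cd by auto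
        also have "\<dots> \<le> ?i" by (rule infdist_compl_ge) (auto simp: dist_real_def)
        finally show ?thesis .
      qed
      have "(t' - s') / (K * (d - c)) * ?i \<le> depth (Suc n) y"
        using depth_ge_distortion[OF y(2) _ dist, of "Suc n"] K same[OF y(1)] cd st' by simp
      moreover have "0 < (t' - s') / (K * (d - c)) * ?i" using i K cd st' by simp
      ultimately have "(t - s) / depth (Suc n) y \<le> (t - s) / ((t' - s') / (K * (d - c)) * ?i)"
        using st by (intro frac_le) auto
      also have "\<dots> = K * (d - c) * ?q / ?i" using K cd st' by (simp add: field_simps)
      finally have "((t - s) / depth (Suc n) y) powr a \<le> (K * (d - c) * ?q / ?i) powr a"
        using a st depth_nonneg[of "Suc n" y] by (intro powr_mono2) auto
      also have "\<dots> = (K * (d - c) * ?q) powr a * ?i powr (- a)"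
        using i K cd less_imp_le[OF q] by (subst powr_divide) (simp_all add: powr_minus_divide)
      finally show ?thesis using same[OF y(1)] st by simp
    qed
    have "(\<integral>\<^sup>+y\<in>?C \<inter> regular. ?u y \<partial>lam) = (\<integral>\<^sup>+y. ?u y * indicator (?C \<inter> regular) y * indicator regular y \<partial>lborel)"
      by (subst nn_integral_restrict_space) auto
    also have "\<dots> \<le> (\<integral>\<^sup>+y. ennreal ((K * (d - c) * ?q) powr a) * (ennreal (infdist y (- {c<..<d}) powr (- a)) * indicator {c<..<d} y) \<partial>lborel)"
    proof (rule nn_integral_mono)
      fix y
      show "?u y * indicator (?C \<inter> regular) y * indicator regular y
        \<le> ennreal ((K * (d - c) * ?q) powr a) * (ennreal (infdist y (- {c<..<d}) powr (- a)) * indicator {c<..<d} y)"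
        using u[of y] by (cases "y \<in> ?C \<inter> regular") (auto simp: cd(2)[symmetric] simp flip: ennreal_mult intro: ennreal_leI)
    qed
    also have "\<dots> = ennreal ((K * (d - c) * ?q) powr a) * (\<integral>\<^sup>+y\<in>{c<..<d}. ennreal (infdist y (- {c<..<d}) powr (- a)) \<partial>lborel)"
      by (rule nn_integral_cmult) measurable
    also have "\<dots> \<le> ennreal ((K * (d - c) * ?q) powr a) * ennreal (4 * (d - c) powr (1 - a))"
      by (intro mult_left_mono nn_integral_infdist_powr cd a) auto
    also have "\<dots> = ennreal (4 * K powr a * ?q powr a * (d - c))"
    proof -
      have "(K * (d - c) * ?q) powr a * (4 * (d - c) powr (1 - a)) = 4 * K powr a * ?q powr a * ((d - c) powr a * (d - c) powr (1 - a))"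
      proof -
        have "(K * (d - c) * r) powr a = K powr a * (d - c) powr a * r powr a" if "0 \<le> r" for r
          using K cd that by (simp add: powr_mult)
        from this[OF less_imp_le[OF q]] show ?thesis by simp
      qed
      also have "(d - c) powr a * (d - c) powr (1 - a) = d - c"
        using cd by (simp flip: powr_add)
      finally have "(K * (d - c) * ?q) powr a * (4 * (d - c) powr (1 - a)) = 4 * K powr a * ?q powr a * (d - c)" .
      then show ?thesis by (metis ennreal_mult' powr_ge_zero)
    qed
    also have "\<dots> = (\<integral>\<^sup>+y\<in>?C \<inter> regular. ennreal (4 * K powr a * ?q powr a) \<partial>lam)"
      using cyl_sets_lam[OF x, of "Suc n"] emeasure_lam_cyl[OF x, of "Suc n"] cd
      by (simp add: nn_integral_cmult_indicator ennreal_mult)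
    also have "\<dots> = (\<integral>\<^sup>+y\<in>?C \<inter> regular. ennreal (4 * K powr a) * ?v y \<partial>lam)"
    proof (rule nn_integral_cong)
      fix y
      have "ennreal (4 * K powr a * ?q powr a) = ennreal (4 * K powr a) * ?v y" if "y \<in> ?C"
        using same[OF that] st st' by (simp add: ennreal_mult)
      then show "ennreal (4 * K powr a * ?q powr a) * indicator (?C \<inter> regular) y = ennreal (4 * K powr a) * ?v y * indicator (?C \<inter> regular) y"
        by (cases "y \<in> ?C \<inter> regular") auto
    qed
    finally show "(\<integral>\<^sup>+y\<in>?C \<inter> regular. ?u y \<partial>lam) \<le> (\<integral>\<^sup>+y\<in>?C \<inter> regular. ennreal (4 * K powr a) * ?v y \<partial>lam)" .
  qed (measurable)
  also have "\<dots> = ennreal (4 * K powr a) * (\<integral>\<^sup>+x. ?v x \<partial>lam)"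
    by (rule nn_integral_cmult) measurable
  finally show ?thesis .
qed

lemma nn_integral_depth_0:
  assumes "0 < a" "a \<le> 1 / 2"
  shows "(\<integral>\<^sup>+x. ennreal (depth 0 x powr (- a)) \<partial>lam) \<le> ennreal 4"
proof -
  have "(\<integral>\<^sup>+x. ennreal (depth 0 x powr (- a)) \<partial>lam) = (\<integral>\<^sup>+x. ennreal (depth 0 x powr (- a)) * indicator regular x \<partial>lborel)"
    by (subst nn_integral_restrict_space) auto
  also have "\<dots> \<le> (\<integral>\<^sup>+x\<in>{0<..<1::real}. ennreal (infdist x (- {0<..<1}) powr (- a)) \<partial>lborel)"
    by (rule nn_integral_mono) (use regular_01 in \<open>auto simp: depth_def img_0 indicator_def\<close>)
  also have "\<dots> \<le> ennreal (4 * (1 - 0) powr (1 - a))"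
    by (rule nn_integral_infdist_powr) (use assms in auto)
  finally show ?thesis by simp
qed

end

section \<open>Averages and logarithms\<close>

lemma eventually_sum_le_of_null:
  fixes x :: "nat \<Rightarrow> real"
  assumes "x \<longlonglongrightarrow> 0" "0 < \<epsilon>"
  shows "\<forall>\<^sub>F n in sequentially. (\<Sum>k<n. x k) \<le> \<epsilon> * real n"
proof -
  obtain N where N: "\<And>k. N \<le> k \<Longrightarrow> \<bar>x k\<bar> < \<epsilon> / 2"
    using LIMSEQ_D[OF assms(1), of "\<epsilon> / 2"] assms(2) by auto
  define S where "S = (\<Sum>k<N. \<bar>x k\<bar>)"
  obtain N' :: nat where N': "2 * S / \<epsilon> < real N'" using reals_Archimedean2 by blast
  show ?thesis
  proof (rule eventually_sequentiallyI[of "max N N'"])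
    fix n assume n: "max N N' \<le> n"
    have "(\<Sum>k<n. x k) \<le> (\<Sum>k<n. \<bar>x k\<bar>)" by (intro sum_mono) auto
    also have "\<dots> = S + (\<Sum>k=N..<n. \<bar>x k\<bar>)"
      unfolding S_def lessThan_atLeast0 by (rule sum.atLeastLessThan_concat[symmetric]) (use n in auto)
    also have "\<dots> \<le> S + (\<Sum>k=N..<n. \<epsilon> / 2)"
      using N by (intro add_left_mono sum_mono) (auto intro: less_imp_le)
    also have "\<dots> \<le> S + real n * (\<epsilon> / 2)" using assms(2) by (simp add: mult_right_mono)
    also have "S \<le> real n * (\<epsilon> / 2)"
    proof -
      have "2 * S / \<epsilon> < real n" using N' n by simp
      then show ?thesis using assms(2) by (simp add: field_simps)
    qed
    finally show "(\<Sum>k<n. x k) \<le> \<epsilon> * real n" by (simp add: field_simps)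
  qed
qed

lemma cesaro_mean_tendsto:
  fixes x :: "nat \<Rightarrow> real"
  assumes "x \<longlonglongrightarrow> L"
  shows "(\<lambda>n. (\<Sum>k<n. x k) / real n) \<longlonglongrightarrow> L"
proof (rule tendstoI)
  fix e :: real assume e: "0 < e"
  have "(\<lambda>k. \<bar>x k - L\<bar>) \<longlonglongrightarrow> 0"
    using assms by (intro tendsto_rabs_zero) (simp add: LIM_zero_iff)
  then have "\<forall>\<^sub>F n in sequentially. (\<Sum>k<n. \<bar>x k - L\<bar>) \<le> e / 2 * real n"
    by (rule eventually_sum_le_of_null) (use e in simp)
  then show "\<forall>\<^sub>F n in sequentially. dist ((\<Sum>k<n. x k) / real n) L < e"
    using eventually_gt_at_top[of 0]
  proof eventually_elim
    case (elim n)
    have "(\<Sum>k<n. x k) / real n - L = (\<Sum>k<n. x k - L) / real n"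
      using elim(2) by (simp add: sum_subtractf diff_divide_distrib)
    then have "dist ((\<Sum>k<n. x k) / real n) L = \<bar>\<Sum>k<n. x k - L\<bar> / real n" by (simp add: dist_real_def)
    also have "\<dots> \<le> (\<Sum>k<n. \<bar>x k - L\<bar>) / real n" by (intro divide_right_mono sum_abs) simp
    also have "\<dots> \<le> e / 2" using elim by (simp add: pos_divide_le_eq)
    finally show ?case using e by simp
  qed
qed

lemma ln_le_powr:
  fixes y a :: real
  assumes "0 < y" "0 < a"
  shows "ln y \<le> (1 / a) * y powr a"
proof -
  have "a * ln y = ln (y powr a)" using assms by (simp add: ln_powr)
  also have "\<dots> \<le> y powr a" using assms ln_le_minus_one[of "y powr a"] by simp
  finally show ?thesis using assms by (simp add: field_simps)
qed

context interval_map
begin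

section \<open>Laws of orbit points and the limit measure\<close>

text \<open>Values on the countable set of irregular points do not affect measurability.\<close>

lemma measurable_unit_of_lam:
  assumes f: "f \<in> measurable lam N" and sp: "f ` unit_ivl \<subseteq> space N"
  shows "f \<in> measurable leb_unit N"
proof (rule measurableI)
  show "f x \<in> space N" if "x \<in> space leb_unit" for x using that sp by (auto simp: space_restrict_space)
  fix A assume A: "A \<in> sets N"
  have "f -` A \<inter> regular \<in> sets lam" using measurable_sets[OF f A] by (simp add: space_lam)
  then have 1: "f -` A \<inter> regular \<in> sets borel" by (simp add: sets_lam_iff)
  have 2: "f -` A \<inter> (unit_ivl - regular) \<in> sets borel"
    by (rule sets.countable[OF _ countable_subset[OF _ countable_irregular]]) auto
  have "f -` A \<inter> space leb_unit = (f -` A \<inter> regular) \<union> (f -` A \<inter> (unit_ivl - regular))"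
    using regular_unit by (auto simp: space_restrict_space)
  then show "f -` A \<inter> space leb_unit \<in> sets leb_unit"
    using 1 2 regular_unit by (auto simp: sets_restrict_space_iff space_restrict_space)
qed

lemma funpow_measurable_unit: "T ^^ n \<in> measurable leb_unit leb_unit"
proof (rule measurable_unit_of_lam)
  have "T ^^ n \<in> measurable lam (restrict_space borel unit_ivl)"
    using measurable_lam_funpow[of n] funpow_unit regular_unit
    by (intro measurable_restrict_space2) (auto simp: space_lam)
  moreover have "sets leb_unit = sets (restrict_space borel unit_ivl)" by (simp add: sets_restrict_space)
  ultimately show "T ^^ n \<in> measurable lam leb_unit"
    using measurable_cong_sets[OF refl, of leb_unit "restrict_space borel unit_ivl" lam] by blast
  show "(T ^^ n) ` unit_ivl \<subseteq> space leb_unit" using funpow_unit by (auto simp: space_restrict_space)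
qed

text \<open>The law of \<open>T\<^sup>n\<close> under Lebesgue measure.\<close>

definition orbit_law :: "nat \<Rightarrow> real measure" where
  "orbit_law n = distr leb_unit leb_unit (T ^^ n)"

lemma prob_space_leb_unit: "prob_space leb_unit"
  by (rule prob_spaceI) (simp add: emeasure_restrict_space space_restrict_space)

lemma prob_space_orbit_law: "prob_space (orbit_law n)"
  unfolding orbit_law_def by (rule prob_space.prob_space_distr[OF prob_space_leb_unit funpow_measurable_unit])

lemma sets_leb_unit_iff: "A \<in> sets leb_unit \<longleftrightarrow> A \<subseteq> unit_ivl \<and> A \<in> sets borel"
  by (auto simp: sets_restrict_space_iff)

lemma emeasure_lam_vimage:
  assumes "A \<in> sets borel" "A \<subseteq> unit_ivl"
  shows "emeasure lam {x \<in> regular. (T ^^ n) x \<in> A} = emeasure (orbit_law n) A"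
proof -
  have A: "A \<in> sets leb_unit" using assms by (simp add: sets_leb_unit_iff)
  let ?B = "(T ^^ n) -` A \<inter> unit_ivl"
  have B: "?B \<in> sets borel"
    using measurable_sets[OF funpow_measurable_unit A, of n] by (simp add: space_restrict_space sets_leb_unit_iff)
  have "emeasure (orbit_law n) A = emeasure leb_unit ?B"
    unfolding orbit_law_def using emeasure_distr[OF funpow_measurable_unit A, of n] by (simp add: space_restrict_space)
  also have "\<dots> = emeasure lborel ?B" using B by (intro emeasure_restrict_space) auto
  also have "\<dots> = emeasure lborel (?B \<inter> regular)" using B by (intro emeasure_Int_regular[symmetric]) auto
  also have "\<dots> = emeasure lam (?B \<inter> regular)" using B by (intro emeasure_lam[symmetric]) auto
  also have "?B \<inter> regular = {x \<in> regular. (T ^^ n) x \<in> A}" using regular_unit by auto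
  finally show ?thesis by simp
qed

lemma measure_orbit_law_tv:
  assumes "limit_acip T \<mu>" "A \<in> sets borel" "A \<subseteq> unit_ivl"
  shows "\<bar>measure (orbit_law n) A - measure \<mu> A\<bar> \<le> tv_dist (orbit_law n) \<mu>"
  unfolding tv_dist_def
proof (rule cSUP_upper)
  interpret \<mu>: prob_space \<mu> using assms(1) by (simp add: limit_acip_def)
  interpret o: prob_space "orbit_law n" by (rule prob_space_orbit_law)
  show "A \<in> sets leb_unit" using assms by (simp add: sets_leb_unit_iff)
  show "bdd_above ((\<lambda>A. \<bar>measure (orbit_law n) A - measure \<mu> A\<bar>) ` sets leb_unit)"
    by (intro bdd_aboveI2[of _ _ 1]) (smt (verit) \<mu>.prob_le_1 o.prob_le_1 measure_nonneg)
qed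

lemma tv_orbit_law: "limit_acip T \<mu> \<Longrightarrow> (\<lambda>n. tv_dist (orbit_law n) \<mu>) \<longlonglongrightarrow> 0"
  by (simp add: limit_acip_def orbit_law_def)

lemma measure_lam_vimage_le:
  assumes "limit_acip T \<mu>" "A \<in> sets borel" "A \<subseteq> unit_ivl"
  shows "measure lam {x \<in> regular. (T ^^ n) x \<in> A} \<le> measure \<mu> A + tv_dist (orbit_law n) \<mu>"
  using measure_orbit_law_tv[OF assms, of n] emeasure_lam_vimage[OF assms(2,3), of n]
  by (simp add: measure_def)

lemma limit_acip_sets: assumes "limit_acip T \<mu>" shows "sets \<mu> = sets leb_unit" "space \<mu> = unit_ivl"
proof -
  show s: "sets \<mu> = sets leb_unit" using assms by (simp add: limit_acip_def)
  show "space \<mu> = unit_ivl" using sets_eq_imp_space_eq[OF s] by (simp add: space_restrict_space)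
qed

text \<open>The height function of the drift argument, \<open>log (\<rho> / r\<^sub>n)\<close> truncated below at 0.\<close>

definition excess :: "real \<Rightarrow> nat \<Rightarrow> real \<Rightarrow> real" where
  "excess \<rho> n x = max 0 (ln (\<rho> / depth n x))"

lemma measurable_excess[measurable]: "excess \<rho> n \<in> borel_measurable lam"
  unfolding excess_def by measurable

text \<open>The pointwise drift inequality. With \<open>u = \<bar>I\<^sub>n\<bar> / r\<^bsub>n+1\<^esub>\<close> there are three cases. Near an endpoint of a
  branch the excess grows by at most \<open>log u\<close>, which is split by the inequality of the means into a
  large multiple of the indicator of this rare event and a small multiple of \<open>u\<^sup>a\<close>. At depth at
  least \<open>\<rho>\<close> the excess vanishes and the new one is at most \<open>log ((\<rho>1 / \<rho>) u)\<close>, small on average if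
  \<open>\<rho>1\<close> is much smaller than \<open>\<rho>\<close>. In the remaining case the depth grows by the factor \<open>\<Lambda>\<close>.\<close>

lemma excess_drift:
  fixes n :: nat
  assumes x: "x \<in> regular" and \<Lambda>: "1 < \<Lambda>" and a: "0 < a" and t: "0 < t" and \<rho>: "0 < \<rho>1" "\<rho>1 \<le> \<rho>"
    and exp: "expanding \<Lambda>"
  defines "u \<equiv> len (img n x) / depth (Suc n) x"
  shows "excess \<rho>1 (Suc n) x + ln \<Lambda> * indicator {x. \<rho> \<le> margin ((T ^^ n) x) \<and> depth n x < \<rho>1 / \<Lambda>} x
    \<le> excess \<rho>1 n x + (1 / a) * (((\<rho>1 / \<rho>) powr a + 1 / t) * u powr a
        + t * indicator {x. margin ((T ^^ n) x) < \<rho>} x)"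
proof -
  let ?m = "margin ((T ^^ n) x)" let ?r = "depth n x" let ?r' = "depth (Suc n) x"
  have r: "0 < ?r" "0 < ?r'" "?r \<le> len (img n x)" using depth_pos[OF x] depth_le_len[OF x] by auto
  have u: "0 < u" "?r / ?r' \<le> u" using r by (auto simp: u_def divide_right_mono)
  have ua: "0 \<le> u powr a" by simp
  have step: "\<Lambda> * min ?m ?r \<le> ?r'" using depth_Suc_expand[OF x _ exp] \<Lambda> by simp
  have lnL: "0 < ln \<Lambda>" using \<Lambda> by simp
  have extra: "0 \<le> (1 / a) * (((\<rho>1 / \<rho>) powr a + 1 / t) * u powr a)"
    using a t by (intro mult_nonneg_nonneg add_nonneg_nonneg) auto
  consider "?m < \<rho>" | "\<rho> \<le> ?m" "\<rho> \<le> ?r" | "\<rho> \<le> ?m" "?r < \<rho>" by linarith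
  then show ?thesis
  proof cases
    case 1
    have "ln (\<rho>1 / ?r') = ln (\<rho>1 / ?r) + ln (?r / ?r')" using r \<rho> by (simp add: ln_div)
    also have "ln (?r / ?r') \<le> ln u" using r u by simp
    also have "ln u \<le> (1 / (a/2)) * u powr (a/2)" using u a by (intro ln_le_powr) auto
    also have "\<dots> = (1 / a) * (2 * u powr (a/2))" by simp
    also have "2 * u powr (a/2) \<le> t + u powr a / t"
    proof -
      have w: "u powr a = (u powr (a/2))\<^sup>2" using u by (simp add: power2_eq_square flip: powr_add)
      have "0 \<le> (t - u powr (a/2))\<^sup>2" by simp
      then have "2 * u powr (a/2) * t \<le> t * t + u powr a" unfolding w by (simp add: power2_eq_square algebra_simps)
      then show ?thesis using t by (simp add: field_simps)
    qed
    finally have "ln (\<rho>1 / ?r') \<le> ln (\<rho>1 / ?r) + (1 / a) * (t + u powr a / t)" using a by (simp add: divide_right_mono)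
    moreover have "0 \<le> (1 / a) * (t + u powr a / t)" using a t by (intro mult_nonneg_nonneg add_nonneg_nonneg) auto
    ultimately have "excess \<rho>1 (Suc n) x \<le> excess \<rho>1 n x + (1 / a) * (t + u powr a / t)"
      unfolding excess_def by linarith
    also have "\<dots> \<le> excess \<rho>1 n x + (1 / a) * (((\<rho>1 / \<rho>) powr a + 1 / t) * u powr a + t)"
      using a by (intro add_left_mono mult_left_mono) (auto simp: algebra_simps)
    finally show ?thesis using 1 by simp
  next
    case 2
    have "\<rho>1 / \<Lambda> < \<rho>1" using \<rho> \<Lambda> by (simp add: field_simps)
    then have ind: "\<not> ?r < \<rho>1 / \<Lambda>" using 2 \<rho> by simp
    have "\<rho>1 / ?r' = (\<rho>1 / \<rho>) * (\<rho> / ?r')" using \<rho> by simp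
    also have "\<dots> \<le> (\<rho>1 / \<rho>) * u"
      using \<rho> r 2 by (intro mult_left_mono) (auto simp: u_def intro!: divide_right_mono)
    finally have "ln (\<rho>1 / ?r') \<le> ln ((\<rho>1 / \<rho>) * u)" using \<rho> r u by simp
    also have "\<dots> \<le> (1 / a) * ((\<rho>1 / \<rho>) * u) powr a" using \<rho> u a by (intro ln_le_powr) auto
    also have "\<dots> = (1 / a) * ((\<rho>1 / \<rho>) powr a * u powr a)" using \<rho> u by (subst powr_mult) auto
    also have "\<dots> \<le> (1 / a) * (((\<rho>1 / \<rho>) powr a + 1 / t) * u powr a)"
      using a t by (intro mult_left_mono mult_right_mono) auto
    finally have "excess \<rho>1 (Suc n) x \<le> excess \<rho>1 n x + (1 / a) * (((\<rho>1 / \<rho>) powr a + 1 / t) * u powr a)"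
      using extra unfolding excess_def by linarith
    then show ?thesis using ind 2 by simp
  next
    case 3
    have "\<Lambda> * ?r \<le> ?r'" using step 3 by simp
    then have "\<rho>1 / ?r' \<le> \<rho>1 / (\<Lambda> * ?r)" using r \<rho> \<Lambda> by (intro frac_le) auto
    then have "ln (\<rho>1 / ?r') \<le> ln (\<rho>1 / (\<Lambda> * ?r))" using r \<rho> \<Lambda> by (subst ln_le_cancel_iff) auto
    also have "\<dots> = ln (\<rho>1 / ?r) - ln \<Lambda>" using r \<rho> \<Lambda> by (simp add: ln_div ln_mult)
    finally have le: "ln (\<rho>1 / ?r') \<le> ln (\<rho>1 / ?r) - ln \<Lambda>" .
    have "excess \<rho>1 (Suc n) x + ln \<Lambda> * indicator {x. \<rho> \<le> margin ((T ^^ n) x) \<and> depth n x < \<rho>1 / \<Lambda>} x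
        \<le> excess \<rho>1 n x"
    proof (cases "?r < \<rho>1 / \<Lambda>")
      case True
      then have "\<Lambda> < \<rho>1 / ?r" using r \<Lambda> by (simp add: field_simps)
      then have "ln \<Lambda> < ln (\<rho>1 / ?r)" using \<Lambda> by simp
      then show ?thesis using le True 3 unfolding excess_def by simp
    next
      case False
      then show ?thesis using le lnL unfolding excess_def by simp
    qed
    then show ?thesis using extra 3 by simp
  qed
qed

text \<open>The drift inequality, integrated and summed over time. The term \<open>4 * \<rho>1 powr a / a\<close> bounds the
  integral of the excess at time 0.\<close>

lemma excess_integral_bound:
  assumes \<Lambda>: "1 < \<Lambda>" and a: "0 < a" "a \<le> 1 / 2" and t: "0 < t" and \<rho>: "0 < \<rho>1" "\<rho>1 \<le> \<rho>"
    and exp: "expanding \<Lambda>"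
    and M: "0 \<le> M" "\<And>n. (\<integral>\<^sup>+x. ennreal ((len (img n x) / depth (Suc n) x) powr a) \<partial>lam) \<le> ennreal M"
  shows "ln \<Lambda> * (\<Sum>k<n. measure lam {x \<in> regular. \<rho> \<le> margin ((T ^^ k) x) \<and> depth k x < \<rho>1 / \<Lambda>})
    \<le> 4 * \<rho>1 powr a / a + (\<Sum>k<n. (1 / a) * (((\<rho>1 / \<rho>) powr a + 1 / t) * M
        + t * measure lam {x \<in> regular. margin ((T ^^ k) x) < \<rho>}))"
proof -
  interpret prob_space lam by (rule prob_space_lam)
  define P where "P = (\<lambda>k. {x \<in> regular. \<rho> \<le> margin ((T ^^ k) x) \<and> depth k x < \<rho>1 / \<Lambda>})"
  define b where "b = (\<lambda>k. {x \<in> regular. margin ((T ^^ k) x) < \<rho>})"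
  define E where "E = (\<lambda>k. \<integral>\<^sup>+x. ennreal (excess \<rho>1 k x) \<partial>lam)"
  define w where "w = (\<rho>1 / \<rho>) powr a + 1 / t"
  have w: "0 \<le> w" using t by (simp add: w_def)
  have lnL: "0 < ln \<Lambda>" using \<Lambda> by simp
  have Ps[measurable]: "P k \<in> sets lam" for k
  proof -
    have "{x \<in> space lam. \<rho> \<le> margin ((T ^^ k) x) \<and> depth k x < \<rho>1 / \<Lambda>} \<in> sets lam" by measurable
    then show ?thesis by (simp only: P_def space_lam)
  qed
  have bs[measurable]: "b k \<in> sets lam" for k
  proof -
    have "{x \<in> space lam. margin ((T ^^ k) x) < \<rho>} \<in> sets lam" by measurable
    then show ?thesis by (simp only: b_def space_lam)
  qed
  have step: "E (Suc k) + ennreal (ln \<Lambda> * measure lam (P k)) \<le> E k + ennreal ((1 / a) * (w * M + t * measure lam (b k)))" for k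
  proof -
    let ?u = "\<lambda>x. (len (img k x) / depth (Suc k) x) powr a"
    have "E (Suc k) + ennreal (ln \<Lambda> * measure lam (P k))
        = E (Suc k) + (\<integral>\<^sup>+x. ennreal (ln \<Lambda>) * indicator (P k) x \<partial>lam)"
      using lnL by (simp add: nn_integral_cmult_indicator emeasure_eq_measure ennreal_mult)
    also have "\<dots> = (\<integral>\<^sup>+x. ennreal (excess \<rho>1 (Suc k) x) + ennreal (ln \<Lambda>) * indicator (P k) x \<partial>lam)"
      unfolding E_def by (rule nn_integral_add[symmetric]) measurable
    also have "\<dots> \<le> (\<integral>\<^sup>+x. ennreal (excess \<rho>1 k x) + (ennreal (w / a) * ennreal (?u x) + ennreal (t / a) * indicator (b k) x) \<partial>lam)"
    proof (rule nn_integral_mono)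
      fix x assume "x \<in> space lam"
      then have x: "x \<in> regular" by (simp add: space_lam)
      have iP: "indicator {x. \<rho> \<le> margin ((T ^^ k) x) \<and> depth k x < \<rho>1 / \<Lambda>} x = (indicator (P k) x :: real)"
        and ib: "indicator {x. margin ((T ^^ k) x) < \<rho>} x = (indicator (b k) x :: real)"
        using x by (auto simp: P_def b_def indicator_def)
      have "excess \<rho>1 (Suc k) x + ln \<Lambda> * indicator (P k) x
          \<le> excess \<rho>1 k x + (1 / a) * (w * ?u x + t * indicator (b k) x)"
        using excess_drift[where n=k, OF x \<Lambda> a(1) t \<rho> exp] unfolding iP ib w_def by simp
      also have "\<dots> = excess \<rho>1 k x + (w / a * ?u x + t / a * indicator (b k) x)" by (simp add: add_divide_distrib)
      finally have le: "excess \<rho>1 (Suc k) x + ln \<Lambda> * indicator (P k) x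
          \<le> excess \<rho>1 k x + (w / a * ?u x + t / a * indicator (b k) x)" .
      have eq1: "ennreal (excess \<rho>1 (Suc k) x + ln \<Lambda> * indicator (P k) x)
          = ennreal (excess \<rho>1 (Suc k) x) + ennreal (ln \<Lambda>) * indicator (P k) x"
        using lnL by (simp add: excess_def indicator_def)
      have eq2: "ennreal (excess \<rho>1 k x + (w / a * ?u x + t / a * indicator (b k) x))
          = ennreal (excess \<rho>1 k x) + (ennreal (w / a) * ennreal (?u x) + ennreal (t / a) * indicator (b k) x)"
        using w a t by (simp add: excess_def indicator_def flip: ennreal_mult)
      show "ennreal (excess \<rho>1 (Suc k) x) + ennreal (ln \<Lambda>) * indicator (P k) x
        \<le> ennreal (excess \<rho>1 k x) + (ennreal (w / a) * ennreal (?u x) + ennreal (t / a) * indicator (b k) x)"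
        unfolding eq1[symmetric] eq2[symmetric] by (rule ennreal_leI[OF le])
    qed
    also have "\<dots> = E k + (ennreal (w / a) * (\<integral>\<^sup>+x. ennreal (?u x) \<partial>lam) + ennreal (t / a) * emeasure lam (b k))"
      by (simp add: nn_integral_add nn_integral_cmult nn_integral_cmult_indicator E_def)
    also have "\<dots> \<le> E k + (ennreal (w / a) * ennreal M + ennreal (t / a) * emeasure lam (b k))"
      by (intro add_left_mono add_right_mono mult_left_mono M) simp
    also have "\<dots> = E k + ennreal ((1 / a) * (w * M + t * measure lam (b k)))"
      using w a t M by (simp add: emeasure_eq_measure add_divide_distrib flip: ennreal_mult ennreal_plus)
    finally show ?thesis .
  qed
  have E0: "E 0 \<le> ennreal (4 * \<rho>1 powr a / a)"
  proof -
    have "E 0 \<le> (\<integral>\<^sup>+x. ennreal (\<rho>1 powr a / a) * ennreal (depth 0 x powr (- a)) \<partial>lam)"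
      unfolding E_def
    proof (rule nn_integral_mono)
      fix x assume "x \<in> space lam"
      then have r: "0 < depth 0 x" using depth_pos by (simp add: space_lam)
      have "ln (\<rho>1 / depth 0 x) \<le> (1 / a) * (\<rho>1 / depth 0 x) powr a" using \<rho> r a by (intro ln_le_powr) auto
      also have "\<dots> = \<rho>1 powr a / a * depth 0 x powr (- a)"
        using \<rho> r by (simp add: powr_divide powr_minus_divide)
      finally have "excess \<rho>1 0 x \<le> \<rho>1 powr a / a * depth 0 x powr (- a)"
        using a by (simp add: excess_def)
      then show "ennreal (excess \<rho>1 0 x) \<le> ennreal (\<rho>1 powr a / a) * ennreal (depth 0 x powr (- a))"
        using a by (simp add: ennreal_leI flip: ennreal_mult)
    qed
    also have "\<dots> = ennreal (\<rho>1 powr a / a) * (\<integral>\<^sup>+x. ennreal (depth 0 x powr (- a)) \<partial>lam)"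
      by (rule nn_integral_cmult) measurable
    also have "\<dots> \<le> ennreal (\<rho>1 powr a / a) * ennreal 4"
      by (intro mult_left_mono nn_integral_depth_0 a) simp
    also have "\<dots> = ennreal (4 * \<rho>1 powr a / a)" using a by (subst ennreal_mult[symmetric]) (auto simp: mult.commute)
    finally show ?thesis .
  qed
  have "E n + ennreal (\<Sum>k<n. ln \<Lambda> * measure lam (P k))
      \<le> E 0 + ennreal (\<Sum>k<n. (1 / a) * (w * M + t * measure lam (b k)))"
  proof (induction n)
    case (Suc n)
    have nn: "0 \<le> (1 / a) * (w * M + t * measure lam (b k))" "0 \<le> ln \<Lambda> * measure lam (P k)" for k
      using w M a t lnL by auto
    have "E (Suc n) + ennreal (\<Sum>k<Suc n. ln \<Lambda> * measure lam (P k))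
        = (E (Suc n) + ennreal (ln \<Lambda> * measure lam (P n))) + ennreal (\<Sum>k<n. ln \<Lambda> * measure lam (P k))"
      using nn by (simp add: ennreal_plus sum_nonneg add_ac del: times_divide_eq_left)
    also have "\<dots> \<le> (E n + ennreal ((1 / a) * (w * M + t * measure lam (b n)))) + ennreal (\<Sum>k<n. ln \<Lambda> * measure lam (P k))"
      by (intro add_right_mono step)
    also have "\<dots> = (E n + ennreal (\<Sum>k<n. ln \<Lambda> * measure lam (P k))) + ennreal ((1 / a) * (w * M + t * measure lam (b n)))"
      by (simp add: add_ac)
    also have "\<dots> \<le> (E 0 + ennreal (\<Sum>k<n. (1 / a) * (w * M + t * measure lam (b k)))) + ennreal ((1 / a) * (w * M + t * measure lam (b n)))"
      by (intro add_right_mono Suc)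
    also have "\<dots> = E 0 + ennreal (\<Sum>k<Suc n. (1 / a) * (w * M + t * measure lam (b k)))"
      using nn(1) by (simp add: ennreal_plus[symmetric] sum_nonneg add.assoc del: ennreal_plus times_divide_eq_left)
    finally show ?case .
  qed simp
  moreover have "ennreal (\<Sum>k<n. ln \<Lambda> * measure lam (P k)) \<le> E n + ennreal (\<Sum>k<n. ln \<Lambda> * measure lam (P k))"
    by (rule add_increasing) simp_all
  ultimately have "ennreal (\<Sum>k<n. ln \<Lambda> * measure lam (P k))
      \<le> E 0 + ennreal (\<Sum>k<n. (1 / a) * (w * M + t * measure lam (b k)))"
    by (rule order_trans[rotated])
  also have "\<dots> \<le> ennreal (4 * \<rho>1 powr a / a) + ennreal (\<Sum>k<n. (1 / a) * (w * M + t * measure lam (b k)))"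
    by (intro add_right_mono E0)
  also have "\<dots> = ennreal (4 * \<rho>1 powr a / a + (\<Sum>k<n. (1 / a) * (w * M + t * measure lam (b k))))"
    using w M a t by (intro ennreal_plus[symmetric] sum_nonneg) auto
  finally have "(\<Sum>k<n. ln \<Lambda> * measure lam (P k)) \<le> 4 * \<rho>1 powr a / a + (\<Sum>k<n. (1 / a) * (w * M + t * measure lam (b k)))"
    using w M a t by (subst (asm) ennreal_le_iff) (auto intro!: add_nonneg_nonneg sum_nonneg)
  then show ?thesis by (simp add: sum_distrib_left P_def b_def w_def)
qed

lemma margin_small_measure:
  assumes "limit_acip T \<mu>" "0 < \<epsilon>"
  obtains \<rho> where "0 < \<rho>" "measure \<mu> {y \<in> regular. margin y < \<rho>} < \<epsilon>"
proof -
  interpret \<mu>: prob_space \<mu> using assms(1) by (simp add: limit_acip_def)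
  let ?A = "\<lambda>i::nat. {y \<in> regular. margin y < 1 / real (Suc i)}"
  have A: "?A i \<in> sets \<mu>" for i
  proof -
    have "{y \<in> space lam. margin y < 1 / real (Suc i)} \<in> sets lam"
      by (rule borel_measurable_less[OF continuous_on_measurable_lam[OF margin_continuous]]) simp
    then show ?thesis using regular_unit unfolding limit_acip_sets[OF assms(1)] sets_leb_unit_iff sets_lam_iff space_lam by auto
  qed
  have dec: "decseq ?A"
  proof (rule decseq_SucI)
    fix i have "1 / real (Suc (Suc i)) \<le> 1 / real (Suc i)" by (simp add: frac_le)
    then show "?A (Suc i) \<subseteq> ?A i" by auto
  qed
  have "(\<Inter>i. ?A i) = {}"
  proof (rule equals0I)
    fix y assume y: "y \<in> (\<Inter>i. ?A i)"
    then have "0 < margin y" using margin_pos by auto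
    then obtain i where "1 / real (Suc i) < margin y" using nat_approx_posE by blast
    moreover have "margin y < 1 / real (Suc i)" using y by blast
    ultimately show False by simp
  qed
  then have "(\<lambda>i. measure \<mu> (?A i)) \<longlonglongrightarrow> 0"
    using \<mu>.finite_Lim_measure_decseq[of ?A] A dec by auto
  then have "\<forall>\<^sub>F i in sequentially. measure \<mu> (?A i) < \<epsilon>" using assms(2) by (rule order_tendstoD)
  then obtain i where "measure \<mu> (?A i) < \<epsilon>" by (auto simp: eventually_sequentially)
  then show ?thesis using that[of "1 / real (Suc i)"] by simp
qed

text \<open>The parameters are chosen in the order \<open>t\<close>, \<open>\<rho>\<close>, \<open>\<rho>1\<close>, so that each of the error terms in
  \<open>excess_integral_bound\<close> is at most \<open>\<eta>\<close> per unit of time, up to the deviation of the law of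
  \<open>T\<^sup>n\<close> from \<open>\<mu>\<close>.\<close>

lemma shallow_orbits_rare:
  assumes H: "H1 T \<xi>" "H2 T \<xi>" and \<mu>: "limit_acip T \<mu>" and \<epsilon>: "0 < \<epsilon>"
  obtains \<rho> where "0 < \<rho>"
    "\<forall>\<^sub>F n in sequentially. (\<Sum>k<n. measure lam {x \<in> regular. depth k x < \<rho>}) \<le> \<epsilon> * real n"
proof -
  interpret prob_space lam by (rule prob_space_lam)
  obtain \<Lambda> where \<Lambda>: "1 < \<Lambda>" and
    exp: "expanding \<Lambda>"
    using H1_uniform_expansion[OF H(1)] by blast
  obtain a B where a: "0 < a" "a \<le> 1 / 2" and B: "0 < B" and
    chop: "fragmentation_bound a B"
    using H1_chopping_estimate[OF H(1)] by blast
  obtain K where K: "1 \<le> K" and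
    dist: "distortion_bound K"
    using bounded_distortion[OF H(2) \<Lambda>] exp by blast
  define M where "M = 4 * K powr a * (K * B)"
  have M0: "0 < M" using K B by (simp add: M_def)
  have M: "(\<integral>\<^sup>+x. ennreal ((len (img n x) / depth (Suc n) x) powr a) \<partial>lam) \<le> ennreal M" for n
  proof -
    have "(\<integral>\<^sup>+x. ennreal ((len (img n x) / depth (Suc n) x) powr a) \<partial>lam)
        \<le> ennreal (4 * K powr a) * (\<integral>\<^sup>+x. ennreal ((len (img n x) / len (img (Suc n) x)) powr a) \<partial>lam)"
      by (rule nn_integral_relative_depth[OF a K dist])
    also have "\<dots> \<le> ennreal (4 * K powr a) * ennreal (K * B)"
      by (intro mult_left_mono nn_integral_length_ratio[OF a B K chop dist] zero_le)
    also have "\<dots> = ennreal M" using K B by (simp add: M_def ennreal_mult)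
    finally show ?thesis .
  qed
  define L where "L = ln \<Lambda>"
  have L: "0 < L" using \<Lambda> by (simp add: L_def)
  define \<eta> where "\<eta> = \<epsilon> * L / 8"
  have \<eta>: "0 < \<eta>" using \<epsilon> L by (simp add: \<eta>_def)
  define t where "t = M / (a * \<eta>)"
  have t: "0 < t" "M / (a * t) = \<eta>" using M0 a \<eta> by (simp_all add: t_def)
  define Q where "Q = t / a + L"
  have Q: "0 < Q" using t a L by (simp add: Q_def add_pos_pos)
  obtain \<rho> where \<rho>: "0 < \<rho>" "measure \<mu> {y \<in> regular. margin y < \<rho>} < \<eta> / Q"
    using margin_small_measure[OF \<mu>, of "\<eta> / Q"] \<eta> Q by auto
  define s where "s = min 1 ((a * \<eta> / M) powr (1 / a))"
  have s: "0 < s" "s \<le> 1" using a \<eta> M0 by (auto simp: s_def)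
  have "s powr a \<le> ((a * \<eta> / M) powr (1 / a)) powr a" using s a by (intro powr_mono2) (auto simp: s_def)
  also have "\<dots> = a * \<eta> / M" using a \<eta> M0 by (simp add: powr_powr)
  finally have sa: "s powr a * M / a \<le> \<eta>" using a M0 by (simp add: field_simps)
  define \<rho>1 where "\<rho>1 = s * \<rho>"
  have \<rho>1: "0 < \<rho>1" "\<rho>1 \<le> \<rho>" "\<rho>1 / \<rho> = s" using s \<rho> by (auto simp: \<rho>1_def mult_left_le_one_le)
  let ?P = "\<lambda>k. {x \<in> regular. \<rho> \<le> margin ((T ^^ k) x) \<and> depth k x < \<rho>1 / \<Lambda>}"
  let ?b = "\<lambda>k. {x \<in> regular. margin ((T ^^ k) x) < \<rho>}"
  let ?q = "\<lambda>k. {x \<in> regular. depth k x < \<rho>1 / \<Lambda>}"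
  let ?tv = "\<lambda>k. tv_dist (orbit_law k) \<mu>"
  have b: "measure lam (?b k) \<le> \<eta> / Q + ?tv k" for k
  proof -
    have "{y \<in> space lam. margin y < \<rho>} \<in> sets lam"
      by (rule borel_measurable_less[OF continuous_on_measurable_lam[OF margin_continuous]]) simp
    then have "{y \<in> regular. margin y < \<rho>} \<in> sets borel" unfolding space_lam sets_lam_iff by simp
    moreover have "{x \<in> regular. (T ^^ k) x \<in> {y \<in> regular. margin y < \<rho>}} = ?b k"
      using regular_funpow by auto
    moreover have "{y \<in> regular. margin y < \<rho>} \<subseteq> unit_ivl" using regular_unit by blast
    ultimately show ?thesis
      using measure_lam_vimage_le[OF \<mu>, of "{y \<in> regular. margin y < \<rho>}" k] \<rho>(2) by simp
  qed
  have q: "measure lam (?q k) \<le> measure lam (?P k) + measure lam (?b k)" for k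
  proof -
    have "{x \<in> space lam. \<rho> \<le> margin ((T ^^ k) x) \<and> depth k x < \<rho>1 / \<Lambda>} \<in> sets lam"
      "{x \<in> space lam. margin ((T ^^ k) x) < \<rho>} \<in> sets lam" by measurable
    then have s: "?P k \<in> sets lam" "?b k \<in> sets lam" unfolding space_lam by auto
    have "measure lam (?q k) \<le> measure lam (?P k \<union> ?b k)"
    proof (rule finite_measure_mono)
      show "?q k \<subseteq> ?P k \<union> ?b k" by force
      show "?P k \<union> ?b k \<in> sets lam" using s by (rule sets.Un)
    qed
    also have "\<dots> \<le> measure lam (?P k) + measure lam (?b k)" using s by (rule measure_Un_le)
    finally show ?thesis .
  qed
  define c0 where "c0 = 4 * \<rho>1 powr a / a"
  have main: "L * (\<Sum>k<n. measure lam (?q k)) \<le> c0 + 3 * \<eta> * real n + Q * (\<Sum>k<n. ?tv k)" for n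
  proof -
    have "L * (\<Sum>k<n. measure lam (?q k)) \<le> L * (\<Sum>k<n. measure lam (?P k) + measure lam (?b k))"
      using L q by (intro mult_left_mono sum_mono) auto
    also have "\<dots> = L * (\<Sum>k<n. measure lam (?P k)) + (\<Sum>k<n. L * measure lam (?b k))"
      by (simp add: sum.distrib distrib_left sum_distrib_left)
    also have "L * (\<Sum>k<n. measure lam (?P k)) \<le> c0 + (\<Sum>k<n. (1 / a) * (((\<rho>1 / \<rho>) powr a + 1 / t) * M + t * measure lam (?b k)))"
      unfolding L_def c0_def by (rule excess_integral_bound[OF \<Lambda> a t(1) \<rho>1(1,2) exp less_imp_le[OF M0] M])
    also have "c0 + (\<Sum>k<n. (1 / a) * (((\<rho>1 / \<rho>) powr a + 1 / t) * M + t * measure lam (?b k))) + (\<Sum>k<n. L * measure lam (?b k))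
        = c0 + (\<Sum>k<n. (s powr a * M / a + M / (a * t)) + Q * measure lam (?b k))"
    proof -
      have "(1 / a) * ((s powr a + 1 / t) * M + t * y) + L * y = (s powr a * M / a + M / (a * t)) + Q * y" for y
        using a(1) t(1) by (simp add: Q_def distrib_left distrib_right add_divide_distrib)
      then show ?thesis unfolding \<rho>1(3) add.assoc sum.distrib[symmetric] by simp
    qed
    also have "\<dots> \<le> c0 + (\<Sum>k<n. (\<eta> + \<eta>) + (\<eta> + Q * ?tv k))"
    proof (intro add_left_mono sum_mono add_mono)
      fix k
      have "Q * measure lam (?b k) \<le> Q * (\<eta> / Q + ?tv k)" using b Q by (intro mult_left_mono) auto
      also have "\<dots> = \<eta> + Q * ?tv k" using Q by (simp add: distrib_left)
      finally show "Q * measure lam (?b k) \<le> \<eta> + Q * ?tv k" .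
    qed (use sa t in auto)
    also have "\<dots> = c0 + 3 * \<eta> * real n + Q * (\<Sum>k<n. ?tv k)"
      by (simp add: sum.distrib sum_distrib_left)
    finally show ?thesis by simp
  qed
  have "\<forall>\<^sub>F n in sequentially. (\<Sum>k<n. ?tv k) \<le> \<eta> / Q * real n"
    by (rule eventually_sum_le_of_null[OF tv_orbit_law[OF \<mu>]]) (use \<eta> Q in auto)
  moreover have "\<forall>\<^sub>F n in sequentially. c0 / \<eta> \<le> real n"
    by (metis eventually_sequentiallyI nat_ceiling_le_eq)
  ultimately have ev: "\<forall>\<^sub>F n in sequentially. (\<Sum>k<n. measure lam (?q k)) \<le> \<epsilon> * real n"
  proof eventually_elim
    case (elim n)
    have "c0 \<le> \<eta> * real n" using elim(2) \<eta> by (simp add: field_simps)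
    moreover have "Q * (\<Sum>k<n. ?tv k) \<le> \<eta> * real n" using elim(1) Q by (simp add: field_simps)
    ultimately have "L * (\<Sum>k<n. measure lam (?q k)) \<le> 5 * \<eta> * real n" using main[of n] by linarith
    also have "\<dots> \<le> 8 * \<eta> * real n" using \<eta> by (intro mult_right_mono) auto
    also have "\<dots> = L * (\<epsilon> * real n)" by (simp add: \<eta>_def)
    finally show ?case using L by simp
  qed
  show ?thesis using that[OF _ ev] \<rho>1 \<Lambda> by simp
qed

lemma finitely_many_short_cylinders:
  assumes H: "H3 T \<xi>" and \<mu>: "limit_acip T \<mu>" and \<epsilon>: "0 < \<epsilon>" "0 < \<rho>"
  shows "\<exists>k \<G>. finite \<G> \<and> \<G> \<subseteq> {cyl k x | x. x \<in> regular \<and> len (cyl k x) < \<rho>} \<and>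
    measure \<mu> (regular - \<Union>\<G>) < \<epsilon>"
proof -
  interpret \<mu>: prob_space \<mu> using \<mu> by (simp add: limit_acip_def)
  have sets\<mu>: "A \<in> sets \<mu>" if "A \<in> sets lam" for A
    using that regular_unit by (auto simp: limit_acip_sets[OF \<mu>] sets_leb_unit_iff sets_lam_iff)
  let ?S = "\<lambda>k. {cyl k x | x. x \<in> regular \<and> len (cyl k x) < \<rho>}"
  let ?X = "\<lambda>k. regular - \<Union>(?S k)"
  have cnt: "countable (?S k)" for k
    by (rule countable_subset[OF _ countable_cyls[of k]]) auto
  have op: "open (\<Union>(?S k))" for k using cyl_open by auto
  have Xs: "?X k \<in> sets \<mu>" for k by (rule sets\<mu>) (use op in \<open>auto simp: sets_lam_iff\<close>)
  have X: "?X k = {x \<in> regular. \<rho> \<le> len (cyl k x)}" for k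
  proof -
    have "x \<in> \<Union>(?S k) \<longleftrightarrow> len (cyl k x) < \<rho>" if x: "x \<in> regular" for x
    proof
      assume "x \<in> \<Union>(?S k)"
      then obtain z where z: "z \<in> regular" "len (cyl k z) < \<rho>" "x \<in> cyl k z" by auto
      then show "len (cyl k x) < \<rho>" using cyl_eq[OF z(1,3), of k] by simp
    next
      assume "len (cyl k x) < \<rho>"
      then show "x \<in> \<Union>(?S k)" using cyl_self[OF x, of k] x by blast
    qed
    then show ?thesis by (auto simp: not_less[symmetric])
  qed
  have mono: "len (cyl (Suc k) x) \<le> len (cyl k x)" if "x \<in> regular" for k x
    using cyl_antimono[of k "Suc k" x] that cyl_open[OF that]
    by (intro measure_mono_fmeasurable) (auto intro: cyl_bounds[OF that, of k] simp: fmeasurable_intervals)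
  have "decseq ?X"
    unfolding X by (rule decseq_SucI) (use mono in \<open>auto intro: order_trans\<close>)
  moreover have "(\<Inter>k. ?X k) = {}"
    unfolding X using H3_cylinders_shrink[OF H _ \<epsilon>(2)] by (force simp: not_le[symmetric])
  moreover have "range ?X \<subseteq> sets \<mu>" using Xs by blast
  ultimately have "(\<lambda>k. measure \<mu> (?X k)) \<longlonglongrightarrow> measure \<mu> {}"
    using \<mu>.finite_Lim_measure_decseq[of ?X] by metis
  then have "(\<lambda>k. measure \<mu> (?X k)) \<longlonglongrightarrow> 0" by simp
  then have "\<forall>\<^sub>F k in sequentially. measure \<mu> (?X k) < \<epsilon>" using \<epsilon>(1) by (rule order_tendstoD)
  then obtain k where k: "measure \<mu> (?X k) < \<epsilon>" by (auto simp: eventually_sequentially)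
  show ?thesis
  proof (cases "?S k = {}")
    case True
    then show ?thesis using k unfolding True by (intro exI[of _ k] exI[of _ "{}"]) simp
  next
    case False
    define g where "g = from_nat_into (?S k)"
    have g: "range g = ?S k" using cnt False by (simp add: g_def range_from_nat_into)
    let ?Y = "\<lambda>i. regular - \<Union>(g ` {..<i})"
    have go: "open (g i)" for i
    proof -
      have "g i \<in> ?S k" using g by blast
      then show ?thesis using cyl_open by auto
    qed
    have Ys: "?Y i \<in> sets \<mu>" for i by (rule sets\<mu>) (use go in \<open>auto simp: sets_lam_iff\<close>)
    have "decseq ?Y" by (rule decseq_SucI) auto
    moreover have "(\<Inter>i. ?Y i) = ?X k" unfolding g[symmetric] by auto
    moreover have "range ?Y \<subseteq> sets \<mu>" using Ys by blast
    ultimately have "(\<lambda>i. measure \<mu> (?Y i)) \<longlonglongrightarrow> measure \<mu> (?X k)"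
      using \<mu>.finite_Lim_measure_decseq[of ?Y] by metis
    then have "\<forall>\<^sub>F i in sequentially. measure \<mu> (?Y i) < \<epsilon>" using k by (rule order_tendstoD)
    then obtain i where "measure \<mu> (?Y i) < \<epsilon>" by (auto simp: eventually_sequentially)
    moreover have "g ` {..<i} \<subseteq> ?S k" using g by blast
    ultimately show ?thesis by (intro exI[of _ k] exI[of _ "g ` {..<i}"]) simp
  qed
qed

text \<open>Time is shifted by the order \<open>k\<close> of the cylinders: an orbit point of depth at least \<open>\<rho>\<close> at time \<open>i\<close>
  in one of the finitely many short cylinders has one of finitely many image intervals at time
  \<open>i + k\<close>.\<close>

lemma finitely_many_images:
  assumes H: "H1 T \<xi>" "H2 T \<xi>" "H3 T \<xi>" and \<mu>: "limit_acip T \<mu>" and \<epsilon>: "0 < \<epsilon>"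
  obtains \<I> where "finite \<I>" "\<And>I. I \<in> \<I> \<Longrightarrow> open I \<and> is_interval I"
    "\<forall>\<^sub>F n in sequentially. (\<Sum>j<n. measure lam {x \<in> regular. img j x \<notin> \<I>}) \<le> \<epsilon> * real n"
proof -
  interpret prob_space lam by (rule prob_space_lam)
  obtain \<rho> where \<rho>: "0 < \<rho>" "\<forall>\<^sub>F n in sequentially. (\<Sum>k<n. measure lam {x \<in> regular. depth k x < \<rho>}) \<le> \<epsilon> / 4 * real n"
    using shallow_orbits_rare[OF H(1,2) \<mu>, of "\<epsilon> / 4"] \<epsilon> by auto
  obtain k \<G> where G: "finite \<G>" "\<G> \<subseteq> {cyl k x | x. x \<in> regular \<and> len (cyl k x) < \<rho>}"
    "measure \<mu> (regular - \<Union>\<G>) < \<epsilon> / 4"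
  proof -
    have "0 < \<epsilon> / 4" using \<epsilon> by simp
    from finitely_many_short_cylinders[OF H(3) \<mu> this \<rho>(1)] show ?thesis using that by (elim exE conjE) blast
  qed
  define \<I> where "\<I> = (\<lambda>C. (T ^^ k) ` C) ` \<G>"
  have I: "open I \<and> is_interval I" if "I \<in> \<I>" for I
  proof -
    obtain C where C: "C \<in> \<G>" "I = (T ^^ k) ` C" using \<open>I \<in> \<I>\<close> by (auto simp: \<I>_def)
    then obtain x where x: "x \<in> regular" "I = img k x" using subsetD[OF G(2) C(1)] by (auto simp: img_def)
    then show ?thesis using img_open img_interval by blast
  qed
  let ?B = "regular - \<Union>\<G>"
  have Bs: "?B \<in> sets borel" "?B \<subseteq> unit_ivl"
  proof -
    have "open (\<Union>\<G>)" using G(2) cyl_open by (intro open_Union) blast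
    then show "?B \<in> sets borel" by auto
    show "?B \<subseteq> unit_ivl" using regular_unit by auto
  qed
  let ?q = "\<lambda>i. {x \<in> regular. depth i x < \<rho>}"
  let ?w = "\<lambda>i. {x \<in> regular. (T ^^ i) x \<in> ?B}"
  let ?N = "\<lambda>j. {x \<in> regular. img j x \<notin> \<I>}"
  let ?tv = "\<lambda>i. tv_dist (orbit_law i) \<mu>"
  have sub: "?N (i + k) \<subseteq> ?q i \<union> ?w i" for i
  proof
    fix x assume x: "x \<in> ?N (i + k)"
    then have xr: "x \<in> regular" by simp
    let ?y = "(T ^^ i) x"
    have y: "?y \<in> regular" by (rule regular_funpow[OF xr])
    show "x \<in> ?q i \<union> ?w i"
    proof (rule ccontr)
      assume "x \<notin> ?q i \<union> ?w i"
      then have d: "\<rho> \<le> depth i x" and "?y \<in> \<Union>\<G>" using xr y by auto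
      then obtain z where z: "z \<in> regular" "len (cyl k z) < \<rho>" "?y \<in> cyl k z" "cyl k z \<in> \<G>" using G(2) by blast
      have C: "cyl k ?y = cyl k z" using cyl_eq[OF z(1,3), of k] by simp
      obtain c e where ce: "c < e" "cyl k ?y = {c<..<e}" by (rule cyl_bounds[OF y])
      have "e - c < \<rho>" using z(2) ce(1) unfolding C[symmetric] ce(2) by simp
      then have "cyl k ?y \<subseteq> ball ?y \<rho>"
        using cyl_self[OF y, of k] unfolding ce(2) by (auto simp: dist_real_def)
      also have "\<dots> \<subseteq> ball ?y (depth i x)" using d by (simp add: subset_ball)
      also have "\<dots> \<subseteq> img i x" unfolding depth_def by (rule ball_infdist_compl)
      finally have "img (i + k) x = (T ^^ k) ` cyl k ?y"
        using img_add[OF xr, of i k] by (simp add: Int_absorb1)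
      then show False using x z(4) C by (auto simp: \<I>_def)
    qed
  qed
  have qs: "?q i \<in> sets lam" for i
  proof -
    have "{x \<in> space lam. depth i x < \<rho>} \<in> sets lam" by measurable
    then show ?thesis by (simp only: space_lam)
  qed
  have ws: "?w i \<in> sets lam" for i
  proof -
    have "(T ^^ i) -` ?B \<inter> space lam \<in> sets lam" using measurable_sets[OF measurable_lam_funpow] Bs by blast
    moreover have "(T ^^ i) -` ?B \<inter> space lam = ?w i" by (auto simp: space_lam)
    ultimately show ?thesis by simp
  qed
  have shifted: "measure lam (?N (i + k)) \<le> measure lam (?q i) + (\<epsilon> / 4 + ?tv i)" for i
  proof -
    have "measure lam (?N (i + k)) \<le> measure lam (?q i \<union> ?w i)"
      by (rule finite_measure_mono[OF sub]) (use qs ws in auto)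
    also have "\<dots> \<le> measure lam (?q i) + measure lam (?w i)" using qs ws by (rule measure_Un_le)
    also have "measure lam (?w i) \<le> \<epsilon> / 4 + ?tv i"
      using measure_lam_vimage_le[OF \<mu> Bs, of i] G(3) by simp
    finally show ?thesis by simp
  qed
  \<comment> \<open>The first \<open>k\<close> summands are bounded by 1; they are negligible in the average.\<close>
  have bound: "(\<Sum>j<n. measure lam (?N j)) \<le> real k + (\<Sum>i<n. measure lam (?q i)) + (\<epsilon> / 4 * real n + (\<Sum>i<n. \<bar>?tv i\<bar>))" for n
  proof -
    have "(\<Sum>j<n. measure lam (?N j)) \<le> (\<Sum>j<k + n. measure lam (?N j))"
      by (intro sum_mono2) auto
    also have "\<dots> = (\<Sum>j<k. measure lam (?N j)) + (\<Sum>i<n. measure lam (?N (i + k)))"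
    proof -
      have "(\<Sum>j<k + n. measure lam (?N j)) = (\<Sum>j<k. measure lam (?N j)) + (\<Sum>j=k..<k + n. measure lam (?N j))"
        unfolding lessThan_atLeast0 by (rule sum.atLeastLessThan_concat[symmetric]) auto
      also have "(\<Sum>j=k..<k + n. measure lam (?N j)) = (\<Sum>i<n. measure lam (?N (i + k)))"
        using sum.shift_bounds_nat_ivl[of "\<lambda>j. measure lam (?N j)" 0 k n] by (simp add: lessThan_atLeast0 add.commute)
      finally show ?thesis .
    qed
    also have "(\<Sum>j<k. measure lam (?N j)) \<le> (\<Sum>j<k. 1)" by (intro sum_mono prob_le_1)
    also have "(\<Sum>i<n. measure lam (?N (i + k))) \<le> (\<Sum>i<n. measure lam (?q i) + (\<epsilon> / 4 + \<bar>?tv i\<bar>))"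
      by (intro sum_mono order_trans[OF shifted]) auto
    finally show ?thesis by (simp add: sum.distrib add_ac mult_ac)
  qed
  have "(\<lambda>i. \<bar>?tv i\<bar>) \<longlonglongrightarrow> 0" using tv_orbit_law[OF \<mu>] by (rule tendsto_rabs_zero)
  then have "\<forall>\<^sub>F n in sequentially. (\<Sum>i<n. \<bar>?tv i\<bar>) \<le> \<epsilon> / 4 * real n"
    by (rule eventually_sum_le_of_null) (use \<epsilon> in auto)
  moreover have "\<forall>\<^sub>F n in sequentially. 4 * real k / \<epsilon> \<le> real n"
    by (metis eventually_sequentiallyI nat_ceiling_le_eq)
  ultimately have "\<forall>\<^sub>F n in sequentially. (\<Sum>j<n. measure lam (?N j)) \<le> \<epsilon> * real n"
    using \<rho>(2)
  proof eventually_elim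
    case (elim n)
    have "real k \<le> \<epsilon> / 4 * real n" using elim(2) \<epsilon> by (simp add: field_simps)
    then show ?case using bound[of n] elim by linarith
  qed
  then show ?thesis using that[of \<I>] G(1) I by (simp add: \<I>_def)
qed

end

section \<open>Measures on generators and tightness on the line\<close>

lemma measure_of_eq_measure:
  assumes "sets N = sigma_sets \<Omega> \<A>" "\<A> \<subseteq> Pow \<Omega>" "\<And>A. A \<in> sets N \<Longrightarrow> f A = emeasure N A"
  shows "measure_of \<Omega> \<A> f = N"
proof (rule measure_eqI)
  show s: "sets (measure_of \<Omega> \<A> f) = sets N" using assms(1,2) by simp
  fix A assume "A \<in> sets (measure_of \<Omega> \<A> f)"
  then have A: "A \<in> sets N" using s by simp
  have "emeasure (measure_of \<Omega> \<A> f) A = f A"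
  proof (rule emeasure_measure_of[OF refl assms(2)])
    show "A \<in> sets (measure_of \<Omega> \<A> f)" using A s by simp
    show "positive (sets (measure_of \<Omega> \<A> f)) f"
      unfolding s positive_def using assms(3)[OF sets.empty_sets] by simp
    show "countably_additive (sets (measure_of \<Omega> \<A> f)) f"
      unfolding s countably_additive_def
    proof (intro allI impI)
      fix B :: "nat \<Rightarrow> 'a set" assume B: "range B \<subseteq> sets N" "disjoint_family B" "\<Union> (range B) \<in> sets N"
      have "(\<Sum>i. f (B i)) = (\<Sum>i. emeasure N (B i))" using B(1) assms(3) by (intro suminf_cong) auto
      also have "\<dots> = emeasure N (\<Union> (range B))" using B by (intro suminf_emeasure) auto
      finally show "(\<Sum>i. f (B i)) = f (\<Union> (range B))" using assms(3)[OF B(3)] by simp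
    qed
  qed
  then show "emeasure (measure_of \<Omega> \<A> f) A = emeasure N A" using assms(3)[OF A] by simp
qed

lemma is_interval_borel:
  fixes Z :: "real set"
  assumes "is_interval Z"
  shows "Z \<in> sets borel"
proof -
  have "Z = interior Z \<union> (Z \<inter> frontier Z)"
    using interior_subset closure_subset by (auto simp: frontier_def)
  moreover have "Z \<inter> frontier Z \<in> sets borel"
    using finite_frontier_interval[OF assms] by (intro borel_closed finite_imp_closed) simp
  ultimately show ?thesis by (metis borel_open open_interior sets.Un)
qed

lemma real_distribution_distr_borel:
  assumes "prob_space M" "f \<in> borel_measurable M"
  shows "real_distribution (distr M borel f)"
  using prob_space.prob_space_distr[OF assms] by (simp add: real_distribution_def real_distribution_axioms_def)

lemma real_distribution_tail:
  assumes "real_distribution M" "0 < \<epsilon>"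
  shows "\<exists>K::nat. 1 - \<epsilon> < measure M {- real K<..real K}"
proof -
  interpret real_distribution M by fact
  let ?A = "\<lambda>K::nat. {- real K<..real K}"
  have "(\<Union>K. ?A K) = UNIV"
  proof (intro set_eqI iffI UNIV_I)
    fix x :: real
    obtain K :: nat where "\<bar>x\<bar> < real K" using reals_Archimedean2 by blast
    then show "x \<in> (\<Union>K. ?A K)" by (intro UN_I[of K]) auto
  qed
  moreover have "incseq ?A" by (intro incseq_SucI) auto
  moreover have "range ?A \<subseteq> sets M" by auto
  ultimately have "(\<lambda>K. measure M (?A K)) \<longlonglongrightarrow> 1"
    using finite_Lim_measure_incseq[of ?A] prob_space by simp
  then have "\<forall>\<^sub>F K in sequentially. 1 - \<epsilon> < measure M (?A K)"
    using assms(2) by (intro order_tendstoD) auto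
  then show ?thesis by (auto simp: eventually_sequentially)
qed

lemma tight_of_eventually:
  assumes rd: "\<And>n. real_distribution (\<nu> n)"
    and ev: "\<And>\<epsilon>. 0 < \<epsilon> \<Longrightarrow> \<exists>K::nat. \<forall>\<^sub>F n in sequentially. 1 - \<epsilon> < measure (\<nu> n) {- real K<..real K}"
  shows "tight \<nu>"
  unfolding tight_def
proof (intro conjI allI impI rd)
  fix \<epsilon> :: real assume \<epsilon>: "0 < \<epsilon>"
  obtain K N where KN: "\<And>n. N \<le> n \<Longrightarrow> 1 - \<epsilon> < measure (\<nu> n) {- real K<..real K}"
    using ev[OF \<epsilon>] by (auto simp: eventually_sequentially)
  obtain k where k: "\<And>n. 1 - \<epsilon> < measure (\<nu> n) {- real (k n)<..real (k n)}"
    using real_distribution_tail[OF rd \<epsilon>] by metis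
  define b where "b = Max (insert K (k ` {..<N}))"
  have b: "K \<le> b" "\<And>n. n < N \<Longrightarrow> k n \<le> b" by (auto simp: b_def)
  have "1 - \<epsilon> < measure (\<nu> n) {- real (Suc b)<..real (Suc b)}" for n
  proof -
    interpret real_distribution "\<nu> n" by (rule rd)
    define c where "c = (if n < N then k n else K)"
    have "1 - \<epsilon> < measure (\<nu> n) {- real c<..real c}" using KN[of n] k[of n] by (auto simp: c_def)
    also have "\<dots> \<le> measure (\<nu> n) {- real (Suc b)<..real (Suc b)}"
    proof (rule finite_measure_mono)
      have "c \<le> b" using b by (simp add: c_def)
      then show "{- real c<..real c} \<subseteq> {- real (Suc b)<..real (Suc b)}" by auto
    qed simp
    finally show ?thesis .
  qed
  then show "\<exists>a b. a < b \<and> (\<forall>n. 1 - \<epsilon> < measure (\<nu> n) {a<..b})"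
    by (intro exI[of _ "- real (Suc b)"] exI[of _ "real (Suc b)"]) auto
qed

context interval_map
begin

text \<open>The cells, the topology and the Borel structure of the tower.\<close>

abbreviation cells :: "real set set" where "cells \<equiv> tower_intervals T \<xi>"
abbreviation ttop :: "(real set \<times> real) topology" where "ttop \<equiv> tower_topology T \<xi>"
abbreviation tborel :: "(real set \<times> real) measure" where "tborel \<equiv> tower_borel T \<xi>"

section \<open>The tower as a measurable space\<close>

lemma unit_cell: "unit_ivl \<in> cells"
  unfolding tower_intervals_def by (rule UN_I[of 0]) auto

lemma countable_cells: "countable cells"
proof -
  have "countable (tower_level T \<xi> n)" for n
  proof (induction n)
    case (Suc n)
    have "tower_level T \<xi> (Suc n) \<subseteq> (\<lambda>(W, V). branch_image T (W \<inter> V)) ` (\<xi> \<times> tower_level T \<xi> n)" by auto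
    then show ?case using Suc countable_xi by (meson countable_SIGMA countable_image countable_subset)
  qed simp
  then show ?thesis by (simp add: tower_intervals_def)
qed

lemma closure_cell: assumes "D \<in> cells" shows "closure D \<subseteq> unit_ivl"
proof -
  obtain n where n: "D \<in> tower_level T \<xi> n" using assms by (auto simp: tower_intervals_def)
  have "D \<subseteq> unit_ivl"
  proof (cases n)
    case (Suc m)
    then obtain W V where WV: "W \<in> \<xi>" "D = branch_image T (W \<inter> V)" using n by auto
    then have "D \<subseteq> T ` W" by (auto simp: branch_image_def)
    also have "\<dots> \<subseteq> unit_ivl" using xi_subset[OF WV(1)] T_unit by blast
    finally show ?thesis .
  qed (use n in simp)
  then show ?thesis by (simp add: closure_minimal)
qed

lemma topspace_tower: "topspace ttop = tower T \<xi>"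
  by (simp add: tower_topology_def tower_def o_def)

lemma opens_Pow: "tower_opens T \<xi> \<subseteq> Pow (tower T \<xi>)"
  using openin_subset topspace_tower by blast

lemma sets_tborel: "sets tborel = sigma_sets (tower T \<xi>) (tower_opens T \<xi>)"
  unfolding tower_borel_def using opens_Pow by (rule sets_measure_of)

lemma space_tborel: "space tborel = tower T \<xi>"
  unfolding tower_borel_def using opens_Pow by (rule space_measure_of)

lemma measurable_tborelI:
  assumes "\<And>x. x \<in> space M \<Longrightarrow> f x \<in> tower T \<xi>"
    and "\<And>U. openin ttop U \<Longrightarrow> {x \<in> space M. f x \<in> U} \<in> sets M"
  shows "f \<in> measurable M tborel"
  unfolding tower_borel_def
  by (rule measurable_measure_of[OF opens_Pow]) (use assms in \<open>auto simp: vimage_def Int_def conj_commute\<close>)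

lemma continuous_measurable_tborel:
  assumes "continuous_map ttop euclidean (f :: _ \<Rightarrow> 'b :: topological_space)"
  shows "f \<in> borel_measurable tborel"
proof (rule borel_measurableI)
  fix S :: "'b set" assume "open S"
  then have "openin ttop {q \<in> topspace ttop. f q \<in> S}" using assms by (auto simp: continuous_map_def)
  then have "{q \<in> topspace ttop. f q \<in> S} \<in> sets tborel" unfolding sets_tborel by (intro sigma_sets.Basic) simp
  moreover have "{q \<in> topspace ttop. f q \<in> S} = f -` S \<inter> space tborel"
    by (auto simp: topspace_tower space_tborel)
  ultimately show "f -` S \<inter> space tborel \<in> sets tborel" by simp
qed

lemma openin_tower_slice:
  assumes "openin ttop U" "D \<in> cells"
  obtains G where "open G" "{z. (D, z) \<in> U} = closure D \<inter> G"
  using assms unfolding tower_topology_def openin_sum_topology openin_open by blast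

lemma openin_towerI:
  assumes "U \<subseteq> tower T \<xi>" "\<And>D. D \<in> cells \<Longrightarrow> \<exists>G. open G \<and> {z. (D, z) \<in> U} = closure D \<inter> G"
  shows "openin ttop U"
  using assms unfolding tower_topology_def openin_sum_topology openin_open by (auto simp: tower_def o_def)

lemma continuous_map_towerI:
  fixes f :: "real set \<times> real \<Rightarrow> 'b :: topological_space"
  assumes "\<And>D. D \<in> cells \<Longrightarrow> continuous_on UNIV (\<lambda>z. f (D, z))"
  shows "continuous_map ttop euclidean f"
  unfolding continuous_map_def
proof (intro conjI allI impI)
  fix S :: "'b set" assume "openin euclidean S"
  then have S: "open S" by simp
  show "openin ttop {q \<in> topspace ttop. f q \<in> S}"
  proof (rule openin_towerI)
    fix D assume D: "D \<in> cells"
    have "open ((\<lambda>z. f (D, z)) -` S)" using assms[OF D] S by (rule open_vimage[rotated])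
    moreover have "{z. (D, z) \<in> {q \<in> topspace ttop. f q \<in> S}} = closure D \<inter> ((\<lambda>z. f (D, z)) -` S)"
      using D by (auto simp: topspace_tower tower_def)
    ultimately show "\<exists>G. open G \<and> {z. (D, z) \<in> {q \<in> topspace ttop. f q \<in> S}} = closure D \<inter> G" by blast
  qed (auto simp: topspace_tower)
qed simp

lemma continuous_map_snd_tower: "continuous_map ttop euclidean snd"
  by (rule continuous_map_towerI) (simp add: continuous_on_id)

lemmas measurable_snd_tower = continuous_measurable_tborel[OF continuous_map_snd_tower]

lemma slice_sets:
  assumes "A \<in> sets tborel" "D \<in> cells"
  shows "{z. (D, z) \<in> A} \<in> sets borel"
proof -
  have "(\<lambda>z. (D, z)) \<in> measurable (restrict_space borel (closure D)) tborel"
  proof (rule measurable_tborelI)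
    show "(D, z) \<in> tower T \<xi>" if "z \<in> space (restrict_space borel (closure D))" for z
      using that assms(2) by (simp add: tower_def space_restrict_space)
    fix U assume "openin ttop U"
    then obtain G where G: "open G" "{z. (D, z) \<in> U} = closure D \<inter> G" using openin_tower_slice assms(2) by metis
    have "{z \<in> space (restrict_space borel (closure D)). (D, z) \<in> U} = closure D \<inter> G"
      unfolding G(2)[symmetric] using G(2) by (auto simp: space_restrict_space)
    then show "{z \<in> space (restrict_space borel (closure D)). (D, z) \<in> U} \<in> sets (restrict_space borel (closure D))"
      using G(1) by (auto simp: sets_restrict_space_iff)
  qed
  from measurable_sets[OF this assms(1)]
  have "(\<lambda>z. (D, z)) -` A \<inter> closure D \<in> sets borel" by (simp add: space_restrict_space sets_restrict_space_iff)
  moreover have "A \<subseteq> tower T \<xi>" using sets.sets_into_space[OF assms(1)] by (simp add: space_tborel)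
  then have "(\<lambda>z. (D, z)) -` A \<inter> closure D = {z. (D, z) \<in> A}" by (auto simp: tower_def)
  ultimately show ?thesis by simp
qed

lemma snd_image_copy:
  assumes "A \<in> sets tborel"
  shows "snd ` (A \<inter> tower_copy D) = {z. (D, z) \<in> A}"
proof -
  have "A \<subseteq> tower T \<xi>" using sets.sets_into_space[OF assms] by (simp add: space_tborel)
  then show ?thesis by (force simp: tower_def image_iff)
qed

lemma emeasure_tower_leb:
  assumes "A \<in> sets tborel"
  shows "emeasure (tower_leb T \<xi>) A = (\<Sum>\<^sub>\<infinity>D\<in>cells. emeasure lborel {z. (D, z) \<in> A})"
proof -
  let ?f = "\<lambda>A. \<Sum>\<^sub>\<infinity>D\<in>cells. emeasure lborel (snd ` (A \<inter> tower_copy D))"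
  have f: "?f B = (\<integral>\<^sup>+D. emeasure lborel {z. (D, z) \<in> B} \<partial>count_space cells)" if "B \<in> sets tborel" for B
    unfolding infsum_eq_nn_integral_count_space[OF countable_cells] snd_image_copy[OF that] ..
  have s: "sets (tower_leb T \<xi>) = sets tborel"
    unfolding tower_leb_def sets_tborel using opens_Pow by (rule sets_measure_of)
  have "emeasure (tower_leb T \<xi>) A = ?f A"
  proof (rule emeasure_measure_of[OF tower_leb_def opens_Pow])
    show "positive (sets (tower_leb T \<xi>)) ?f" by (simp add: positive_def)
    show "countably_additive (sets (tower_leb T \<xi>)) ?f"
      unfolding s countably_additive_def
    proof (intro allI impI)
      fix B :: "nat \<Rightarrow> (real set \<times> real) set"
      assume B: "range B \<subseteq> sets tborel" "disjoint_family B" "\<Union> (range B) \<in> sets tborel"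
      have "(\<Sum>i. ?f (B i)) = (\<Sum>i. \<integral>\<^sup>+D. emeasure lborel {z. (D, z) \<in> B i} \<partial>count_space cells)"
        using B(1) f by (intro suminf_cong) auto
      also have "\<dots> = (\<integral>\<^sup>+D. (\<Sum>i. emeasure lborel {z. (D, z) \<in> B i}) \<partial>count_space cells)"
        by (rule nn_integral_suminf[symmetric]) simp
      also have "\<dots> = (\<integral>\<^sup>+D. emeasure lborel {z. (D, z) \<in> \<Union> (range B)} \<partial>count_space cells)"
      proof (rule nn_integral_cong)
        fix D assume "D \<in> space (count_space cells)"
        then have D: "D \<in> cells" by simp
        have "(\<Sum>i. emeasure lborel {z. (D, z) \<in> B i}) = emeasure lborel (\<Union>i. {z. (D, z) \<in> B i})"
          using B(1,2) slice_sets[OF _ D] by (intro suminf_emeasure) (auto simp: disjoint_family_on_def)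
        also have "(\<Union>i. {z. (D, z) \<in> B i}) = {z. (D, z) \<in> \<Union> (range B)}" by auto
        finally show "(\<Sum>i. emeasure lborel {z. (D, z) \<in> B i}) = emeasure lborel {z. (D, z) \<in> \<Union> (range B)}" .
      qed
      also have "\<dots> = ?f (\<Union> (range B))" using f[OF B(3)] by simp
      finally show "(\<Sum>i. ?f (B i)) = ?f (\<Union> (range B))" .
    qed
    show "A \<in> sets (tower_leb T \<xi>)" using assms s by simp
  qed
  then show ?thesis using snd_image_copy[OF assms] by simp
qed

lemma base_sets:
  assumes "B \<in> sets borel" "B \<subseteq> unit_ivl"
  shows "{unit_ivl} \<times> B \<in> sets tborel"
proof -
  have op: "openin ttop tower_base"
  proof (rule openin_towerI)
    show "tower_base \<subseteq> tower T \<xi>" using unit_cell by (auto simp: tower_def)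
    fix D assume "D \<in> cells"
    show "\<exists>G. open G \<and> {z. (D, z) \<in> tower_base} = closure D \<inter> G"
    proof (cases "D = unit_ivl")
      case True then show ?thesis by (intro exI[of _ UNIV]) auto
    next
      case False then show ?thesis by (intro exI[of _ "{}"]) auto
    qed
  qed
  then have "tower_base \<in> sets tborel" unfolding sets_tborel by (intro sigma_sets.Basic) simp
  moreover have "snd -` B \<inter> space tborel \<in> sets tborel" using measurable_sets[OF measurable_snd_tower assms(1)] .
  ultimately have "tower_base \<inter> (snd -` B \<inter> space tborel) \<in> sets tborel" by (rule sets.Int)
  moreover have "tower_base \<inter> (snd -` B \<inter> space tborel) = {unit_ivl} \<times> B"
    using assms(2) unit_cell by (auto simp: space_tborel tower_def)
  ultimately show ?thesis by simp
qed

lemma emeasure_tower_leb_base: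
  assumes "B \<in> sets borel" "B \<subseteq> unit_ivl"
  shows "emeasure (tower_leb T \<xi>) ({unit_ivl} \<times> B) = emeasure lborel B"
proof -
  have "emeasure (tower_leb T \<xi>) ({unit_ivl} \<times> B) = (\<Sum>\<^sub>\<infinity>D\<in>cells. emeasure lborel {z. (D, z) \<in> {unit_ivl} \<times> B})"
    by (rule emeasure_tower_leb[OF base_sets[OF assms]])
  also have "\<dots> = emeasure lborel B"
    using unit_cell by (subst infsum_cong_neutral[where T="{unit_ivl}" and g="\<lambda>_. emeasure lborel B"]) auto
  finally show ?thesis .
qed

section \<open>Orbits in the tower\<close>

text \<open>The orbit in the tower of the point \<open>x\<close> of the base.\<close>

definition lift :: "nat \<Rightarrow> real \<Rightarrow> real set \<times> real" where
  "lift n x = (tower_map T \<xi> ^^ n) (unit_ivl, x)"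

lemma snd_tower_map_funpow: "snd ((tower_map T \<xi> ^^ n) p) = (T ^^ n) (snd p)"
  by (induction n) (auto simp: tower_map_def split: prod.splits)

lemma snd_lift: "snd (lift n x) = (T ^^ n) x"
  by (simp add: lift_def snd_tower_map_funpow)

lemma fst_lift_Suc: "fst (lift (Suc n) x) = branch_image T (fst (lift n x) \<inter> elt ((T ^^ n) x))"
proof -
  have "lift (Suc n) x = tower_map T \<xi> (lift n x)" by (simp add: lift_def)
  then show ?thesis using snd_lift[of n x] by (cases "lift n x") (simp add: tower_map_def)
qed

lemma fst_lift_0: "fst (lift 0 x) = unit_ivl" by (simp add: lift_def)

text \<open>Only the endpoints of the cell depend on the values of the map at the endpoints of the branches;
  its interior is the image interval.\<close>

lemma fst_lift_props:
  assumes x: "x \<in> regular"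
  shows "img n x \<subseteq> fst (lift n x) \<and> fst (lift n x) \<subseteq> closure (img n x) \<and> fst (lift n x) \<in> tower_level T \<xi> n"
proof (induction n)
  case 0
  show ?case by (auto simp: fst_lift_0 img_0)
next
  case (Suc n)
  let ?D = "fst (lift n x)" let ?E = "elt ((T ^^ n) x)"
  have E: "?E \<in> \<xi>" by (rule elt_funpow[OF x])
  have iD: "interior ?D = img n x"
    using Suc interior_between_open_interval[OF img_open[OF x] img_interval[OF x]] by blast
  have eq: "T ` interior (?D \<inter> ?E) = img (Suc n) x"
    by (simp add: interior_Int iD img_Suc)
  have b: "fst (lift (Suc n) x) = T ` (?D \<inter> ?E) \<inter> closure (img (Suc n) x)"
    unfolding fst_lift_Suc branch_image_def eq ..
  have "img (Suc n) x \<subseteq> T ` (?D \<inter> ?E)" unfolding eq[symmetric] using interior_subset by blast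
  then have 1: "img (Suc n) x \<subseteq> fst (lift (Suc n) x)" unfolding b using closure_subset by blast
  have "convex ?D"
  proof -
    have "is_interval ?D" unfolding is_interval_1
    proof (intro ballI allI impI, elim conjE)
      fix p q z assume pq: "p \<in> ?D" "q \<in> ?D" "p \<le> z" "z \<le> q"
      obtain c d where cd: "c < d" "img n x = {c<..<d}" by (rule img_bounds[OF x])
      have "?D \<subseteq> {c..d}" using Suc cd by simp
      then have "z = p \<or> z = q \<or> z \<in> {c<..<d}" using pq by force
      then show "z \<in> ?D" using pq Suc cd by auto
    qed
    then show ?thesis by (simp add: is_interval_convex_1)
  qed
  then have iv: "is_interval (?E \<inter> ?D)"
    using xi_interval[OF E] by (simp add: is_interval_convex_1 convex_Int)
  have "interior (?E \<inter> ?D) \<noteq> {}"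
    using img_self[OF x, of n] regular_interior[OF regular_funpow[OF x, of n]] by (auto simp: interior_Int iD)
  then obtain y e where e: "0 < e" "ball y e \<subseteq> ?E \<inter> ?D" by (metis ex_in_conv mem_interior)
  have "?E \<inter> ?D \<subseteq> unit_ivl" using xi_subset[OF E] by auto
  moreover have "0 < len (?E \<inter> ?D)"
  proof -
    have "0 < len (ball y e)" using e by (simp add: ball_eq_greaterThanLessThan)
    also have "\<dots> \<le> len (?E \<inter> ?D)"
    proof (rule measure_mono_fmeasurable[OF e(2)])
      show "?E \<inter> ?D \<in> fmeasurable lborel"
      proof (rule fmeasurableI2[of "{0..1}"])
        show "?E \<inter> ?D \<in> sets lborel" using iv by (simp add: is_interval_borel)
      qed (use \<open>?E \<inter> ?D \<subseteq> unit_ivl\<close> in \<open>auto simp: fmeasurable_intervals\<close>)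
    qed simp
    finally show ?thesis .
  qed
  ultimately have "subinterval (?E \<inter> ?D)" using iv by (simp add: subinterval_def)
  moreover have "fst (lift (Suc n) x) = branch_image T (?E \<inter> ?D)" by (simp add: fst_lift_Suc Int_commute)
  ultimately have "fst (lift (Suc n) x) \<in> tower_level T \<xi> (Suc n)" using E Suc by auto
  then show ?case using 1 b by blast
qed

lemma fst_lift_cyl:
  assumes "x \<in> regular" "y \<in> cyl n x" "k \<le> n"
  shows "fst (lift k y) = fst (lift k x)"
  using assms(3)
proof (induction k)
  case (Suc k)
  then show ?case using elt_cyl[OF assms(1,2), of k] by (simp add: fst_lift_Suc)
qed (simp add: fst_lift_0)

lemma lift_cell: "x \<in> regular \<Longrightarrow> fst (lift n x) \<in> cells"
  using fst_lift_props[of x n] by (auto simp: tower_intervals_def)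

lemma lift_tower: assumes "x \<in> regular" shows "lift n x \<in> tower T \<xi>"
proof -
  have "(T ^^ n) x \<in> closure (fst (lift n x))"
    using fst_lift_props[OF assms, of n] img_self[OF assms, of n] closure_subset by blast
  then show ?thesis using lift_cell[OF assms, of n] snd_lift[of n x] by (cases "lift n x") (simp add: tower_def)
qed

lemma lift_measurable: "lift n \<in> measurable lam tborel"
proof (rule measurable_tborelI)
  fix U assume U: "openin ttop U"
  have "openin (top_of_set regular) {x \<in> regular. lift n x \<in> U}"
  proof (subst openin_subopen, intro ballI)
    fix x assume "x \<in> {x \<in> regular. lift n x \<in> U}"
    then have x: "x \<in> regular" "lift n x \<in> U" by auto
    let ?D = "fst (lift n x)"
    obtain G where G: "open G" "{z. (?D, z) \<in> U} = closure ?D \<inter> G"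
      using openin_tower_slice[OF U lift_cell[OF x(1), of n]] by blast
    let ?N = "{y \<in> cyl n x. (T ^^ n) y \<in> G}"
    have N: "open ?N"
      using continuous_open_preimage[OF cyl_cont[OF x(1)] cyl_open[OF x(1)] G(1), of n]
      by (simp add: Int_def vimage_def)
    have lift_eq: "lift n y = (?D, (T ^^ n) y)" if "y \<in> cyl n x" for y
      using fst_lift_cyl[OF x(1) that, of n] snd_lift[of n y] by (metis order_refl prod.collapse)
    have "lift n x = (?D, (T ^^ n) x)" by (rule lift_eq[OF cyl_self[OF x(1)]])
    then have "(T ^^ n) x \<in> G" using G(2) x(2) by (metis (mono_tags, lifting) IntE mem_Collect_eq)
    then have xN: "x \<in> regular \<inter> ?N" using x(1) cyl_self by blast
    have "regular \<inter> ?N \<subseteq> {x \<in> regular. lift n x \<in> U}"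
    proof
      fix y assume y: "y \<in> regular \<inter> ?N"
      then have e: "lift n y = (?D, (T ^^ n) y)" using lift_eq by blast
      then have "(T ^^ n) y \<in> closure ?D" using lift_tower[of y n] y by (simp add: tower_def)
      then have "(?D, (T ^^ n) y) \<in> U" using G(2) y by blast
      then show "y \<in> {x \<in> regular. lift n x \<in> U}" using y e by simp
    qed
    then show "\<exists>S. openin (top_of_set regular) S \<and> x \<in> S \<and> S \<subseteq> {x \<in> regular. lift n x \<in> U}"
      using xN N by (intro exI[of _ "regular \<inter> ?N"]) (auto simp: openin_open)
  qed
  then obtain G where "open G" "{x \<in> regular. lift n x \<in> U} = regular \<inter> G" by (auto simp: openin_open)
  then show "{x \<in> space lam. lift n x \<in> U} \<in> sets lam" by (auto simp: space_lam sets_lam_iff)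
qed (simp add: space_lam lift_tower)

text \<open>The law of the orbit in the tower at time \<open>n\<close>; it coincides with \<open>tower_pushed T \<xi> n\<close>.\<close>

definition lift_law :: "nat \<Rightarrow> (real set \<times> real) measure" where
  "lift_law n = distr lam tborel (lift n)"

lemma prob_space_lift_law: "prob_space (lift_law n)"
  unfolding lift_law_def by (rule prob_space.prob_space_distr[OF prob_space_lam lift_measurable])

lemma sets_lift_law: "sets (lift_law n) = sets tborel" by (simp add: lift_law_def)

lemma emeasure_lift_law:
  assumes "A \<in> sets tborel"
  shows "emeasure (lift_law n) A = emeasure lam {x \<in> regular. lift n x \<in> A}"
proof -
  have "lift n -` A \<inter> space lam = {x \<in> regular. lift n x \<in> A}" by (auto simp: space_lam)
  then show ?thesis unfolding lift_law_def using emeasure_distr[OF lift_measurable assms, of n] by simp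
qed

lemma tower_pushed_eq: "tower_pushed T \<xi> n = lift_law n"
  unfolding tower_pushed_def
proof (rule measure_of_eq_measure)
  show "sets (lift_law n) = sigma_sets (tower T \<xi>) (tower_opens T \<xi>)" by (simp add: sets_lift_law sets_tborel)
  fix A assume "A \<in> sets (lift_law n)"
  then have A: "A \<in> sets tborel" by (simp add: sets_lift_law)
  define B where "B = {x \<in> unit_ivl. (\<forall>k<n. (T ^^ k) x \<notin> endpoint_set T \<xi> 1) \<and> lift n x \<in> A}"
  have eq: "tower_preimage T \<xi> n A \<inter> tower_base = {unit_ivl} \<times> B"
    using unit_cell by (auto simp: tower_preimage_def B_def tower_def snd_tower_map_funpow lift_def)
  have "(T ^^ k) x \<notin> endpoint_set T \<xi> 1" if "x \<in> regular" for x k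
    using regular_not_endpoint[OF regular_funpow[OF that, of k]] by (auto simp: endpoint_set_inf_def)
  then have Breg: "B \<inter> regular = {x \<in> regular. lift n x \<in> A}" using regular_unit by (auto simp: B_def)
  have "lift n -` A \<inter> space lam \<in> sets lam" by (rule measurable_sets[OF lift_measurable A])
  moreover have "lift n -` A \<inter> space lam = B \<inter> regular" unfolding Breg by (auto simp: space_lam)
  ultimately have 1: "B \<inter> regular \<in> sets lam" "B \<inter> regular \<in> sets borel" by (auto simp: sets_lam_iff)
  have 2: "B \<inter> (unit_ivl - regular) \<in> sets borel"
    by (rule sets.countable[OF _ countable_subset[OF _ countable_irregular]]) auto
  have Bsub: "B \<subseteq> unit_ivl" by (auto simp: B_def)
  then have "B = (B \<inter> regular) \<union> (B \<inter> (unit_ivl - regular))" by auto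
  then have Bs: "B \<in> sets borel" using 1(2) 2 by (metis sets.Un)
  have "emeasure (tower_leb T \<xi>) (tower_preimage T \<xi> n A \<inter> tower_base) = emeasure lborel B"
    unfolding eq by (rule emeasure_tower_leb_base[OF Bs Bsub])
  also have "\<dots> = emeasure lam (B \<inter> regular)"
    using emeasure_Int_regular[OF Bs Bsub] emeasure_lam[OF 1(2)] by simp
  also have "\<dots> = emeasure (lift_law n) A" unfolding Breg emeasure_lift_law[OF A] ..
  finally show "emeasure (tower_leb T \<xi>) (tower_preimage T \<xi> n A \<inter> tower_base) = emeasure (lift_law n) A" .
qed (rule opens_Pow)

lemma sets_tower_average: "sets (tower_average T \<xi> n) = sets tborel"
  unfolding tower_average_def sets_tborel using opens_Pow by (rule sets_measure_of)

lemma space_tower_average: "space (tower_average T \<xi> n) = tower T \<xi>"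
  unfolding tower_average_def using opens_Pow by (rule space_measure_of)

lemma emeasure_tower_average:
  assumes "A \<in> sets tborel" "0 < n"
  shows "emeasure (tower_average T \<xi> n) A = (\<Sum>k<n. emeasure (lift_law k) A) / of_nat n"
proof (subst emeasure_measure_of[OF tower_average_def opens_Pow])
  let ?f = "\<lambda>A. (\<Sum>k<n. emeasure (tower_pushed T \<xi> k) A) / of_nat n"
  show "positive (sets (tower_average T \<xi> n)) ?f" by (simp add: positive_def)
  show "countably_additive (sets (tower_average T \<xi> n)) ?f"
    unfolding sets_tower_average countably_additive_def tower_pushed_eq
  proof (intro allI impI)
    fix B :: "nat \<Rightarrow> (real set \<times> real) set"
    assume B: "range B \<subseteq> sets tborel" "disjoint_family B" "\<Union> (range B) \<in> sets tborel"
    have "(\<Sum>i. (\<Sum>k<n. emeasure (lift_law k) (B i)) / of_nat n) = (\<Sum>i. \<Sum>k<n. emeasure (lift_law k) (B i)) / of_nat n"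
      by (simp add: divide_ennreal_def ennreal_suminf_multc)
    also have "(\<Sum>i. \<Sum>k<n. emeasure (lift_law k) (B i)) = (\<Sum>k<n. \<Sum>i. emeasure (lift_law k) (B i))"
      by (rule suminf_sum) simp
    also have "\<dots> = (\<Sum>k<n. emeasure (lift_law k) (\<Union> (range B)))"
      using B by (intro sum.cong refl suminf_emeasure) (auto simp: sets_lift_law)
    finally show "(\<Sum>i. (\<Sum>k<n. emeasure (lift_law k) (B i)) / of_nat n) = (\<Sum>k<n. emeasure (lift_law k) (\<Union> (range B))) / of_nat n" .
  qed
qed (use assms sets_tower_average tower_pushed_eq in auto)

lemma measure_tower_average:
  assumes "A \<in> sets tborel" "0 < n"
  shows "measure (tower_average T \<xi> n) A = (\<Sum>k<n. measure (lift_law k) A) / real n"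
proof -
  have "emeasure (lift_law k) A = ennreal (measure (lift_law k) A)" for k
    using prob_space.finite_measure[OF prob_space_lift_law] by (simp add: finite_measure.emeasure_eq_measure)
  then have "emeasure (tower_average T \<xi> n) A = ennreal ((\<Sum>k<n. measure (lift_law k) A) / real n)"
    unfolding emeasure_tower_average[OF assms] using assms(2)
    by (simp add: sum_nonneg divide_ennreal ennreal_of_nat_eq_real_of_nat)
  then show ?thesis by (simp add: measure_def sum_nonneg)
qed

lemma prob_space_tower_average: assumes "0 < n" shows "prob_space (tower_average T \<xi> n)"
proof (rule prob_spaceI)
  have "emeasure (lift_law k) (tower T \<xi>) = 1" for k
    using prob_space.emeasure_space_1[OF prob_space_lift_law[of k]] by (simp add: lift_law_def space_tborel)
  moreover have "tower T \<xi> \<in> sets tborel" using sets.top[of tborel] by (simp add: space_tborel)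
  ultimately have "emeasure (tower_average T \<xi> n) (tower T \<xi>) = of_nat n / of_nat n"
    using emeasure_tower_average[OF _ assms, of "tower T \<xi>"] by simp
  also have "\<dots> = 1" using assms by (intro ennreal_divide_self) (auto simp: of_nat_less_top)
  finally show "emeasure (tower_average T \<xi> n) (space (tower_average T \<xi> n)) = 1"
    by (simp add: space_tower_average)
qed

section \<open>Embedding the tower into the real line\<close>

text \<open>The \<open>i\<close>-th cell is placed in \<open>[2 i, 2 i + 1]\<close>; the gaps make the embedding a homeomorphism onto a
  closed set.\<close>

definition emb :: "real set \<times> real \<Rightarrow> real" where
  "emb p = 2 * real (to_nat_on cells (fst p)) + snd p"

lemma snd_tower:
  assumes "p \<in> tower T \<xi>"
  shows "snd p \<in> unit_ivl"
proof -
  have "fst p \<in> cells" "snd p \<in> closure (fst p)" using assms by (auto simp: tower_def)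
  then show ?thesis using closure_cell by blast
qed

lemma emb_in_block:
  assumes "p \<in> tower T \<xi>"
  shows "2 * real (to_nat_on cells (fst p)) \<le> emb p" "emb p \<le> 2 * real (to_nat_on cells (fst p)) + 1"
proof -
  have "snd p \<in> unit_ivl" by (rule snd_tower[OF assms])
  then show "2 * real (to_nat_on cells (fst p)) \<le> emb p" "emb p \<le> 2 * real (to_nat_on cells (fst p)) + 1"
    by (auto simp: emb_def)
qed

lemma emb_near_same_cell:
  assumes "p \<in> tower T \<xi>" "q \<in> tower T \<xi>" "\<bar>emb p - emb q\<bar> < 1"
  shows "fst p = fst q"
proof -
  have "to_nat_on cells (fst p) = to_nat_on cells (fst q)"
    using emb_in_block[OF assms(1)] emb_in_block[OF assms(2)] assms(3) by linarith
  moreover have "fst p \<in> cells" "fst q \<in> cells" using assms(1,2) by (auto simp: tower_def)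
  ultimately show ?thesis using inj_on_to_nat_on[OF countable_cells] by (meson inj_onD)
qed

lemma inj_emb: "inj_on emb (tower T \<xi>)"
proof (rule inj_onI)
  fix p q assume pq: "p \<in> tower T \<xi>" "q \<in> tower T \<xi>" "emb p = emb q"
  then have "fst p = fst q" by (intro emb_near_same_cell) auto
  then show "p = q" using pq(3) by (simp add: emb_def prod_eq_iff)
qed

lemma continuous_map_emb: "continuous_map ttop euclidean emb"
  by (rule continuous_map_towerI) (auto simp: emb_def intro!: continuous_intros)

lemmas measurable_emb = continuous_measurable_tborel[OF continuous_map_emb]

lemma closed_emb_tower: "closed (emb ` tower T \<xi>)"
  unfolding closed_def
proof (subst openin_subopen[of euclidean, unfolded open_openin[symmetric]], intro ballI)
  fix x assume x: "x \<in> - emb ` tower T \<xi>"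
  define I where "I = {D \<in> cells. 2 * real (to_nat_on cells D) \<le> \<bar>x\<bar> + 1}"
  have "finite I"
  proof (rule inj_on_finite[OF _ _ finite_atMost])
    show "inj_on (to_nat_on cells) I"
      using inj_on_to_nat_on[OF countable_cells] by (rule inj_on_subset) (auto simp: I_def)
    show "to_nat_on cells ` I \<subseteq> {..nat \<lceil>\<bar>x\<bar> + 1\<rceil>}"
    proof (rule image_subsetI)
      fix D assume "D \<in> I"
      then have "real (to_nat_on cells D) \<le> \<bar>x\<bar> + 1" by (auto simp: I_def)
      then show "to_nat_on cells D \<in> {..nat \<lceil>\<bar>x\<bar> + 1\<rceil>}" by (simp add: le_nat_iff) linarith
    qed
  qed
  define F where "F = (\<Union>D\<in>I. (\<lambda>z. 2 * real (to_nat_on cells D) + z) ` closure D)"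
  have "closed F"
    unfolding F_def using \<open>finite I\<close> by (intro closed_UN closed_translation ballI) auto
  have F: "F \<subseteq> emb ` tower T \<xi>" by (force simp: F_def I_def emb_def tower_def)
  have "- F \<inter> ball x 1 \<subseteq> - emb ` tower T \<xi>"
  proof (rule subsetI, rule ComplI)
    fix y assume y: "y \<in> - F \<inter> ball x 1" "y \<in> emb ` tower T \<xi>"
    then obtain D z where p: "(D, z) \<in> tower T \<xi>" "y = emb (D, z)" by auto
    have "2 * real (to_nat_on cells D) \<le> y" using emb_in_block(1)[OF p(1)] p(2) by simp
    also have "\<dots> \<le> \<bar>x\<bar> + 1" using y(1) by (auto simp: dist_real_def)
    finally have "D \<in> I" using p(1) by (auto simp: I_def tower_def)
    then have "y \<in> F" using p by (auto simp: F_def emb_def tower_def)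
    then show False using y(1) by simp
  qed
  moreover have "open (- F \<inter> ball x 1)" using \<open>closed F\<close> by (auto simp: closed_def)
  moreover have "x \<in> - F \<inter> ball x 1" using x F by auto
  ultimately show "\<exists>S. open S \<and> x \<in> S \<and> S \<subseteq> - emb ` tower T \<xi>" by blast
qed

lemma openin_emb_image:
  assumes "openin ttop U"
  shows "openin (top_of_set (emb ` tower T \<xi>)) (emb ` U)"
proof (subst openin_subopen, intro ballI)
  fix x assume "x \<in> emb ` U"
  then obtain D z where p: "(D, z) \<in> U" "x = emb (D, z)" by auto
  have Usub: "U \<subseteq> tower T \<xi>" using openin_subset[OF assms] by (simp add: topspace_tower)
  then have pt: "(D, z) \<in> tower T \<xi>" using p(1) by blast
  then have D: "D \<in> cells" by (simp add: tower_def)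
  obtain G where G: "open G" "{z. (D, z) \<in> U} = closure D \<inter> G" by (rule openin_tower_slice[OF assms D])
  let ?i = "2 * real (to_nat_on cells D)"
  let ?N = "ball x 1 \<inter> (\<lambda>y. y - ?i) -` G"
  have N: "open ?N" using G(1) by (intro open_Int open_ball open_vimage continuous_intros)
  have "z \<in> G" using p(1) G(2) by blast
  moreover have "x - ?i = z" using p(2) by (simp add: emb_def)
  ultimately have xN: "x \<in> emb ` tower T \<xi> \<inter> ?N" using p(2) pt by auto
  have "emb ` tower T \<xi> \<inter> ?N \<subseteq> emb ` U"
  proof
    fix y assume y: "y \<in> emb ` tower T \<xi> \<inter> ?N"
    then obtain D' z' where q: "(D', z') \<in> tower T \<xi>" "y = emb (D', z')" by auto
    have "\<bar>emb (D, z) - emb (D', z')\<bar> < 1" using y p(2) q(2) by (simp add: dist_real_def)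
    then have DD: "D' = D" using emb_near_same_cell[OF pt q(1)] by simp
    then have "z' \<in> G" using y q(2) by (simp add: emb_def)
    moreover have "z' \<in> closure D" using q(1) DD by (simp add: tower_def)
    ultimately have "(D', z') \<in> U" using G(2) DD by blast
    then show "y \<in> emb ` U" using q(2) by blast
  qed
  then show "\<exists>S. openin (top_of_set (emb ` tower T \<xi>)) S \<and> x \<in> S \<and> S \<subseteq> emb ` U"
    using xN N by (intro exI[of _ "emb ` tower T \<xi> \<inter> ?N"]) (auto simp: openin_open)
qed

text \<open>The inverse of the embedding; meaningful only on the image of the tower.\<close>

definition unemb :: "real \<Rightarrow> real set \<times> real" where
  "unemb = inv_into (tower T \<xi>) emb"

lemma unemb_emb: "p \<in> tower T \<xi> \<Longrightarrow> unemb (emb p) = p"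
  by (simp add: unemb_def inv_into_f_f[OF inj_emb])

lemma unemb_vimage: "U \<subseteq> tower T \<xi> \<Longrightarrow> {x \<in> emb ` tower T \<xi>. unemb x \<in> U} = emb ` U"
  using unemb_emb by (auto simp: image_iff)

lemma unemb_measurable: "unemb \<in> measurable (restrict_space borel (emb ` tower T \<xi>)) tborel"
proof (rule measurable_tborelI)
  show "unemb x \<in> tower T \<xi>" if "x \<in> space (restrict_space borel (emb ` tower T \<xi>))" for x
    using that unemb_emb by (auto simp: space_restrict_space)
  fix U assume U: "openin ttop U"
  have "openin (top_of_set (emb ` tower T \<xi>)) (emb ` U)" by (rule openin_emb_image[OF U])
  then obtain G where G: "open G" "emb ` U = emb ` tower T \<xi> \<inter> G" by (auto simp: openin_open)
  have "U \<subseteq> tower T \<xi>" using openin_subset[OF U] by (simp add: topspace_tower)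
  then have "{x \<in> space (restrict_space borel (emb ` tower T \<xi>)). unemb x \<in> U} = emb ` tower T \<xi> \<inter> G"
    using unemb_vimage G(2) by (simp add: space_restrict_space)
  then show "{x \<in> space (restrict_space borel (emb ` tower T \<xi>)). unemb x \<in> U} \<in> sets (restrict_space borel (emb ` tower T \<xi>))"
    using G(1) closed_emb_tower by (auto simp: sets_restrict_space_iff)
qed

lemma tower_function_extends:
  assumes "continuous_map ttop euclideanreal f" "bounded (f ` tower T \<xi>)"
  obtains F B where "continuous_on UNIV F" "\<And>p. p \<in> tower T \<xi> \<Longrightarrow> F (emb p) = f p" "\<And>x. \<bar>F x\<bar> \<le> (B::real)"
proof -
  obtain B where B: "0 \<le> B" "\<And>p. p \<in> tower T \<xi> \<Longrightarrow> \<bar>f p\<bar> \<le> B"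
    using assms(2) unfolding bounded_pos by (auto intro: less_imp_le)
  have "continuous_on (emb ` tower T \<xi>) (\<lambda>x. f (unemb x))"
    unfolding continuous_openin_preimage_eq
  proof (intro allI impI)
    fix S :: "real set" assume "open S"
    then have op: "openin ttop {q \<in> topspace ttop. f q \<in> S}" using assms(1) by (auto simp: continuous_map_def)
    have "emb ` tower T \<xi> \<inter> (\<lambda>x. f (unemb x)) -` S = emb ` {q \<in> topspace ttop. f q \<in> S}"
      using unemb_emb by (auto simp: topspace_tower)
    then show "openin (top_of_set (emb ` tower T \<xi>)) (emb ` tower T \<xi> \<inter> (\<lambda>x. f (unemb x)) -` S)"
      using openin_emb_image[OF op] by simp
  qed
  moreover have "norm (f (unemb x)) \<le> B" if "x \<in> emb ` tower T \<xi>" for x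
    using that B(2) unemb_emb by auto
  ultimately obtain F where "continuous_on UNIV F" "\<And>x. x \<in> emb ` tower T \<xi> \<Longrightarrow> F x = f (unemb x)"
    "\<And>x. norm (F x) \<le> B"
    using Tietze[of "emb ` tower T \<xi>" "\<lambda>x. f (unemb x)" UNIV B] B(1) closed_emb_tower by auto
  then show ?thesis using that[of F B] unemb_emb by auto
qed

section \<open>Tightness and the weak limit\<close>

lemma finite_between_interval_and_closure:
  fixes I :: "real set"
  assumes "open I" "is_interval I"
  shows "finite {D. I \<subseteq> D \<and> D \<subseteq> closure I}"
proof (rule finite_subset)
  show "{D. I \<subseteq> D \<and> D \<subseteq> closure I} \<subseteq> (\<lambda>X. I \<union> X) ` Pow (frontier I)"
  proof
    fix D assume D: "D \<in> {D. I \<subseteq> D \<and> D \<subseteq> closure I}"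
    have "D - I \<subseteq> frontier I" using D assms(1) by (auto simp: frontier_def interior_open)
    moreover have "D = I \<union> (D - I)" using D by auto
    ultimately show "D \<in> (\<lambda>X. I \<union> X) ` Pow (frontier I)" by blast
  qed
  show "finite ((\<lambda>X. I \<union> X) ` Pow (frontier I))" using finite_frontier_interval[OF assms(2)] by simp
qed

text \<open>The averaged measures on the line. The index is shifted by one, as the average of order 0 is
  not a probability measure.\<close>

definition emb_average :: "nat \<Rightarrow> real measure" where
  "emb_average n = distr (tower_average T \<xi> (Suc n)) borel emb"

lemma measurable_average: "borel_measurable (tower_average T \<xi> n) = borel_measurable tborel"
  by (rule measurable_cong_sets) (simp_all add: sets_tower_average)

lemma real_distribution_emb_average: "real_distribution (emb_average n)"
  unfolding emb_average_def
  by (rule real_distribution_distr_borel[OF prob_space_tower_average]) (simp_all add: measurable_average measurable_emb)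

lemma tight_emb_average:
  assumes H: "H1 T \<xi>" "H2 T \<xi>" "H3 T \<xi>" and \<mu>: "limit_acip T \<mu>"
  shows "tight emb_average"
proof (rule tight_of_eventually[OF real_distribution_emb_average])
  fix \<epsilon> :: real assume \<epsilon>: "0 < \<epsilon>"
  have half: "0 < \<epsilon> / 2" using \<epsilon> by simp
  obtain \<I> where I: "finite \<I>" "\<And>I. I \<in> \<I> \<Longrightarrow> open I \<and> is_interval I"
    "\<forall>\<^sub>F n in sequentially. (\<Sum>j<n. measure lam {x \<in> regular. img j x \<notin> \<I>}) \<le> \<epsilon> / 2 * real n"
    using finitely_many_images[OF H \<mu> half] by blast
  define F where "F = (\<Union>I\<in>\<I>. {D. I \<subseteq> D \<and> D \<subseteq> closure I})"
  have "finite F" unfolding F_def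
    by (intro finite_UN_I I(1) finite_between_interval_and_closure) (use I(2) in blast)+
  \<comment> \<open>The finitely many cells in \<open>F\<close> are embedded into \<open>[0, 2 S + 1]\<close>.\<close>
  define S where "S = (\<Sum>D\<in>F. to_nat_on cells D)"
  define K where "K = 2 * S + 2"
  define A where "A = {p \<in> tower T \<xi>. emb p \<notin> {- real K<..real K}}"
  have As: "A \<in> sets tborel"
  proof -
    have "emb -` (- {- real K<..real K}) \<inter> space tborel \<in> sets tborel"
      by (rule measurable_sets[OF measurable_emb]) auto
    moreover have "emb -` (- {- real K<..real K}) \<inter> space tborel = A" by (auto simp: A_def space_tborel)
    ultimately show ?thesis by simp
  qed
  have cell: "fst p \<notin> F" if "p \<in> A" for p
  proof
    assume "fst p \<in> F"
    then have "to_nat_on cells (fst p) \<le> S" unfolding S_def using \<open>finite F\<close> by (intro member_le_sum) auto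
    then have "2 * real (to_nat_on cells (fst p)) + 1 < real K" by (simp add: K_def)
    then have "emb p \<in> {- real K<..real K}" using emb_in_block[of p] that by (auto simp: A_def)
    then show False using that by (simp add: A_def)
  qed
  have law: "measure (lift_law j) A \<le> measure lam {x \<in> regular. img j x \<notin> \<I>}" for j
  proof -
    interpret prob_space lam by (rule prob_space_lam)
    have "measure (lift_law j) A = measure lam {x \<in> regular. lift j x \<in> A}"
      using emeasure_lift_law[OF As, of j] by (simp add: measure_def)
    also have "\<dots> \<le> measure lam {x \<in> regular. img j x \<notin> \<I>}"
    proof (rule finite_measure_mono)
      show "{x \<in> regular. lift j x \<in> A} \<subseteq> {x \<in> regular. img j x \<notin> \<I>}"
      proof safe
        fix x assume x: "x \<in> regular" "lift j x \<in> A" "img j x \<in> \<I>"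
        then have "fst (lift j x) \<in> F" using fst_lift_props[OF x(1), of j] by (auto simp: F_def)
        then show False using cell[OF x(2)] by simp
      qed
      have "open (\<Union>x\<in>{x \<in> regular. img j x \<notin> \<I>}. cyl j x)" using cyl_open by blast
      moreover have "{x \<in> regular. img j x \<notin> \<I>} = (\<Union>x\<in>{x \<in> regular. img j x \<notin> \<I>}. cyl j x) \<inter> regular"
      proof (intro set_eqI iffI)
        fix y assume "y \<in> {x \<in> regular. img j x \<notin> \<I>}"
        then show "y \<in> (\<Union>x\<in>{x \<in> regular. img j x \<notin> \<I>}. cyl j x) \<inter> regular" using cyl_self[of y j] by blast
      next
        fix y assume "y \<in> (\<Union>x\<in>{x \<in> regular. img j x \<notin> \<I>}. cyl j x) \<inter> regular"
        then obtain x where "x \<in> regular" "img j x \<notin> \<I>" "y \<in> cyl j x" "y \<in> regular" by blast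
        then show "y \<in> {x \<in> regular. img j x \<notin> \<I>}" using img_eq[of x y j] by simp
      qed
      ultimately show "{x \<in> regular. img j x \<notin> \<I>} \<in> sets lam"
        unfolding sets_lam_iff by (metis (no_types, lifting) borel_open inf_le2 regular_sets sets.Int)
    qed
    finally show ?thesis .
  qed
  have compl: "measure (emb_average n) {- real K<..real K} = 1 - (\<Sum>k<Suc n. measure (lift_law k) A) / real (Suc n)" for n
  proof -
    interpret a: prob_space "tower_average T \<xi> (Suc n)" by (rule prob_space_tower_average) simp
    have "measure (emb_average n) {- real K<..real K}
        = measure (tower_average T \<xi> (Suc n)) (emb -` {- real K<..real K} \<inter> space (tower_average T \<xi> (Suc n)))"
      unfolding emb_average_def by (rule measure_distr) (simp_all add: measurable_average measurable_emb)
    also have "emb -` {- real K<..real K} \<inter> space (tower_average T \<xi> (Suc n)) = space (tower_average T \<xi> (Suc n)) - A"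
      by (auto simp: A_def space_tower_average)
    also have "measure (tower_average T \<xi> (Suc n)) \<dots> = 1 - measure (tower_average T \<xi> (Suc n)) A"
      by (rule a.prob_compl) (simp add: sets_tower_average As)
    also have "measure (tower_average T \<xi> (Suc n)) A = (\<Sum>k<Suc n. measure (lift_law k) A) / real (Suc n)"
      by (rule measure_tower_average[OF As]) simp
    finally show ?thesis .
  qed
  have "\<forall>\<^sub>F n in sequentially. (\<Sum>j<Suc n. measure lam {x \<in> regular. img j x \<notin> \<I>}) \<le> \<epsilon> / 2 * real (Suc n)"
    using I(3) by (rule eventually_compose_filterlim[OF _ filterlim_Suc])
  then have "\<forall>\<^sub>F n in sequentially. 1 - \<epsilon> < measure (emb_average n) {- real K<..real K}"
  proof eventually_elim
    case (elim n)
    have "(\<Sum>k<Suc n. measure (lift_law k) A) \<le> (\<Sum>k<Suc n. measure lam {x \<in> regular. img k x \<notin> \<I>})"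
      by (intro sum_mono law)
    also have "\<dots> \<le> \<epsilon> / 2 * real (Suc n)" by (rule elim)
    finally have "(\<Sum>k<Suc n. measure (lift_law k) A) / real (Suc n) \<le> \<epsilon> / 2"
      by (subst pos_divide_le_eq) auto
    then show ?case unfolding compl using \<epsilon> by linarith
  qed
  then show "\<exists>K::nat. \<forall>\<^sub>F n in sequentially. 1 - \<epsilon> < measure (emb_average n) {- real K<..real K}" by blast
qed

lemma integral_emb_average:
  fixes F :: "real \<Rightarrow> real"
  assumes "F \<in> borel_measurable borel"
  shows "integral\<^sup>L (emb_average n) F = (\<integral>p. F (emb p) \<partial>tower_average T \<xi> (Suc n))"
  unfolding emb_average_def by (rule integral_distr) (use assms in \<open>simp_all add: measurable_average measurable_emb\<close>)

text \<open>The limit on the line is carried by the closed image of the tower, because the truncated distance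
  to that image has integral 0; so it can be pulled back.\<close>

lemma weak_limit_on_tower:
  assumes M: "real_distribution M" and conv: "weak_conv_m (\<lambda>j. emb_average (s j)) M"
  obtains \<mu>h where "sets \<mu>h = sets tborel" "prob_space \<mu>h"
    "tower_weak_star_conv T \<xi> (\<lambda>j. tower_average T \<xi> (Suc (s j))) \<mu>h"
proof -
  interpret real_distribution M by fact
  let ?E = "emb ` tower T \<xi>"
  have Es: "?E \<in> sets borel" using closed_emb_tower by simp
  define p0 where "p0 = (unit_ivl, 0::real)"
  have p0: "p0 \<in> tower T \<xi>" using unit_cell by (simp add: p0_def tower_def)
  then have Ene: "?E \<noteq> {}" by blast
  have weak: "(\<lambda>j. \<integral>p. F (emb p) \<partial>tower_average T \<xi> (Suc (s j))) \<longlonglongrightarrow> integral\<^sup>L M F"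
    if F: "continuous_on UNIV F" "\<And>x. \<bar>F x\<bar> \<le> (B::real)" for F B
  proof -
    have "(\<lambda>j. integral\<^sup>L (emb_average (s j)) F) \<longlonglongrightarrow> integral\<^sup>L M F"
      using F by (intro weak_conv_imp_integral_bdd_continuous_conv[OF real_distribution_emb_average M conv])
        (auto simp: continuous_on_eq_continuous_at)
    then show ?thesis using integral_emb_average[of F] F(1) by (simp add: borel_measurable_continuous_onI)
  qed
  define d where "d = (\<lambda>x. min 1 (infdist x ?E))"
  have d: "continuous_on UNIV d" "\<bar>d x\<bar> \<le> 1" "0 \<le> d x" for x
    by (auto simp: d_def infdist_nonneg intro!: continuous_intros)
  have "(\<integral>p. d (emb p) \<partial>tower_average T \<xi> n) = 0" for n
  proof -
    have "(\<integral>p. d (emb p) \<partial>tower_average T \<xi> n) = (\<integral>p. 0 \<partial>tower_average T \<xi> n)"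
      by (rule Bochner_Integration.integral_cong) (auto simp: space_tower_average d_def)
    then show ?thesis by simp
  qed
  then have "integral\<^sup>L M d = 0" using weak[OF d(1,2)] by (simp add: LIMSEQ_const_iff)
  moreover have "integrable M d"
    using d by (intro integrable_const_bound[of _ 1]) (auto simp: borel_measurable_continuous_onI)
  ultimately have "AE x in M. d x = 0"
    using integral_nonneg_eq_0_iff_AE[of M d] d(3) by simp
  then have AE_E: "AE x in M. x \<in> ?E"
  proof eventually_elim
    case (elim x)
    then have "infdist x ?E = 0" by (auto simp: d_def min_def split: if_splits)
    then show ?case using in_closed_iff_infdist_zero[OF closed_emb_tower Ene] by simp
  qed
  \<comment> \<open>The value off the image of the tower is irrelevant, but has to lie in the tower.\<close>
  define g where "g = (\<lambda>x. if x \<in> ?E then unemb x else p0)"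
  have g: "g \<in> measurable M tborel"
  proof -
    have "g \<in> measurable borel tborel"
      unfolding g_def
      by (rule measurable_If_restrict_space_iff[THEN iffD2])
        (use Es unemb_measurable p0 in \<open>auto simp: space_tborel\<close>)
    then show ?thesis by simp
  qed
  define \<mu>h where "\<mu>h = distr M tborel g"
  have "prob_space \<mu>h" unfolding \<mu>h_def by (rule prob_space_distr[OF g])
  moreover have "tower_weak_star_conv T \<xi> (\<lambda>j. tower_average T \<xi> (Suc (s j))) \<mu>h"
    unfolding tower_weak_star_conv_def
  proof (intro allI impI, elim conjE)
    fix f assume f: "continuous_map ttop euclideanreal f" "bounded (f ` tower T \<xi>)"
    have fm: "f \<in> borel_measurable tborel" by (rule continuous_measurable_tborel[OF f(1)])
    obtain F B where F: "continuous_on UNIV F" "\<And>p. p \<in> tower T \<xi> \<Longrightarrow> F (emb p) = f p" "\<And>x. \<bar>F x\<bar> \<le> (B::real)"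
      using tower_function_extends[OF f] by blast
    have "(\<integral>p. F (emb p) \<partial>tower_average T \<xi> n) = integral\<^sup>L (tower_average T \<xi> n) f" for n
      by (rule Bochner_Integration.integral_cong) (auto simp: space_tower_average F(2))
    moreover have "integral\<^sup>L M F = integral\<^sup>L \<mu>h f"
    proof -
      have "integral\<^sup>L \<mu>h f = (\<integral>x. f (g x) \<partial>M)" unfolding \<mu>h_def by (rule integral_distr[OF g fm])
      also have "\<dots> = integral\<^sup>L M F"
      proof (rule integral_cong_AE)
        show "(\<lambda>x. f (g x)) \<in> borel_measurable M" using measurable_compose[OF g fm] .
        show "F \<in> borel_measurable M" using F(1) by (simp add: borel_measurable_continuous_onI)
        show "AE x in M. f (g x) = F x" using AE_E by eventually_elim (auto simp: g_def unemb_emb F(2))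
      qed
      finally show ?thesis by simp
    qed
    ultimately show "(\<lambda>j. integral\<^sup>L (tower_average T \<xi> (Suc (s j))) f) \<longlonglongrightarrow> integral\<^sup>L \<mu>h f"
      using weak[OF F(1,3)] by simp
  qed
  ultimately show ?thesis using that[of \<mu>h] by (simp add: \<mu>h_def)
qed

section \<open>Projection of the limit\<close>

text \<open>Convergence in total variation gives convergence of the distribution functions at every point.\<close>

lemma projected_average_converges:
  assumes \<mu>: "limit_acip T \<mu>"
  shows "weak_conv_m (\<lambda>n. distr (tower_average T \<xi> (Suc n)) borel snd) (distr \<mu> borel (\<lambda>x. x))"
  unfolding weak_conv_m_def weak_conv_def
proof (intro allI impI)
  fix x :: real
  let ?A = "{..x} \<inter> unit_ivl"
  let ?m = "\<lambda>k. measure (orbit_law k) ?A"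
  have A: "?A \<in> sets borel" "?A \<subseteq> unit_ivl" by auto
  have avg: "cdf (distr (tower_average T \<xi> (Suc n)) borel snd) x = (\<Sum>k<Suc n. ?m k) / real (Suc n)" for n
  proof -
    have As: "snd -` {..x} \<inter> space tborel \<in> sets tborel" by (rule measurable_sets[OF measurable_snd_tower]) simp
    have "cdf (distr (tower_average T \<xi> (Suc n)) borel snd) x
        = measure (tower_average T \<xi> (Suc n)) (snd -` {..x} \<inter> space (tower_average T \<xi> (Suc n)))"
      unfolding cdf_def by (rule measure_distr) (simp_all add: measurable_average measurable_snd_tower)
    also have "\<dots> = measure (tower_average T \<xi> (Suc n)) (snd -` {..x} \<inter> space tborel)"
      by (simp add: space_tower_average space_tborel)
    also have "\<dots> = (\<Sum>k<Suc n. measure (lift_law k) (snd -` {..x} \<inter> space tborel)) / real (Suc n)"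
      by (rule measure_tower_average[OF As]) simp
    also have "(\<Sum>k<Suc n. measure (lift_law k) (snd -` {..x} \<inter> space tborel)) = (\<Sum>k<Suc n. ?m k)"
    proof (rule sum.cong[OF refl])
      fix k
      have "{y \<in> regular. lift k y \<in> snd -` {..x} \<inter> space tborel} = {y \<in> regular. (T ^^ k) y \<in> ?A}"
        using lift_tower[of _ k] funpow_unit[OF regular_unit, of _ k] by (auto simp: space_tborel snd_lift)
      then show "measure (lift_law k) (snd -` {..x} \<inter> space tborel) = ?m k"
        using emeasure_lift_law[OF As, of k] emeasure_lam_vimage[OF A, of k] by (simp add: measure_def)
    qed
    finally show ?thesis .
  qed
  have lim: "cdf (distr \<mu> borel (\<lambda>x. x)) x = measure \<mu> ?A"
  proof -
    have "(\<lambda>x. x) \<in> measurable \<mu> borel"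
    proof -
      have "(\<lambda>x. x) \<in> measurable leb_unit borel" by (simp add: measurable_restrict_space1)
      then show ?thesis using measurable_cong_sets[OF limit_acip_sets(1)[OF \<mu>] refl] by blast
    qed
    then have "cdf (distr \<mu> borel (\<lambda>x. x)) x = measure \<mu> ((\<lambda>x. x) -` {..x} \<inter> space \<mu>)"
      unfolding cdf_def by (rule measure_distr) simp
    also have "(\<lambda>x. x) -` {..x} \<inter> space \<mu> = ?A" by (auto simp: limit_acip_sets(2)[OF \<mu>])
    finally show ?thesis .
  qed
  have "(\<lambda>k. ?m k - measure \<mu> ?A) \<longlonglongrightarrow> 0"
    by (rule tendsto_rabs_zero_cancel, rule tendsto_sandwich[OF _ _ tendsto_const tv_orbit_law[OF \<mu>]])
      (intro always_eventually allI abs_ge_zero measure_orbit_law_tv[OF \<mu> A])+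
  then have "?m \<longlonglongrightarrow> measure \<mu> ?A" by (simp add: LIM_zero_iff)
  then have "(\<lambda>n. (\<Sum>k<Suc n. ?m k) / real (Suc n)) \<longlonglongrightarrow> measure \<mu> ?A"
    by (rule LIMSEQ_Suc[OF cesaro_mean_tendsto])
  then show "(\<lambda>n. cdf (distr (tower_average T \<xi> (Suc n)) borel snd) x) \<longlonglongrightarrow> cdf (distr \<mu> borel (\<lambda>x. x)) x"
    unfolding avg lim .
qed

text \<open>The projected averages converge weakly both to the projection of the limit and to \<open>\<mu>\<close>; weak
  limits are unique because the characteristic function determines a distribution.\<close>

lemma projection_of_limit:
  assumes \<mu>: "limit_acip T \<mu>" and \<mu>h: "sets \<mu>h = sets tborel" "prob_space \<mu>h" and s: "strict_mono s"
    and conv: "tower_weak_star_conv T \<xi> (\<lambda>j. tower_average T \<xi> (Suc (s j))) \<mu>h"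
  shows "distr \<mu>h leb_unit snd = \<mu>"
proof -
  let ?\<nu> = "\<lambda>j. distr (tower_average T \<xi> (Suc (s j))) borel snd"
  let ?P = "distr \<mu>h borel snd" let ?Q = "distr \<mu> borel (\<lambda>x. x)"
  have m\<mu>h: "borel_measurable \<mu>h = borel_measurable tborel" by (rule measurable_cong_sets) (simp_all add: \<mu>h(1))
  have sndm: "snd \<in> borel_measurable \<mu>h" "snd \<in> borel_measurable (tower_average T \<xi> n)" for n
    using measurable_snd_tower by (simp_all add: m\<mu>h measurable_average)
  have idm: "(\<lambda>x. x) \<in> measurable \<mu> borel"
  proof -
    have "(\<lambda>x. x) \<in> measurable leb_unit borel" by (simp add: measurable_restrict_space1)
    then show ?thesis using measurable_cong_sets[OF limit_acip_sets(1)[OF \<mu>] refl] by blast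
  qed
  have rd: "real_distribution (?\<nu> j)" "real_distribution ?P" "real_distribution ?Q" for j
    using real_distribution_distr_borel[OF prob_space_tower_average sndm(2)]
      real_distribution_distr_borel[OF \<mu>h(2) sndm(1)] real_distribution_distr_borel[OF _ idm] \<mu>
    by (auto simp: limit_acip_def)
  have toQ: "weak_conv_m ?\<nu> ?Q"
    using projected_average_converges[OF \<mu>] LIMSEQ_subseq_LIMSEQ[OF _ s]
    unfolding weak_conv_m_def weak_conv_def by (force simp: o_def)
  have toP: "weak_conv_m ?\<nu> ?P"
  proof (rule integral_bdd_continuous_conv_imp_weak_conv[OF rd(1,2)])
    fix f :: "real \<Rightarrow> real" assume f: "\<And>x. isCont f x" "\<And>x. \<bar>f x\<bar> \<le> 1"
    have fc: "continuous_on UNIV f" using f(1) by (simp add: continuous_on_eq_continuous_at)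
    then have fm: "f \<in> borel_measurable borel" by (rule borel_measurable_continuous_onI)
    have "continuous_map ttop euclideanreal (\<lambda>p. f (snd p))"
      by (rule continuous_map_towerI) (simp add: fc)
    moreover have "bounded ((\<lambda>p. f (snd p)) ` tower T \<xi>)" using f(2) by (auto simp: bounded_iff)
    ultimately have "(\<lambda>j. \<integral>p. f (snd p) \<partial>tower_average T \<xi> (Suc (s j))) \<longlonglongrightarrow> (\<integral>p. f (snd p) \<partial>\<mu>h)"
      using conv unfolding tower_weak_star_conv_def by blast
    then show "(\<lambda>j. integral\<^sup>L (?\<nu> j) f) \<longlonglongrightarrow> integral\<^sup>L ?P f"
      by (simp add: integral_distr[OF sndm(1) fm] integral_distr[OF sndm(2) fm])
  qed
  have "char ?P = char ?Q"
  proof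
    fix t
    show "char ?P t = char ?Q t"
      using levy_continuity1[OF rd(1,2) toP, of t] levy_continuity1[OF rd(1,3) toQ, of t]
      by (rule LIMSEQ_unique)
  qed
  then have PQ: "?P = ?Q" by (rule Levy_uniqueness[OF rd(2,3)])
  have sndu: "snd \<in> measurable \<mu>h leb_unit"
  proof -
    have "snd p \<in> unit_ivl" if "p \<in> space \<mu>h" for p
      using that snd_tower sets_eq_imp_space_eq[OF \<mu>h(1)] by (simp only: space_tborel)
    then have "snd \<in> measurable \<mu>h (restrict_space borel unit_ivl)"
      using sndm(1) by (intro measurable_restrict_space2) auto
    moreover have "sets leb_unit = sets (restrict_space borel unit_ivl)" by (simp add: sets_restrict_space)
    ultimately show ?thesis using measurable_cong_sets[OF refl, of leb_unit "restrict_space borel unit_ivl" \<mu>h] by blast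
  qed
  show ?thesis
  proof (rule measure_eqI)
    show "sets (distr \<mu>h leb_unit snd) = sets \<mu>" by (simp add: limit_acip_sets(1)[OF \<mu>])
    fix A assume "A \<in> sets (distr \<mu>h leb_unit snd)"
    then have A: "A \<in> sets leb_unit" by simp
    then have A': "A \<subseteq> unit_ivl" "A \<in> sets borel" by (simp_all add: sets_leb_unit_iff)
    have "emeasure (distr \<mu>h leb_unit snd) A = emeasure \<mu>h (snd -` A \<inter> space \<mu>h)" by (rule emeasure_distr[OF sndu A])
    also have "\<dots> = emeasure ?P A" by (rule emeasure_distr[OF sndm(1) A'(2), symmetric])
    also have "\<dots> = emeasure \<mu> ((\<lambda>x. x) -` A \<inter> space \<mu>)" unfolding PQ by (rule emeasure_distr[OF idm A'(2)])
    also have "(\<lambda>x. x) -` A \<inter> space \<mu> = A" using A'(1) by (auto simp: limit_acip_sets(2)[OF \<mu>])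
    finally show "emeasure (distr \<mu>h leb_unit snd) A = emeasure \<mu> A" .
  qed
qed

end

theorem lemma5p3:
  fixes T :: "real \<Rightarrow> real" and \<xi> :: "real set set" and \<mu> :: "real measure"
  assumes "piecewise_monotone_map T \<xi>"
    and "H1 T \<xi>" and "H2 T \<xi>" and "H3 T \<xi>"
    and "limit_acip T \<mu>"
  shows "\<exists>(r :: nat \<Rightarrow> nat) (\<mu>h :: (real set \<times> real) measure).
           strict_mono r \<and> (\<forall>j. 1 \<le> r j) \<and>
           sets \<mu>h = sets (tower_borel T \<xi>) \<and> prob_space \<mu>h \<and>
           tower_weak_star_conv T \<xi> (\<lambda>j. tower_average T \<xi> (r j)) \<mu>h \<and>
           distr \<mu>h leb_unit snd = \<mu>"
proof -
  interpret interval_map T \<xi> by (unfold_locales) (rule assms(1))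
  obtain s M where s: "strict_mono (s :: nat \<Rightarrow> nat)" "real_distribution M"
    "weak_conv_m (emb_average \<circ> (\<lambda>n. n) \<circ> s) M"
    using tight_imp_convergent_subsubsequence[OF tight_emb_average[OF assms(2-5)], of "\<lambda>n. n"]
    by (auto simp: strict_mono_def)
  then have "weak_conv_m (\<lambda>j. emb_average (s j)) M" by (simp add: o_def)
  then obtain \<mu>h where \<mu>h: "sets \<mu>h = sets tborel" "prob_space \<mu>h"
    "tower_weak_star_conv T \<xi> (\<lambda>j. tower_average T \<xi> (Suc (s j))) \<mu>h"
    by (rule weak_limit_on_tower[OF s(2)])
  have "distr \<mu>h leb_unit snd = \<mu>" by (rule projection_of_limit[OF assms(5) \<mu>h(1,2) s(1) \<mu>h(3)])
  moreover have "strict_mono (\<lambda>j. Suc (s j))" using s(1) by (simp add: strict_mono_def)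
  ultimately show ?thesis using \<mu>h by (intro exI[of _ "\<lambda>j. Suc (s j)"] exI[of _ \<mu>h]) auto
qed

end
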